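(* Let $\mathcal T$ be a self-similar tiling in $\mathbb R^d$ with (single) generator $G$ of inradius $g$, and suppose a Steiner-like representation $V(G,\varepsilon)=\sum_{k=0}^d\kappa_k(G,\varepsilon)\varepsilon^{d-k}$ ($0<\varepsilon\le g$) for $G$ has been chosen. Let $S$ be a screen with $S(0)<0$ and let $W$ be the associated window. Assume that the visible poles (those in $W$) of the tubular zeta function are simple (which implies that $\mathcal D_{\mathcal L}(W)$ and $\{0,1,\dots,d\}$ are disjoint). Then for all $\varepsilon>0$, $$V(\mathcal T,\varepsilon)=\sum_{\omega\in\mathcal D_{\mathcal L}(W)}c_\omega\varepsilon^{d-\omega}+\sum_{k\in\{0,1,\dots,d\}\cap W}\bigl(c_k+e_k(\varepsilon)\bigr)\varepsilon^{d-k}+\mathcal R(\varepsilon),$$ where $$\mathcal R(\varepsilon)=\frac1{2\pi i}\int_S\frac{\varepsilon^{d-s}\zeta_{\mathcal L}(s)}{d-s}\left(\sum_{k=0}^{d-1}\frac{g^{s-k}}{s-k}(d-k)\kappa_k(G)\right)ds,$$ $$c_\omega:=\frac{\operatorname{Res}_{s=\omega}\zeta_{\mathcal L}(s)}{d-\omega}\sum_{k=0}^{d-1}\frac{g^{\omega-k}(d-k)}{\omega-k}\kappa_k(G)\quad(\omega\in\mathcal D_{\mathcal L}(W)),$$ $$c_k:=\kappa_k(G)\,\zeta_{\mathcal L}(k),\qquad e_k(\varepsilon):=\sum_{j=1}^{J(\varepsilon)}\ell_j^k\bigl(\kappa_k(G,\ell_j^{-1}\varepsilon)-\kappa_k(G)\bigr)\quad(k=0,1,\dots,d),$$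 and $J(\varepsilon):=\max\bigl(\{j\ge1:\ell_j^{-1}\varepsilon<g\}\cup\{0\}\bigr)$. Moreover, if $G$ is monophase, then the formula holds for any screen $S$ which avoids the set $\{0,1,\dots,d\}$ (without requiring $S(0)<0$), and it takes the simpler form $$V(\mathcal T,\varepsilon)=\sum_{\omega\in\mathcal D_{\mathcal L}(W)}c_\omega\varepsilon^{d-\omega}+\sum_{k\in\{0,1,\dots,d\}\cap W}c_k\varepsilon^{d-k}+\mathcal R(\varepsilon),\qquad\mathcal R(\varepsilon)=\frac1{2\pi i}\int_S\zeta_{\mathcal T}(\varepsilon,s)\,ds.$$
   Context: Self-similar tilings. Let $\{\Phi_1,\dots,\Phi_N\}$, $N\ge2$, be contractive similarities of $\mathbb R^d$ with scaling ratios $r_n\in(0,1)$, $\Phi(A):=\bigcup_n\Phi_n(A)$, and $F$ the attractor (the unique nonempty compact set with $F=\Phi(F)$). A feasible open set is a nonempty open $O\subseteq\mathbb R^d$ (bounded here) with $\Phi_n(O)\subseteq O$ for all $n$ and $\Phi_n(O)\cap\Phi_m(O)=\emptyset$ for $n\ne m$; the open set condition says that one exists. The nontriviality condition says that $O\not\subseteq\Phi(\overline O)$ for some feasible $O$ (this does not depend on the choice of $O$). Both conditions are always assumed. The self-similar tiling associated with $\{\Phi_n\}$ and $O$ is $\mathcal T=\{\Phi_w(G_q)\}$, where the $G_q$ are the connected components of $O\setminus\Phi(\overline O)$ and $w=w_1\cdots w_n$ runs over all finite words (including the empty word) in $\{1,\dots,N\}$, with $\Phi_w=\Phi_{w_1}\circ\cdots\circ\Phi_{w_n}$,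 $r_w=r_{w_1}\cdots r_{w_n}$ ($\Phi_w=\mathrm{Id}$, $r_w=1$ for the empty word). Here there is a single component $G$ (the generator). The words are ordered as $w^{(1)},w^{(2)},\dots$ so that $\ell_j:=r_{w^{(j)}}$ is nonincreasing; $\mathcal L=\{\ell_j\}$ is the associated fractal string ($\ell_1=1$), and the tiles are $G^j=\Phi_{w^{(j)}}(G)$. Inner parallel volumes. $\lambda_d$ is Lebesgue measure. For bounded open $A\subseteq\mathbb R^d$ and $\varepsilon>0$, $A_{-\varepsilon}:=\{x\in A:\operatorname{dist}(x,A^c)\le\varepsilon\}$, $V(A,\varepsilon):=\lambda_d(A_{-\varepsilon})$, and $V(\mathcal T,\varepsilon):=\lambda_d(T_{-\varepsilon})=\sum_jV(G^j,\varepsilon)$ with $T=\bigcup_jG^j$. The inradius $g$ of $G$ is the radius of the largest open ball contained in $G$. Steiner-like representation. This is an expression $V(G,\varepsilon)=\sum_{k=0}^d\kappa_k(G,\varepsilon)\varepsilon^{d-k}$ for $0<\varepsilon\le g$, where each $\kappa_k(G,\cdot)$ is a real-valued function on $(0,g]$ bounded on $[\varepsilon_0,g]$ for every $\varepsilon_0\in(0,g]$. Put $\kappa_k(G):=\kappa_k(G,g)$ and extend by $\kappa_k(G,\varepsilon):=\kappa_k(G)$ for $\varepsilon\ge g$. $G$ is monophase if it has such a representation with constant coefficient functions $\kappa_k(G,\varepsilon)=\kappa_k(G)$; this representation is then always the one used. Zeta functions. $\zeta_{\mathcal L}(s)=\sum_j\ell_j^s$ for $\Re s>D$ ($D$ the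 abscissa of convergence, the unique real root of $\sum_nr_n^s=1$), with meromorphic continuation $\zeta_{\mathcal L}(s)=1/(1-\sum_{n=1}^Nr_n^s)$ to $\mathbb C$. The tubular zeta function is (the meromorphic extension in $s$ to $\mathbb C$ of) $$\zeta_{\mathcal T}(\varepsilon,s)=\varepsilon^{d-s}\sum_{j=1}^\infty\ell_j^s\left(\sum_{k=0}^d\frac{g^{s-k}}{s-k}\kappa_k(G,\ell_j^{-1}\varepsilon)-\frac{g^{s-d}}{s-d}\lambda_d(G)\right).$$ Screens. A screen is the contour $S=\{S(t)+it:t\in\mathbb R\}$, where $S:\mathbb R\to(-\infty,D]$ is a bounded Lipschitz function, chosen so that no pole of $\zeta_{\mathcal L}$ lies on $S$. The window is $W=\{z:\Re z\ge S(\Im z)\}$. $\int_S$ is taken upwards: $\int_Sf(s)\,ds=\int_{\mathbb R}f(S(t)+it)(S'(t)+i)\,dt$. $\mathcal D_{\mathcal L}(W)$ is the set of poles of $\zeta_{\mathcal L}$ in $W$. The visible (potential) poles of $\zeta_{\mathcal T}$ are the elements of $\mathcal D_{\mathcal L}(W)\cup(\{0,1,\dots,d\}\cap W)$; "the visible poles of the tubular zeta function are simple" is understood to mean that all poles of $\zeta_{\mathcal L}$ in $W$ are simple and $\mathcal D_{\mathcal L}(W)\cap\{0,1,\dots,d\}=\emptyset$. Convention. An infinite sum over complex dimensions is understood as $\lim_{n\to\infty}$ of the sums over those $\omega$ with $T_{-n}<\Im\omega<T_n$, where $\{T_n\}_{n\in\mathbb Z}$ is a real sequence with $T_{-n}<0<T_n$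 ($n\ge1$), $T_n\to\infty$, $T_{-n}\to-\infty$, $T_n/|T_{-n}|\to1$, along which $\zeta_{\mathcal L}$ is languid of order $0$: for some $c>0$, $|\zeta_{\mathcal L}(\alpha+iT_n)|\le c$ for all $n$ and all $\alpha\in\mathbb R$ (such sequences exist for self-similar strings).
   Formalization: A screen may approach poles so fast that the integral over S diverges; the formula is shown whenever that integral converges absolutely (proved if the string's zeta function is bounded on S), and for every screen with sum and integral truncated at the same heights. *)

theory Defs
  imports "HOL-Complex_Analysis.Complex_Analysis"
begin

text \<open>
  The ambient space \<open>\<real>\<^sup>d\<close> is a type of class \<open>euclidean_space\<close>, with \<open>d = DIM('a)\<close>. The maps are
  indexed by \<open>{1..N}\<close>, words are lists over \<open>{1..N}\<close>, and the enumeration of the words starts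
  at 1.
\<close>

subsection \<open>Self-similar tilings\<close>

definition contractive_similarities ::
    "nat \<Rightarrow> (nat \<Rightarrow> 'a::euclidean_space \<Rightarrow> 'a) \<Rightarrow> (nat \<Rightarrow> real) \<Rightarrow> bool" where
  "contractive_similarities N \<Phi> r \<longleftrightarrow> 2 \<le> N \<and>
     (\<forall>n\<in>{1..N}. 0 < r n \<and> r n < 1 \<and> (\<forall>x y. dist (\<Phi> n x) (\<Phi> n y) = r n * dist x y))"

definition set_map :: "nat \<Rightarrow> (nat \<Rightarrow> 'a \<Rightarrow> 'a) \<Rightarrow> 'a set \<Rightarrow> 'a set" where
  "set_map N \<Phi> A = (\<Union>n\<in>{1..N}. \<Phi> n ` A)"

definition feasible_open_set ::
    "nat \<Rightarrow> (nat \<Rightarrow> 'a::euclidean_space \<Rightarrow> 'a) \<Rightarrow> 'a set \<Rightarrow> bool" where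
  "feasible_open_set N \<Phi> U \<longleftrightarrow> open U \<and> bounded U \<and> U \<noteq> {} \<and>
     (\<forall>n\<in>{1..N}. \<Phi> n ` U \<subseteq> U) \<and>
     (\<forall>n\<in>{1..N}. \<forall>m\<in>{1..N}. n \<noteq> m \<longrightarrow> \<Phi> n ` U \<inter> \<Phi> m ` U = {})"

definition nontriviality_condition ::
    "nat \<Rightarrow> (nat \<Rightarrow> 'a::euclidean_space \<Rightarrow> 'a) \<Rightarrow> bool" where
  "nontriviality_condition N \<Phi> \<longleftrightarrow>
     (\<exists>U. feasible_open_set N \<Phi> U \<and> \<not> U \<subseteq> set_map N \<Phi> (closure U))"

definition word_map :: "(nat \<Rightarrow> 'a \<Rightarrow> 'a) \<Rightarrow> nat list \<Rightarrow> 'a \<Rightarrow> 'a" where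
  "word_map \<Phi> w = foldr (\<lambda>n f. \<Phi> n \<circ> f) w id"

definition word_ratio :: "(nat \<Rightarrow> real) \<Rightarrow> nat list \<Rightarrow> real" where
  "word_ratio r w = prod_list (map r w)"

definition generators ::
    "nat \<Rightarrow> (nat \<Rightarrow> 'a::euclidean_space \<Rightarrow> 'a) \<Rightarrow> 'a set \<Rightarrow> 'a set set" where
  "generators N \<Phi> U = components (U - set_map N \<Phi> (closure U))"

definition tiling ::
    "nat \<Rightarrow> (nat \<Rightarrow> 'a::euclidean_space \<Rightarrow> 'a) \<Rightarrow> 'a set \<Rightarrow> 'a set set" where
  "tiling N \<Phi> U = {word_map \<Phi> w ` C | w C. w \<in> lists {1..N} \<and> C \<in> generators N \<Phi> U}"

definition word_ordering :: "nat \<Rightarrow> (nat \<Rightarrow> real) \<Rightarrow> (nat \<Rightarrow> nat list) \<Rightarrow> bool" where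
  "word_ordering N r wd \<longleftrightarrow> bij_betw wd {1..} (lists {1..N}) \<and>
     (\<forall>i j. 1 \<le> i \<and> i \<le> j \<longrightarrow> word_ratio r (wd j) \<le> word_ratio r (wd i))"

subsection \<open>Inner parallel volumes and Steiner-like representations\<close>

definition inner_volume :: "'a::euclidean_space set \<Rightarrow> real \<Rightarrow> real" where
  "inner_volume A \<epsilon> = measure lebesgue {x \<in> A. infdist x (- A) \<le> \<epsilon>}"

text \<open>For nonempty bounded open sets this supremum is attained.\<close>

definition inradius :: "'a::euclidean_space set \<Rightarrow> real" where
  "inradius A = Sup {\<rho>. 0 \<le> \<rho> \<and> (\<exists>x. ball x \<rho> \<subseteq> A)}"

definition steiner_representation ::
    "'a::euclidean_space set \<Rightarrow> (nat \<Rightarrow> real \<Rightarrow> real) \<Rightarrow> bool" where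
  "steiner_representation G \<kappa> \<longleftrightarrow>
     (\<forall>\<epsilon>\<in>{0<..inradius G}. inner_volume G \<epsilon> = (\<Sum>k=0..DIM('a). \<kappa> k \<epsilon> * \<epsilon> ^ (DIM('a) - k))) \<and>
     (\<forall>k\<le>DIM('a). \<forall>\<epsilon>\<^sub>0\<in>{0<..inradius G}. bounded (\<kappa> k ` {\<epsilon>\<^sub>0..inradius G}))"

text \<open>
  A set is monophase if it has such a representation. The constants are then determined by the
  set, since the inner volume is a polynomial on \<open>(0, g]\<close>.
\<close>

definition monophase_representation ::
    "'a::euclidean_space set \<Rightarrow> (nat \<Rightarrow> real \<Rightarrow> real) \<Rightarrow> bool" where
  "monophase_representation G \<kappa> \<longleftrightarrow> steiner_representation G \<kappa> \<and>
     (\<forall>k\<le>DIM('a). \<forall>\<epsilon>\<in>{0<..inradius G}. \<kappa> k \<epsilon> = \<kappa> k (inradius G))"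

text \<open>The extension of \<open>\<kappa> k\<close> from \<open>(0, g]\<close> to \<open>(0, \<infinity>)\<close> by the constant value \<open>\<kappa> k g\<close>.\<close>

definition extended_coeff ::
    "'a::euclidean_space set \<Rightarrow> (nat \<Rightarrow> real \<Rightarrow> real) \<Rightarrow> nat \<Rightarrow> real \<Rightarrow> real" where
  "extended_coeff G \<kappa> k \<epsilon> = \<kappa> k (min \<epsilon> (inradius G))"

subsection \<open>Zeta functions\<close>

text \<open>
  \<open>nicely_meromorphic_on\<close> fixes the value 0 at poles and removes removable singularities, so
  that a meromorphic extension to the plane is unique as a total function.
\<close>

definition meromorphic_extension ::
    "complex set \<Rightarrow> (complex \<Rightarrow> complex) \<Rightarrow> complex \<Rightarrow> complex" where
  "meromorphic_extension A f =
     (THE h. h nicely_meromorphic_on UNIV \<and> (\<forall>s\<in>A. h s = f s))"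

definition similarity_dimension :: "nat \<Rightarrow> (nat \<Rightarrow> real) \<Rightarrow> real" where
  "similarity_dimension N r = (THE t. (\<Sum>n=1..N. r n powr t) = 1)"

definition string_zeta ::
    "nat \<Rightarrow> (nat \<Rightarrow> real) \<Rightarrow> (nat \<Rightarrow> real) \<Rightarrow> complex \<Rightarrow> complex" where
  "string_zeta N r l =
     meromorphic_extension {s. similarity_dimension N r < Re s}
       (\<lambda>s. \<Sum>j. of_real (l (Suc j)) powr s)"

text \<open>
  The points \<open>0, \<dots>, d\<close>, where the summands may have poles, are excluded from the set on
  which the extension has to agree with the series.
\<close>

definition tubular_zeta ::
    "nat \<Rightarrow> (nat \<Rightarrow> real) \<Rightarrow> (nat \<Rightarrow> real) \<Rightarrow> 'a::euclidean_space set \<Rightarrow>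
     (nat \<Rightarrow> real \<Rightarrow> real) \<Rightarrow> real \<Rightarrow> complex \<Rightarrow> complex" where
  "tubular_zeta N r l G \<kappa> \<epsilon> =
     meromorphic_extension
       ({s. similarity_dimension N r < Re s} - of_nat ` {0..DIM('a)})
       (\<lambda>s. of_real \<epsilon> powr (of_nat DIM('a) - s) *
          (\<Sum>j. of_real (l (Suc j)) powr s *
            ((\<Sum>k=0..DIM('a). of_real (inradius G) powr (s - of_nat k) / (s - of_nat k)
                * of_real (extended_coeff G \<kappa> k (\<epsilon> / l (Suc j))))
             - of_real (inradius G) powr (s - of_nat DIM('a)) / (s - of_nat DIM('a))
                * of_real (measure lebesgue G))))"

subsection \<open>Screens and windows\<close>

definition screen :: "(complex \<Rightarrow> complex) \<Rightarrow> real \<Rightarrow> (real \<Rightarrow> real) \<Rightarrow> bool" where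
  "screen \<zeta> D S \<longleftrightarrow> (\<forall>t. S t \<le> D) \<and> bounded (range S) \<and> (\<exists>C. C-lipschitz_on UNIV S) \<and>
     (\<forall>t. \<not> is_pole \<zeta> (Complex (S t) t))"

definition window :: "(real \<Rightarrow> real) \<Rightarrow> complex set" where
  "window S = {z. S (Im z) \<le> Re z}"

definition visible_dims :: "(complex \<Rightarrow> complex) \<Rightarrow> (real \<Rightarrow> real) \<Rightarrow> complex set" where
  "visible_dims \<zeta> S = {\<omega> \<in> window S. is_pole \<zeta> \<omega>}"

definition visible_integer_dims :: "nat \<Rightarrow> (real \<Rightarrow> real) \<Rightarrow> nat set" where
  "visible_integer_dims d S = {k \<in> {0..d}. of_nat k \<in> window S}"

definition simple_visible_poles :: "(complex \<Rightarrow> complex) \<Rightarrow> nat \<Rightarrow> (real \<Rightarrow> real) \<Rightarrow> bool" where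
  "simple_visible_poles \<zeta> d S \<longleftrightarrow>
     (\<forall>\<omega>\<in>visible_dims \<zeta> S. zorder \<zeta> \<omega> = -1) \<and> visible_dims \<zeta> S \<inter> of_nat ` {0..d} = {}"

text \<open>
  A Lipschitz function is differentiable almost everywhere, so the (unspecified) value of
  \<open>deriv S\<close> at the remaining points is irrelevant.
\<close>

definition screen_integrand ::
    "(real \<Rightarrow> real) \<Rightarrow> (complex \<Rightarrow> complex) \<Rightarrow> real \<Rightarrow> complex" where
  "screen_integrand S f t = f (Complex (S t) t) * (of_real (deriv S t) + \<i>)"

definition screen_integrable :: "(real \<Rightarrow> real) \<Rightarrow> (complex \<Rightarrow> complex) \<Rightarrow> bool" where
  "screen_integrable S f \<longleftrightarrow> integrable lebesgue (screen_integrand S f)"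

definition screen_integral :: "(real \<Rightarrow> real) \<Rightarrow> (complex \<Rightarrow> complex) \<Rightarrow> complex" where
  "screen_integral S f = (LINT t|lebesgue. screen_integrand S f t)"

definition truncated_screen_integral ::
    "real \<Rightarrow> real \<Rightarrow> (real \<Rightarrow> real) \<Rightarrow> (complex \<Rightarrow> complex) \<Rightarrow> complex" where
  "truncated_screen_integral a b S f = (LINT t:{a..b}|lebesgue. screen_integrand S f t)"

definition languid_heights :: "(complex \<Rightarrow> complex) \<Rightarrow> (int \<Rightarrow> real) \<Rightarrow> bool" where
  "languid_heights \<zeta> T \<longleftrightarrow>
     (\<forall>n\<ge>1. T (- n) < 0 \<and> 0 < T n) \<and>
     filterlim (\<lambda>n. T (int n)) at_top sequentially \<and>
     filterlim (\<lambda>n. T (- int n)) at_bot sequentially \<and>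
     (\<lambda>n. T (int n) / \<bar>T (- int n)\<bar>) \<longlonglongrightarrow> 1 \<and>
     (\<exists>c>0. \<forall>n. \<forall>\<alpha>. norm (\<zeta> (Complex \<alpha> (T n))) \<le> c)"

definition truncated_dims_sum ::
    "(int \<Rightarrow> real) \<Rightarrow> complex set \<Rightarrow> (complex \<Rightarrow> complex) \<Rightarrow> nat \<Rightarrow> complex" where
  "truncated_dims_sum T P a n = (\<Sum>\<omega>\<in>{\<omega>\<in>P. T (- int n) < Im \<omega> \<and> Im \<omega> < T (int n)}. a \<omega>)"

text \<open>
  The assertion \<open>v = (\<Sum>\<omega>\<in>P. a \<omega>) + 1/(2\<pi>i) \<integral>\<^sub>S f(s) ds\<close>, with the infinite sum understood as the
  limit of the sums truncated at the heights \<open>T\<close>. A screen that only has to avoid the poles of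
  \<open>\<zeta>\<close> may approach them arbitrarily fast at infinity, in which case the integrals that occur
  here can diverge (already for the Cantor string), so existence of the integral is made
  explicit:
  (1) it exists if \<open>\<zeta>\<close> is bounded on the screen (is languid of order 0 there);
  (2) whenever it exists, the sum converges and the identity holds;
  (3) on every screen the identity holds with sum and integral truncated at the same heights.
\<close>

definition dims_expansion ::
    "(complex \<Rightarrow> complex) \<Rightarrow> (int \<Rightarrow> real) \<Rightarrow> (real \<Rightarrow> real) \<Rightarrow> complex set \<Rightarrow>
     (complex \<Rightarrow> complex) \<Rightarrow> (complex \<Rightarrow> complex) \<Rightarrow> complex \<Rightarrow> bool" where
  "dims_expansion \<zeta> T S P a f v \<longleftrightarrow>
     (bounded (range (\<lambda>t. \<zeta> (Complex (S t) t))) \<longrightarrow> screen_integrable S f) \<and>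
     (screen_integrable S f \<longrightarrow>
        truncated_dims_sum T P a \<longlonglongrightarrow> v - 1 / (2 * of_real pi * \<i>) * screen_integral S f) \<and>
     (\<lambda>n. truncated_dims_sum T P a n + 1 / (2 * of_real pi * \<i>) *
            truncated_screen_integral (T (- int n)) (T (int n)) S f) \<longlonglongrightarrow> v"

subsection \<open>The terms of the tube formula\<close>

definition error_integrand ::
    "(complex \<Rightarrow> complex) \<Rightarrow> 'a::euclidean_space set \<Rightarrow> (nat \<Rightarrow> real \<Rightarrow> real) \<Rightarrow>
     real \<Rightarrow> complex \<Rightarrow> complex" where
  "error_integrand \<zeta> G \<kappa> \<epsilon> s =
     of_real \<epsilon> powr (of_nat DIM('a) - s) * \<zeta> s / (of_nat DIM('a) - s) *
     (\<Sum>k=0..DIM('a)-1. of_real (inradius G) powr (s - of_nat k) / (s - of_nat k)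
        * of_nat (DIM('a) - k) * of_real (\<kappa> k (inradius G)))"

definition dim_coeff ::
    "(complex \<Rightarrow> complex) \<Rightarrow> 'a::euclidean_space set \<Rightarrow> (nat \<Rightarrow> real \<Rightarrow> real) \<Rightarrow>
     complex \<Rightarrow> complex" where
  "dim_coeff \<zeta> G \<kappa> \<omega> =
     residue \<zeta> \<omega> / (of_nat DIM('a) - \<omega>) *
     (\<Sum>k=0..DIM('a)-1. of_real (inradius G) powr (\<omega> - of_nat k) * of_nat (DIM('a) - k)
        / (\<omega> - of_nat k) * of_real (\<kappa> k (inradius G)))"

definition integer_coeff ::
    "(complex \<Rightarrow> complex) \<Rightarrow> 'a::euclidean_space set \<Rightarrow> (nat \<Rightarrow> real \<Rightarrow> real) \<Rightarrow>
     nat \<Rightarrow> complex" where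
  "integer_coeff \<zeta> G \<kappa> k = of_real (\<kappa> k (inradius G)) * \<zeta> (of_nat k)"

definition scale_cutoff :: "(nat \<Rightarrow> real) \<Rightarrow> 'a::euclidean_space set \<Rightarrow> real \<Rightarrow> nat" where
  "scale_cutoff l G \<epsilon> = Max ({j. 1 \<le> j \<and> \<epsilon> / l j < inradius G} \<union> {0})"

definition fluctuation ::
    "(nat \<Rightarrow> real) \<Rightarrow> 'a::euclidean_space set \<Rightarrow> (nat \<Rightarrow> real \<Rightarrow> real) \<Rightarrow> nat \<Rightarrow> real \<Rightarrow> real" where
  "fluctuation l G \<kappa> k \<epsilon> =
     (\<Sum>j=1..scale_cutoff l G \<epsilon>.
        l j ^ k * (extended_coeff G \<kappa> k (\<epsilon> / l j) - \<kappa> k (inradius G)))"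

end

theory Submission
  imports Defs
begin

text \<open>
  Two ingredients give the formula: an exact expression of the inner parallel volume as an
  integral over one vertical line, and a shift of the line of integration to the screen.

  \<^bold>\<open>The volume.\<close> The tiles \<open>\<Phi>\<^sub>w(G)\<close> are pairwise disjoint open sets, so the inner parallel volume of
  their union is \<open>\<Sum>\<^sub>j \<ell>\<^sub>j\<^sup>d V(G, \<epsilon>/\<ell>\<^sub>j)\<close> (lemma \<open>inner_volume_tiling_sums\<close>). A tile with \<open>\<epsilon>/\<ell>\<^sub>j \<ge> g\<close>
  contributes its whole volume, and \<open>\<lambda>(G) = V(G, g) = \<Sum>\<^sub>k \<kappa>\<^sub>k g\<^sup>d\<^sup>-\<^sup>k\<close>; a tile with \<open>\<epsilon>/\<ell>\<^sub>j < g\<close>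
  contributes a Steiner-like sum. Splitting off the finitely many differences \<open>\<kappa>\<^sub>k(\<epsilon>/\<ell>\<^sub>j) - \<kappa>\<^sub>k\<close>,
  which make up the terms \<open>e\<^sub>k(\<epsilon>)\<close>, leaves \<open>\<Sum>\<^sub>k \<kappa>\<^sub>k \<Sum>\<^sub>j h\<^sub>k(\<ell>\<^sub>j)\<close>, where \<open>h\<^sub>k(x)\<close> is \<open>x\<^sup>k \<epsilon>\<^sup>d\<^sup>-\<^sup>k\<close> if \<open>\<epsilon>/x < g\<close>
  and \<open>x\<^sup>d g\<^sup>d\<^sup>-\<^sup>k\<close> otherwise.

  \<^bold>\<open>The vertical line.\<close> For \<open>k < d\<close> the function \<open>h\<^sub>k\<close> is a Mellin inverse: for \<open>k < c < d\<close>,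
  \<open>2\<pi>i h\<^sub>k(x)\<close> is the integral of \<open>\<epsilon>\<^sup>d\<^sup>-\<^sup>s x\<^sup>s g\<^sup>s\<^sup>-\<^sup>k (d-k) / ((s-k)(d-s))\<close> over the line \<open>Re s = c\<close>
  (lemma \<open>mellin_kernel_integral\<close>).
  Comparing volumes gives \<open>\<Sum>\<^sub>n r\<^sub>n\<^sup>d < 1\<close>, hence \<open>D < d\<close>, so that one \<open>c\<close> with \<open>max D (d-1) < c < d\<close>
  serves every \<open>k < d\<close> and \<open>\<Sum>\<^sub>j \<ell>\<^sub>j\<^sup>s\<close> converges absolutely on the line. Summation over \<open>j\<close> yields
  the integral of \<open>\<zeta>(s) B(s)\<close>, where \<open>\<zeta> B\<close> is the integrand of the error term; the index \<open>k = d\<close> adds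
  \<open>\<kappa>\<^sub>d \<zeta>(d) = c\<^sub>d\<close> (lemma \<open>tube_formula_vertical_line\<close>).

  \<^bold>\<open>The screen.\<close> Between the screen and the line, \<open>\<zeta> B\<close> has simple poles at the visible complex
  dimensions, with residues \<open>c\<^sub>\<omega> \<epsilon>\<^sup>d\<^sup>-\<^sup>\<omega>\<close>, and at the visible integers \<open>k < d\<close>, with residues
  \<open>c\<^sub>k \<epsilon>\<^sup>d\<^sup>-\<^sup>k\<close>. At the heights \<open>T\<^sub>n\<close> the zeta function is bounded while \<open>B\<close> decays quadratically, so
  the horizontal segments vanish in the limit (lemma \<open>error_integrand_dims_expansion\<close>). A screen
  is only a Lipschitz graph. Integration along it uses that a Lipschitz function of one variable
  is differentiable almost everywhere and is the integral of its derivative (lemmas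
  \<open>lipschitz_differentiable_ae\<close>, \<open>integral_lipschitz_derivative\<close>). The residue theorem for the
  region between the graph and the line (lemma \<open>graph_boundary_residues\<close>) then follows by
  subtracting principal parts: the region has a simply connected neighbourhood, on which the
  holomorphic remainder has a primitive, and each \<open>1/(s-p)\<close> is integrated by branches of the
  logarithm.

  \<^bold>\<open>The monophase case.\<close> Here every \<open>e\<^sub>k(\<epsilon>)\<close> vanishes, so it does not matter which integers are
  visible, and the tubular zeta function coincides with \<open>\<zeta> B\<close> away from \<open>0, \<dots>, d\<close> and the poles of
  \<open>\<zeta>\<close> (lemma \<open>tubular_zeta_eq_error_integrand\<close>).
\<close>

section \<open>Lipschitz functions of one real variable\<close>

text \<open>
  Let two measures be dominated by Lebesgue measure, one of them being equal to it. If
  \<open>M\<^sub>1 \<le> p M\<^sub>2\<close> on all Borel subsets of the bounded set \<open>A\<close>, then the points of \<open>A\<close> that lie in arbitrarily short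
  intervals on which \<open>M\<^sub>1 \<ge> q M\<^sub>2\<close>, with \<open>q > p\<close>, form a null set. By Vitali's covering theorem they
  are covered, up to a null set, by disjoint intervals of this kind inside an open set that exceeds
  \<open>A\<close> by little; comparing \<open>M\<^sub>1\<close> and \<open>M\<^sub>2\<close> on the union of the intervals shows that this union has
  small measure.
\<close>

lemma Vitali_density_negligible:
  fixes M1 M2 :: "real measure" and A :: "real set" and p q :: real
  assumes sets1: "sets M1 = sets borel" and sets2: "sets M2 = sets borel"
    and le1: "\<And>B. B \<in> sets borel \<Longrightarrow> emeasure M1 B \<le> emeasure lborel B"
    and le2: "\<And>B. B \<in> sets borel \<Longrightarrow> emeasure M2 B \<le> emeasure lborel B"
    and leb: "M1 = lborel \<or> M2 = lborel"
    and A: "A \<in> sets borel" "bounded A" 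
    and pq: "0 \<le> p" "p < q"
    and pA: "\<And>B. B \<in> sets borel \<Longrightarrow> B \<subseteq> A \<Longrightarrow> emeasure M1 B \<le> ennreal p * emeasure M2 B"
  shows "negligible {x \<in> A. \<forall>\<delta>>0. \<exists>a b. a < b \<and> x \<in> {a..b} \<and> b - a < \<delta> \<and>
           ennreal q * emeasure M2 {a..b} \<le> emeasure M1 {a..b}}" (is "negligible ?E")
proof -
  have "\<exists>T. ?E \<subseteq> T \<and> T \<in> lmeasurable \<and> measure lebesgue T \<le> e" if "e > 0" for e
  proof -
    \<comment> \<open>This makes the bounds \<open>\<delta> / (q - p)\<close> for \<open>M\<^sub>2\<close> and \<open>p \<delta> / (q - p) + \<delta>\<close> for \<open>M\<^sub>1\<close> at most \<open>e\<close>.\<close>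
    define \<delta> where "\<delta> = e / (1 + 1 / (q - p) + p / (q - p))"
    have den: "1 + 1 / (q - p) + p / (q - p) > 0"
      using pq by (simp add: add_pos_nonneg)
    have \<delta>: "\<delta> > 0" using den that by (simp add: \<delta>_def)
    have Al: "A \<in> lmeasurable"
      using A by (intro bounded_set_imp_lmeasurable) auto
    obtain W where W: "open W" "A \<subseteq> W" "W - A \<in> lmeasurable" "emeasure lebesgue (W - A) < ennreal \<delta>"
      using sets_lebesgue_outer_open[of A \<delta>] Al \<delta> by (metis fmeasurableD)
    have WAb: "W - A \<in> sets borel" using W A by auto
    define K where "K = {(a,b). a < b \<and> {a..b} \<subseteq> W \<and> ennreal q * emeasure M2 {a..b}
        \<le> emeasure M1 {a..b}}"
    let ?m = "\<lambda>i::real\<times>real. (fst i + snd i) / 2" and ?r = "\<lambda>i::real\<times>real. (snd i - fst i) / 2"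
    have cb: "cball (?m i) (?r i) = {fst i..snd i}" for i
      by (simp add: cball_eq_atLeastAtMost field_simps)
    obtain C where C: "countable C" "C \<subseteq> K"
       "pairwise (\<lambda>i j. disjnt (cball (?m i) (?r i)) (cball (?m j) (?r j))) C"
       "negligible (?E - (\<Union>i\<in>C. cball (?m i) (?r i)))"
    proof (rule Vitali_covering_theorem_cballs[of K ?r ?E ?m])
      show "0 < ?r i" if "i \<in> K" for i using that by (auto simp: K_def)
      fix x d assume x: "x \<in> ?E" and d: "0 < (d::real)"
      then obtain \<eta> where \<eta>: "\<eta> > 0" "ball x \<eta> \<subseteq> W" using W
        by (metis (no_types, lifting) mem_Collect_eq open_contains_ball subsetD)
      then obtain a b where ab: "a < b" "x \<in> {a..b}" "b - a < min d \<eta>"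
        "ennreal q * emeasure M2 {a..b} \<le> emeasure M1 {a..b}"
        using x[unfolded mem_Collect_eq, THEN conjunct2, rule_format, of "min d \<eta>"] d \<eta>(1) by auto
      have "{a..b} \<subseteq> ball x \<eta>" using ab by (auto simp: dist_real_def)
      then have "(a,b) \<in> K" using ab \<eta> by (auto simp: K_def)
      then show "\<exists>i. i \<in> K \<and> x \<in> cball (?m i) (?r i) \<and> ?r i < d"
        using ab unfolding cb by (intro exI[of _ "(a,b)"]) auto
    qed
    define I where "I = (\<Union>i\<in>C. {fst i..snd i})"
    have Ib: "I \<in> sets borel" unfolding I_def using C(1) by auto
    have IW: "I \<subseteq> W" using C(2) by (fastforce simp: I_def K_def)
    have disj: "disjoint_family_on (\<lambda>i. {fst i..snd i}) C"
      using C(3) unfolding cb by (auto simp: disjoint_family_on_def pairwise_def disjnt_def)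
    have M1I: "emeasure M1 I = (\<integral>\<^sup>+i. emeasure M1 {fst i..snd i} \<partial>count_space C)"
      unfolding I_def using C(1) disj sets1 by (intro emeasure_UN_countable) auto
    have M2I: "emeasure M2 I = (\<integral>\<^sup>+i. emeasure M2 {fst i..snd i} \<partial>count_space C)"
      unfolding I_def using C(1) disj sets2 by (intro emeasure_UN_countable) auto
    have qI: "ennreal q * emeasure M2 I \<le> emeasure M1 I"
      unfolding M1I M2I using C(2)
      by (subst nn_integral_cmult[symmetric]) (auto intro!: nn_integral_mono simp: K_def)
    have split: "emeasure M (I \<inter> A) + emeasure M (I - A) = emeasure M I" if "sets M = sets borel"
      for M :: "real measure"
      using that Ib A by (subst plus_emeasure) (auto intro: arg_cong2[where f=emeasure])
    have small: "emeasure lborel (I - A) \<le> ennreal \<delta>"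
    proof -
      have "emeasure lborel (I - A) \<le> emeasure lborel (W - A)" using IW WAb
        by (intro emeasure_mono) auto
      also have "\<dots> = emeasure lebesgue (W - A)" using WAb by simp
      finally show ?thesis using W(4) by simp
    qed
    have M1up: "emeasure M1 I \<le> ennreal p * emeasure M2 I + ennreal \<delta>"
    proof -
      have "emeasure M1 I = emeasure M1 (I \<inter> A) + emeasure M1 (I - A)" using split[OF sets1] by simp
      also have "\<dots> \<le> ennreal p * emeasure M2 (I \<inter> A) + ennreal \<delta>"
        using pA[of "I \<inter> A"] le1[of "I - A"] small Ib A
          by (intro add_mono) (auto intro: order_trans)
      also have "\<dots> \<le> ennreal p * emeasure M2 I + ennreal \<delta>"
        using Ib sets2 by (intro add_mono mult_left_mono emeasure_mono) auto
      finally show ?thesis .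
    qed
    have finl: "emeasure lborel I < \<infinity>"
    proof -
      have "emeasure lborel I = emeasure lborel (I \<inter> A) + emeasure lborel (I - A)"
        using split[of lborel] by simp
      also have "\<dots> \<le> emeasure lborel A + ennreal \<delta>" using small A
        by (intro add_mono emeasure_mono) auto
      also have "\<dots> < \<infinity>" using emeasure_bounded_finite[OF A(2)] by (simp add: ennreal_add_less_top)
      finally show ?thesis .
    qed
    have fin1: "emeasure M1 I < \<infinity>" and fin2: "emeasure M2 I < \<infinity>"
      using le1[OF Ib] le2[OF Ib] finl by auto
    define m1 m2 where "m1 = measure M1 I" and "m2 = measure M2 I"
    have e1: "emeasure M1 I = ennreal m1" and e2: "emeasure M2 I = ennreal m2"
      using fin1 fin2 by (auto simp: m1_def m2_def emeasure_eq_ennreal_measure)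
    have nn: "m1 \<ge> 0" "m2 \<ge> 0" by (auto simp: m1_def m2_def)
    have r1: "q * m2 \<le> m1" using qI nn pq unfolding e1 e2
      by (simp add: ennreal_mult[symmetric] ennreal_le_iff)
    have r2: "m1 \<le> p * m2 + \<delta>" using M1up nn pq \<delta> unfolding e1 e2
      by (simp add: ennreal_mult[symmetric] ennreal_plus[symmetric] ennreal_le_iff del:
        ennreal_plus)
    have m2: "m2 \<le> \<delta> / (q - p)" using r1 r2 pq by (simp add: field_simps)
    have m1: "m1 \<le> p * (\<delta> / (q - p)) + \<delta>" using r2 m2 pq mult_left_mono[OF m2, of p] by linarith
    have de: "\<delta> + \<delta> / (q - p) + p * (\<delta> / (q - p)) = e"
    proof -
      have "\<delta> + \<delta> / (q - p) + p * (\<delta> / (q - p)) = \<delta> * (1 + 1 / (q - p) + p / (q - p))"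
        by (simp add: algebra_simps)
      then show ?thesis using den by (simp add: \<delta>_def)
    qed
    have mI: "measure lborel I \<le> e"
    proof -
      have "p * (\<delta> / (q - p)) \<ge> 0" "\<delta> / (q - p) \<ge> 0" using pq \<delta> by auto
      then have "m1 \<le> e" "m2 \<le> e" using m1 m2 de \<delta> by linarith+
      then show ?thesis using leb unfolding m1_def m2_def by metis
    qed
    let ?N = "?E - I"
    have N: "negligible ?N" using C(4) unfolding cb I_def .
    have Il: "I \<in> lmeasurable" using finl Ib by (auto simp: fmeasurable_def)
    have "measure lebesgue (I \<union> ?N) = measure lebesgue I"
      by (rule measure_Un_null_set) (use N Il in \<open>auto simp: negligible_iff_null_sets fmeasurableD\<close>)
    moreover have "I \<union> ?N \<in> lmeasurable" using Il N
      by (intro fmeasurable.Un) (auto intro: negligible_imp_measurable)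
    moreover have "measure lebesgue I = measure lborel I" using Ib by simp
    moreover have "?E \<subseteq> I \<union> ?N" by blast
    ultimately have "?E \<subseteq> I \<union> ?N \<and> I \<union> ?N \<in> lmeasurable \<and> measure lebesgue (I \<union> ?N) \<le> e"
      using mI by (intro conjI) auto
    then show ?thesis by (rule exI)
  qed
  then show ?thesis unfolding negligible_outer_le by (intro allI impI)
qed

text \<open>
  The function \<open>(x + g x / L) / 2\<close> is nondecreasing, and its Stieltjes measure is dominated by
  Lebesgue measure, because together with the Stieltjes measure of \<open>(x - g x / L) / 2\<close> it adds up
  to Lebesgue measure. Hence it has a density.
\<close>

lemma lipschitz_density_measure:
  fixes g :: "real \<Rightarrow> real"
  assumes "L-lipschitz_on UNIV g" "L > 0"
  obtains M1 :: "real measure" and f :: "real \<Rightarrow> ennreal"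
  where "sets M1 = sets borel" "\<And>B. B \<in> sets borel \<Longrightarrow> emeasure M1 B \<le> emeasure lborel B"
    "\<And>a b. a \<le> b \<Longrightarrow> emeasure M1 {a..b} = ennreal (((b - a) + (g b - g a) / L) / 2)"
    "f \<in> borel_measurable borel" "density lborel f = M1"
proof -
  have lip: "\<bar>g x - g y\<bar> \<le> L * \<bar>x - y\<bar>" for x y
    using lipschitz_onD[OF assms(1), of x y] by (simp add: dist_real_def)
  have lip': "\<bar>(g x - g y) / L\<bar> \<le> \<bar>x - y\<bar>" for x y
    using lip[of x y] assms(2) by (simp add: divide_le_eq mult.commute)
  have contg: "continuous_on UNIV g" using assms(1) lipschitz_on_continuous_on by blast
  define F1 where "F1 = (\<lambda>x. (x + g x / L) / 2)"
  define F2 where "F2 = (\<lambda>x. (x - g x / L) / 2)"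
  have lip2: "g x / L - g y / L \<le> \<bar>x - y\<bar>" "g y / L - g x / L \<le> \<bar>x - y\<bar>" for x y
    using lip'[of x y] by (simp_all add: abs_le_iff diff_divide_distrib)
  have mono1: "F1 x \<le> F1 y" if "x \<le> y" for x y
  proof -
    have "x + g x / L \<le> y + g y / L" using lip2(1)[of x y] that by linarith
    then show ?thesis unfolding F1_def by (intro divide_right_mono) auto
  qed
  have mono2: "F2 x \<le> F2 y" if "x \<le> y" for x y
  proof -
    have "x - g x / L \<le> y - g y / L" using lip2(1)[of y x] that by linarith
    then show ?thesis unfolding F2_def by (intro divide_right_mono) auto
  qed
  have c1: "continuous_on UNIV F1" and c2: "continuous_on UNIV F2"
    unfolding F1_def F2_def using contg assms(2) by (auto intro!: continuous_intros)
  have rc: "continuous (at_right a) F1" "continuous (at_right a) F2" for a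
    using c1 c2 by (auto simp: continuous_on_eq_continuous_at intro:
      continuous_at_imp_continuous_within)
  define M1 where "M1 = interval_measure F1"
  define M2 where "M2 = interval_measure F2"
  have s1: "sets M1 = sets borel" and s2: "sets M2 = sets borel" by (auto simp: M1_def M2_def)
  have i1: "emeasure M1 {a..b} = ennreal (F1 b - F1 a)" if "a \<le> b" for a b
    unfolding M1_def using that mono1 c1 by (intro emeasure_interval_measure_Icc) auto
  have o1: "emeasure M1 {a<..b} = ennreal (F1 b - F1 a)" if "a \<le> b" for a b
    unfolding M1_def using that mono1 rc by (intro emeasure_interval_measure_Ioc) auto
  have o2: "emeasure M2 {a<..b} = ennreal (F2 b - F2 a)" if "a \<le> b" for a b
    unfolding M2_def using that mono2 rc by (intro emeasure_interval_measure_Ioc) auto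
  have i2: "emeasure M2 {a..b} = ennreal (F2 b - F2 a)" if "a \<le> b" for a b
    unfolding M2_def using that mono2 c2 by (intro emeasure_interval_measure_Icc) auto
  \<comment> \<open>The sum of the two Stieltjes measures, which is Lebesgue measure.\<close>
  define K where "K = measure_of UNIV (sets borel) (\<lambda>A. emeasure M1 A + emeasure M2 A)"
  have sK: "sets K = sets borel" unfolding K_def
    by (simp add: sets.sigma_sets_eq[of borel, simplified])
  have eK: "emeasure K A = emeasure M1 A + emeasure M2 A" if "A \<in> sets borel" for A
  proof (rule emeasure_measure_of[OF K_def])
    show "countably_additive (sets K) (\<lambda>A. emeasure M1 A + emeasure M2 A)"
    proof (rule countably_additiveI)
      fix B :: "nat \<Rightarrow> real set" assume B: "range B \<subseteq> sets K" "disjoint_family B"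
        "(\<Union>i. B i) \<in> sets K"
      then show "(\<Sum>i. emeasure M1 (B i) + emeasure M2 (B i))
          = emeasure M1 (\<Union>i. B i) + emeasure M2 (\<Union>i. B i)"
        using s1 s2 sK by (subst suminf_add[symmetric]) (auto simp: suminf_emeasure)
    qed
  qed (use that sK in \<open>auto simp: positive_def\<close>)
  have KL: "lborel = K"
  proof (rule lborel_eqI)
    fix l u :: real assume "\<And>b. b \<in> Basis \<Longrightarrow> l \<bullet> b \<le> u \<bullet> b"
    then have lu: "l \<le> u" by auto
    have e1: "emeasure M1 {l<..<u} = ennreal (F1 u - F1 l)"
      and e2: "emeasure M2 {l<..<u} = ennreal (F2 u - F2 l)"
    proof -
      have p1: "emeasure M1 {u} = 0" "emeasure M2 {u} = 0" using i1[of u u] i2[of u u] by auto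
      have "emeasure M {l<..u} = emeasure M {l<..<u}" if "sets M = sets borel" "emeasure M {u} = 0"
        for M :: "real measure"
      proof (cases "l = u")
        case False
        then have "{l<..u} = {l<..<u} \<union> {u}" using lu by auto
        then show ?thesis using emeasure_Un_null_set[of "{l<..<u}" M "{u}"] that
          by (auto simp: null_sets_def)
      qed auto
      then show "emeasure M1 {l<..<u} = ennreal (F1 u - F1 l)"
        "emeasure M2 {l<..<u} = ennreal (F2 u - F2 l)"
        using p1 s1 s2 o1[OF lu] o2[OF lu] by auto
    qed
    have "emeasure K {l<..<u} = ennreal (F1 u - F1 l) + ennreal (F2 u - F2 l)"
      by (simp add: eK e1 e2)
    also have "\<dots> = ennreal (u - l)"
      using mono1[OF lu] mono2[OF lu]
        by (subst ennreal_plus[symmetric]) (auto simp: F1_def F2_def field_simps)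
    finally show "emeasure K (box l u) = ennreal (\<Prod>b\<in>Basis. (u - l) \<bullet> b)" by simp
  qed (use sK in auto)
  have le: "emeasure M1 B \<le> emeasure lborel B" if "B \<in> sets borel" for B
    using eK[OF that] by (simp add: KL)
  have ac: "absolutely_continuous lborel M1"
    unfolding absolutely_continuous_def null_sets_def using le s1 by force
  obtain f where f: "f \<in> borel_measurable lborel" "density lborel f = M1"
    using sigma_finite_measure.Radon_Nikodym[OF sigma_finite_lborel ac] s1 by auto
  show ?thesis
  proof (rule that[of M1 f])
    show "emeasure M1 {a..b} = ennreal (((b - a) + (g b - g a) / L) / 2)" if "a \<le> b" for a b
      using i1[OF that] by (simp add: F1_def diff_divide_distrib add_divide_distrib algebra_simps)
  qed (use s1 le f in auto)
qed

text \<open>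
  Rademacher's theorem on the line. The quotients of the Stieltjes measure over short intervals at
  \<open>x\<close> converge to the density \<open>f x\<close> except where they are infinitely often at least \<open>q\<close> although
  \<open>f x < p < q\<close>, or at most \<open>p\<close> although \<open>f x > q > p\<close>, for some rational \<open>p\<close>, \<open>q\<close>.
\<close>

lemma lipschitz_differentiable_ae:
  fixes g :: "real \<Rightarrow> real"
  assumes "L-lipschitz_on UNIV g"
  shows "negligible {x. \<not> (\<exists>D. (g has_real_derivative D) (at x))}"
proof -
  have L: "max L 1 > 0" "(max L 1)-lipschitz_on UNIV g"
    using assms by (auto intro: lipschitz_on_le)
  define L' where "L' = max L 1"
  have L'0: "L' > 0" using L by (simp add: L'_def)
  have lip: "\<bar>(g x - g y) / L'\<bar> \<le> \<bar>x - y\<bar>" for x y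
    using lipschitz_onD[OF L(2), of x y] L(1)
      by (simp add: dist_real_def L'_def divide_le_eq mult.commute)
  obtain M f where M: "sets M = sets borel" "\<And>B. B \<in> sets borel \<Longrightarrow> emeasure M B \<le> emeasure lborel B"
    "\<And>a b. a \<le> b \<Longrightarrow> emeasure M {a..b} = ennreal (((b - a) + (g b - g a) / L') / 2)"
    and f[measurable]: "f \<in> borel_measurable borel" and fM: "density lborel f = M"
    using lipschitz_density_measure[OF L(2) L(1)] unfolding L'_def by metis
  have eM: "emeasure M B = (\<integral>\<^sup>+x\<in>B. f x \<partial>lborel)" if "B \<in> sets borel" for B
    using that by (simp add: fM[symmetric] emeasure_density)
  define lo where "lo n p = {x \<in> {-real n..real n}. f x < ennreal p}" for n p
  define hi where "hi n p = {x \<in> {-real n..real n}. f x > ennreal p}" for n p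
  have meas: "lo n p \<in> sets borel" "hi n p \<in> sets borel" for n p unfolding lo_def hi_def
    by measurable
  have bdd: "bounded (lo n p)" "bounded (hi n p)" for n p
    unfolding lo_def hi_def by (auto intro: bounded_subset[of "{-real n..real n}"])
  define E1 where "E1 n p q = {x \<in> lo n p. \<forall>\<delta>>0. \<exists>a b. a < b \<and> x \<in> {a..b} \<and> b - a < \<delta> \<and>
           ennreal q * emeasure lborel {a..b} \<le> emeasure M {a..b}}" for n p q
  define E2 where "E2 n p q = {x \<in> hi n q. \<forall>\<delta>>0. \<exists>a b. a < b \<and> x \<in> {a..b} \<and> b - a < \<delta> \<and>
           ennreal (1/p) * emeasure M {a..b} \<le> emeasure lborel {a..b}}" for n p q
  have N1: "negligible (E1 n p q)" if "0 \<le> p" "p < q" for n p q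
    unfolding E1_def
  proof (rule Vitali_density_negligible[OF M(1) sets_lborel M(2) order.refl disjI2[OF refl] meas(1)
    bdd(1) that])
    fix B assume B: "B \<in> sets borel" "B \<subseteq> lo n p"
    have "emeasure M B \<le> (\<integral>\<^sup>+x. ennreal p * indicator B x \<partial>lborel)"
      unfolding eM[OF B(1)] using B(2) by (intro nn_integral_mono) (auto simp: lo_def indicator_def)
    then show "emeasure M B \<le> ennreal p * emeasure lborel B" using B(1)
      by (simp add: nn_integral_cmult)
  qed
  have N2: "negligible (E2 n p q)" if "0 < p" "p < q" for n p q
    unfolding E2_def
  proof (rule Vitali_density_negligible[OF sets_lborel M(1) order.refl M(2) disjI1[OF refl] meas(2)
    bdd(2)])
    show "0 \<le> 1/q" "1/q < 1/p" using that by (auto simp: field_simps)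
    fix B assume B: "B \<in> sets borel" "B \<subseteq> hi n q"
    have "ennreal q * emeasure lborel B = (\<integral>\<^sup>+x. ennreal q * indicator B x \<partial>lborel)" 
      using B(1) by (simp add: nn_integral_cmult)
    also have "\<dots> \<le> emeasure M B"
      unfolding eM[OF B(1)] using B(2) by (intro nn_integral_mono) (auto simp: hi_def indicator_def)
    finally have "ennreal (1/q) * (ennreal q * emeasure lborel B) \<le> ennreal (1/q) * emeasure M B"
      by (rule mult_left_mono) auto
    also have "ennreal (1/q) * (ennreal q * emeasure lborel B) = emeasure lborel B"
      using that by (simp add: mult.assoc[symmetric] ennreal_mult[symmetric])
    finally show "emeasure lborel B \<le> ennreal (1/q) * emeasure M B" .
  qed
  define E where "E = (\<Union>n. \<Union>p\<in>\<rat>\<inter>{0<..}. \<Union>q\<in>\<rat>\<inter>{p<..}. E1 n p q \<union> E2 n p q)"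
  have cQ: "countable (\<rat> \<inter> A)" for A :: "real set"
    using countable_rat countable_subset by blast
  have negUN: "negligible (\<Union>i\<in>I. B i)" if "countable I" "\<And>i. i \<in> I \<Longrightarrow> negligible (B i)"
    for I :: "'i set" and B :: "'i \<Rightarrow> real set"
    using that by (intro negligible_countable_Union) auto
  have "negligible (\<Union>q\<in>\<rat>\<inter>{p<..}. E1 n p q \<union> E2 n p q)" if "0 < p" for n p
    using that by (rule_tac negUN[OF cQ]) (auto intro!: negligible_Un N1 N2)
  then have "negligible (\<Union>p\<in>\<rat>\<inter>{0<..}. \<Union>q\<in>\<rat>\<inter>{p<..}. E1 n p q \<union> E2 n p q)" for n
    by (rule_tac negUN[OF cQ]) blast
  then have nE: "negligible E" unfolding E_def
    by (rule_tac negUN) auto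
  have D: "\<exists>D. (g has_real_derivative D) (at x)" if x: "x \<notin> E" for x
  proof -
    obtain n where n: "x \<in> {-real n..real n}"
      using real_arch_simple[of "\<bar>x\<bar>"] by (metis abs_le_iff atLeastAtMost_iff minus_le_iff)
    define Q where "Q y = (g y - g x) / (y - x)" for y
    define R where "R y = (1 + Q y / L') / 2" for y
    have I: "emeasure M {min x y..max x y} = ennreal (R y) * emeasure lborel {min x y..max x y}"
       and R01: "0 \<le> R y \<and> R y \<le> 1" if "y \<noteq> x" for y
    proof -
      have q: "\<bar>Q y / L'\<bar> \<le> 1" using lip[of y x] that L'0
        by (simp add: Q_def abs_divide divide_le_eq mult.commute)
      then show R: "0 \<le> R y \<and> R y \<le> 1" unfolding R_def abs_le_iff by auto
      have "((max x y - min x y) + (g (max x y) - g (min x y)) / L') / 2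
          = R y * (max x y - min x y)"
        using that L'0 by (cases "x < y") (auto simp: R_def Q_def field_simps max_def min_def)
      then show "emeasure M {min x y..max x y} = ennreal (R y) * emeasure lborel {min x y..max x y}"
        using M(3)[of "min x y" "max x y"] R by (simp add: ennreal_mult[symmetric])
    qed
    have up: "eventually (\<lambda>y. R y < q) (at x)" if pq: "0 < p" "p < q" "p \<in> \<rat>" "q \<in> \<rat>"
      and fx: "f x < ennreal p" for p q
    proof -
      have "x \<notin> E1 n p q" using x pq unfolding E_def by blast
      moreover have "x \<in> lo n p" using n fx by (auto simp: lo_def)
      ultimately obtain \<delta> where \<delta>: "\<delta> > 0" "\<And>a b. a < b \<Longrightarrow> x \<in> {a..b} \<Longrightarrow> b - a < \<delta> \<Longrightarrow>
           \<not> ennreal q * emeasure lborel {a..b} \<le> emeasure M {a..b}" unfolding E1_def by blast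
      show ?thesis unfolding eventually_at
      proof (intro exI[of _ \<delta>] conjI ballI impI, rule \<delta>(1))
        fix y assume y: "y \<noteq> x \<and> dist y x < \<delta>"
        then have "\<not> ennreal q * emeasure lborel {min x y..max x y} \<le> emeasure M {min x y..max x y}"
          by (intro \<delta>(2)) (auto simp: dist_real_def max_def min_def)
        then have "\<not> ennreal q \<le> ennreal (R y)"
          unfolding I[OF conjunct1[OF y]] using mult_right_mono[of "ennreal q" "ennreal (R y)"]
            by auto
        then show "R y < q" by (meson ennreal_leI not_less)
      qed
    qed
    have dn: "eventually (\<lambda>y. p < R y) (at x)" if pq: "0 < p" "p < q" "p \<in> \<rat>" "q \<in> \<rat>"
      and fx: "ennreal q < f x" for p q
    proof -
      have "x \<notin> E2 n p q" using x pq unfolding E_def by blast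
      moreover have "x \<in> hi n q" using n fx by (auto simp: hi_def)
      ultimately obtain \<delta> where \<delta>: "\<delta> > 0" "\<And>a b. a < b \<Longrightarrow> x \<in> {a..b} \<Longrightarrow> b - a < \<delta> \<Longrightarrow>
           \<not> ennreal (1/p) * emeasure M {a..b} \<le> emeasure lborel {a..b}" unfolding E2_def by blast
      show ?thesis unfolding eventually_at
      proof (intro exI[of _ \<delta>] conjI ballI impI, rule \<delta>(1))
        fix y assume y: "y \<noteq> x \<and> dist y x < \<delta>"
        then have *: "\<not> ennreal (1/p) * emeasure M {min x y..max x y}
            \<le> emeasure lborel {min x y..max x y}"
          by (intro \<delta>(2)) (auto simp: dist_real_def max_def min_def)
        show "p < R y"
        proof (rule ccontr)
          assume "\<not> p < R y"
          then have "(1/p) * R y \<le> 1" using pq by (simp add: field_simps)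
          then have "ennreal (1/p) * ennreal (R y) \<le> 1"
            using R01[of y] y pq by (simp add: ennreal_mult[symmetric])
          then have "(ennreal (1/p) * ennreal (R y)) * emeasure lborel {min x y..max x y}
              \<le> 1 * emeasure lborel {min x y..max x y}"
            by (rule mult_right_mono) auto
          then show False using * unfolding I[OF conjunct1[OF y]] by (simp add: mult.assoc)
        qed
      qed
    qed
    \<comment> \<open>All quotients lie in \<open>[0, 1]\<close>, so the density cannot be infinite at \<open>x\<close>.\<close>
    have f2: "f x \<le> 2"
    proof (rule ccontr)
      assume "\<not> f x \<le> 2"
      then have "eventually (\<lambda>y. 1 < R y) (at x)" by (intro dn[of 1 2]) auto
      then obtain d where d: "d > 0" "\<And>y. y \<noteq> x \<Longrightarrow> dist y x < d \<Longrightarrow> 1 < R y"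
        unfolding eventually_at by blast
      have "1 < R (x + d/2)" using d(1) by (intro d(2)) (auto simp: dist_real_def)
      then show False using R01[of "x + d/2"] d(1) by auto
    qed
    define \<phi> where "\<phi> = enn2real (f x)"
    have \<phi>: "f x = ennreal \<phi>" "\<phi> \<ge> 0" using f2 by (auto simp: \<phi>_def ennreal_enn2real_if top_unique)
    have "(R \<longlongrightarrow> \<phi>) (at x)"
    proof (rule order_tendstoI)
      fix a assume a: "a < \<phi>"
      show "\<forall>\<^sub>F y in at x. a < R y"
      proof (cases "a < 0")
        case True
        then show ?thesis using R01
          by (auto simp: eventually_at intro!: exI[of _ 1] less_le_trans[OF True])
      next
        case False
        obtain p where p: "p \<in> \<rat>" "a < p" "p < \<phi>" using a Rats_dense_in_real by blast
        obtain q where q: "q \<in> \<rat>" "p < q" "q < \<phi>" using p Rats_dense_in_real by blast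
        have "ennreal q < f x" unfolding \<phi> using p q False by (subst ennreal_less_iff) auto
        then show ?thesis using dn[of p q] p q False by (auto elim: eventually_mono)
      qed
    next
      fix a assume a: "\<phi> < a"
      obtain q where q: "q \<in> \<rat>" "\<phi> < q" "q < a" using a Rats_dense_in_real by blast
      obtain p where p: "p \<in> \<rat>" "\<phi> < p" "p < q" using q Rats_dense_in_real by blast
      have "f x < ennreal p" using p \<phi>(2) by (simp add: \<phi>(1) ennreal_less_iff)
      then show "\<forall>\<^sub>F y in at x. R y < a" using up[of p q] p q \<phi>(2) by (auto elim: eventually_mono)
    qed
    then have "((\<lambda>y. (2 * R y - 1) * L') \<longlongrightarrow> (2 * \<phi> - 1) * L') (at x)" by (intro tendsto_intros)
    moreover have "(\<lambda>y. (2 * R y - 1) * L') = Q" using L'0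
      by (simp add: R_def fun_eq_iff field_simps)
    ultimately have "(g has_real_derivative (2 * \<phi> - 1) * L') (at x)"
      unfolding has_field_derivative_iff Q_def by simp
    then show ?thesis ..
  qed
  show ?thesis using D by (intro negligible_subset[OF nE]) blast
qed

lemma has_vector_derivative_LIMSEQ:
  assumes "(f has_vector_derivative f') (at x)" and "\<And>k. e k > 0" and "e \<longlonglongrightarrow> (0::real)"
  shows "(\<lambda>k. (1 / e k) *\<^sub>R (f (x + e k) - f x)) \<longlonglongrightarrow> f'"
proof -
  have "(\<lambda>h. norm (f (x + h) - f x - h *\<^sub>R f') / norm h) \<midarrow>0\<rightarrow> 0"
    using assms(1) by (simp add: has_vector_derivative_def has_derivative_at)
  moreover have "filterlim e (at 0) sequentially"
    unfolding filterlim_at using assms(2,3) by (auto simp: less_imp_neq[symmetric])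
  ultimately have "(\<lambda>k. norm (f (x + e k) - f x - e k *\<^sub>R f') / norm (e k)) \<longlonglongrightarrow> 0"
    by (rule filterlim_compose)
  moreover have "norm (f (x + e k) - f x - e k *\<^sub>R f') / norm (e k)
      = norm ((1 / e k) *\<^sub>R (f (x + e k) - f x) - f')" for k
  proof -
    have "(1 / e k) *\<^sub>R (f (x + e k) - f x) - f' = (1 / e k) *\<^sub>R (f (x + e k) - f x - e k *\<^sub>R f')"
      using assms(2)[of k] by (simp add: scaleR_diff_right)
    then show ?thesis using assms(2)[of k] by simp
  qed
  ultimately show ?thesis by (simp add: tendsto_norm_zero_iff Lim_null[of _ f'])
qed

text \<open>
  The fundamental theorem of calculus for Lipschitz functions: the difference quotients at the
  steps \<open>e\<^sub>k\<close> are uniformly bounded, converge to the derivative almost everywhere, and their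
  integrals telescope. The Lipschitz bound is only needed for nearby points, which is what a
  holomorphic function composed with a Lipschitz curve provides directly.
\<close>

lemma integral_lipschitz_derivative:
  fixes h h' :: "real \<Rightarrow> 'b::euclidean_space"
  assumes ab: "a \<le> b" and \<delta>: "\<delta> > 0"
    and lip: "\<And>s t. s \<in> {a..b} \<Longrightarrow> t \<in> {a..b} \<Longrightarrow> \<bar>s - t\<bar> \<le> \<delta> \<Longrightarrow> norm (h s - h t) \<le> K * \<bar>s - t\<bar>"
    and N: "negligible N"
    and deriv: "\<And>t. a < t \<Longrightarrow> t < b \<Longrightarrow> t \<notin> N \<Longrightarrow> (h has_vector_derivative h' t) (at t)"
  shows "h' absolutely_integrable_on {a..b}" and "integral {a..b} h' = h b - h a"
proof -
  define K' where "K' = \<bar>K\<bar>"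
  have lipK: "norm (h s - h t) \<le> K' * \<bar>s - t\<bar>" if "s \<in> {a..b}" "t \<in> {a..b}" "\<bar>s - t\<bar> \<le> \<delta>" for s t
    using lip[OF that] mult_right_mono[of K K' "\<bar>s - t\<bar>"] unfolding K'_def by linarith
  \<comment> \<open>Extending \<open>h\<close> by constants outside \<open>[a, b]\<close> makes all difference quotients available.\<close>
  define cl where "cl t = max a (min b t)" for t
  have cl: "cl t \<in> {a..b}" "\<bar>cl s - cl t\<bar> \<le> \<bar>s - t\<bar>" for s t
    using ab by (auto simp: cl_def)
  have cl_id: "cl t = t" if "t \<in> {a..b}" for t using that by (auto simp: cl_def)
  define H where "H t = h (cl t)" for t
  have lipH: "norm (H s - H t) \<le> K' * \<bar>s - t\<bar>" if "\<bar>s - t\<bar> \<le> \<delta>" for s t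
  proof -
    have "norm (H s - H t) \<le> K' * \<bar>cl s - cl t\<bar>"
      unfolding H_def using cl(2)[of s t] that by (intro lipK cl(1)) linarith
    also have "\<dots> \<le> K' * \<bar>s - t\<bar>" using cl(2)[of s t] by (intro mult_left_mono) (auto simp: K'_def)
    finally show ?thesis .
  qed
  have contH: "continuous_on A H" for A
  proof (rule continuous_on_subset[of UNIV], unfold continuous_on_iff, intro ballI allI impI)
    fix x e :: real assume e: "e > 0"
    show "\<exists>d>0. \<forall>x'\<in>UNIV. dist x' x < d \<longrightarrow> dist (H x') (H x) < e"
    proof (intro exI[of _ "min \<delta> (e / (K' + 1))"] conjI ballI impI)
      show "0 < min \<delta> (e / (K' + 1))" using \<delta> e by (auto simp: K'_def)
      fix y assume y: "dist y x < min \<delta> (e / (K' + 1))"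
      then have "norm (H y - H x) \<le> K' * \<bar>y - x\<bar>" by (intro lipH) (auto simp: dist_real_def)
      also have "\<dots> \<le> (K' + 1) * \<bar>y - x\<bar>" by (simp add: distrib_right)
      also have "\<dots> < e" using y e by (auto simp: dist_real_def K'_def field_simps)
      finally show "dist (H y) (H x) < e" by (simp add: dist_norm)
    qed
  qed auto
  obtain m :: nat where m: "1 / \<delta> < real m" using reals_Archimedean2 by blast
  have mpos: "real m > 0" using m \<delta> by (meson divide_pos_pos less_trans zero_less_one)
  define e where "e k = 1 / real (k + m)" for k :: nat
  have e: "e k > 0" "e k \<le> \<delta>" "e k \<le> 1" for k
  proof -
    have mk: "real (k + m) > 0" "real (k + m) \<ge> 1" using mpos by auto
    have "1 / real (k + m) \<le> 1 / real m" using mpos by (intro divide_left_mono) auto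
    also have "\<dots> \<le> \<delta>" using m \<delta> mpos by (simp add: field_simps)
    finally show "e k \<le> \<delta>" by (simp add: e_def)
    show "e k > 0" "e k \<le> 1" using mk by (auto simp: e_def)
  qed
  have e0: "e \<longlonglongrightarrow> 0"
    unfolding e_def by (rule LIMSEQ_ignore_initial_segment) (rule lim_1_over_n)
  define D where "D k t = (1 / e k) *\<^sub>R (H (t + e k) - H t)" for k t
  have Dbound: "norm (D k t) \<le> K'" for k t
  proof -
    have "norm (D k t) = norm (H (t + e k) - H t) / e k" using e(1)[of k] by (simp add: D_def)
    also have "\<dots> \<le> K'" using lipH[of "t + e k" t] e[of k] by (simp add: divide_le_eq)
    finally show ?thesis .
  qed
  have Dcont: "continuous_on A (D k)" for k A
    unfolding D_def by (intro continuous_intros continuous_on_compose2[OF contH[of UNIV]]) auto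
  define N' where "N' = N \<union> {a,b}"
  have N': "negligible N'" using N by (auto simp: N'_def intro!: negligible_Un)
  define D' where "D' k t = (if t \<in> N' then 0 else D k t)" for k t
  define g where "g t = (if t \<in> N' then 0 else h' t)" for t
  have Dlim: "(\<lambda>k. D k t) \<longlonglongrightarrow> h' t" if t: "a < t" "t < b" "t \<notin> N" for t
  proof -
    have "H y = h y" if "y \<in> {a<..<b}" for y using that by (simp add: H_def cl_id)
    then have "(H has_vector_derivative h' t) (at t)"
      using deriv[OF t] t by (intro has_vector_derivative_transform_within_open[of h _ t
        "{a<..<b}" H]) auto
    then show ?thesis unfolding D_def by (rule has_vector_derivative_LIMSEQ[OF _ e(1) e0])
  qed
  have Dint: "D k integrable_on {a..b}" for k using Dcont by (rule integrable_continuous_interval)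
  have D'int: "D' k integrable_on {a..b}" for k
    by (rule integrable_spike[OF Dint N']) (auto simp: D'_def)
  have DC: "g integrable_on {a..b}" "(\<lambda>k. integral {a..b} (D' k)) \<longlonglongrightarrow> integral {a..b} g"
  proof -
    have 1: "(\<lambda>_::real. K') integrable_on {a..b}" by (rule integrable_const_ivl)
    have 2: "norm (D' k x) \<le> K'" for k x using Dbound[of k x] by (simp add: D'_def K'_def)
    have 3: "(\<lambda>k. D' k x) \<longlonglongrightarrow> g x" if "x \<in> {a..b}" for x
      using Dlim[of x] that by (cases "x \<in> N'") (auto simp: D'_def g_def N'_def)
    show "g integrable_on {a..b}" "(\<lambda>k. integral {a..b} (D' k)) \<longlonglongrightarrow> integral {a..b} g"
      using dominated_convergence[of D', OF D'int 1 2 3] by auto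
  qed
  have gb: "norm (g x) \<le> K'" if "x \<in> {a..b}" for x
  proof (cases "x \<in> N'")
    case False
    then have "(\<lambda>k. norm (D k x)) \<longlonglongrightarrow> norm (h' x)" using that
      by (intro tendsto_norm Dlim) (auto simp: N'_def)
    then show ?thesis using Dbound False unfolding g_def by (auto intro!: LIMSEQ_le_const2)
  qed (auto simp: g_def K'_def)
  have "g absolutely_integrable_on {a..b}"
    using gb DC(1) integrable_const_ivl by (rule absolutely_integrable_integrable_bound)
  then show "h' absolutely_integrable_on {a..b}"
    by (rule absolutely_integrable_spike[OF _ N']) (auto simp: g_def)
  have gi: "integral {a..b} g = integral {a..b} h'"
    by (rule integral_spike[OF N']) (auto simp: g_def)
  define P where "P x = integral {a-1..x} H" for x
  have PI: "integral {u..v} H = P v - P u" if "a - 1 \<le> u" "u \<le> v" for u v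
    using Henstock_Kurzweil_Integration.integral_combine[where a="a-1" and c=u and b=v
      and f=H, OF _ _ integrable_continuous_interval[OF contH]] that
      by (simp add: P_def algebra_simps)
  have Pd: "(P has_vector_derivative H x) (at x)" if "a - 1 < x" for x
  proof -
    have "(P has_vector_derivative H x) (at x within {a-1..x+1})"
      unfolding P_def using that by (intro integral_has_vector_derivative contH) auto
    then have w: "(P has_vector_derivative H x) (at x within {a-1<..<x+1})"
      by (rule has_vector_derivative_within_subset) auto
    have eq: "at x within {a-1<..<x+1} = at x" using that by (intro at_within_open) auto
    show ?thesis using w unfolding eq .
  qed
  \<comment> \<open>The integral of a difference quotient is a difference of two means of \<open>H\<close> over shrinking
  intervals at the endpoints \<open>b\<close> and \<open>a\<close>.\<close>
  have PL: "(\<lambda>k. (1 / e k) *\<^sub>R (P (x + e k) - P x)) \<longlonglongrightarrow> H x" if "a - 1 < x" for x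
  proof -
    show ?thesis by (rule has_vector_derivative_LIMSEQ[OF Pd[OF that] e(1) e0])
  qed
  have ID: "integral {a..b} (D' k) = (1 / e k) *\<^sub>R (P (b + e k) - P b)
      - (1 / e k) *\<^sub>R (P (a + e k) - P a)" for k
  proof -
    have "integral {a..b} (D' k) = integral {a..b} (D k)"
      by (rule integral_spike[OF N']) (auto simp: D'_def)
    also have "\<dots> = (1 / e k) *\<^sub>R (integral {a..b} (\<lambda>t. H (t + e k)) - integral {a..b} H)"
    proof -
      have i1: "(\<lambda>t. H (t + e k)) integrable_on {a..b}"
        by (intro integrable_continuous_interval continuous_on_compose2[OF contH[of UNIV]])
          (auto intro!: continuous_intros)
      have i2: "H integrable_on {a..b}" by (intro integrable_continuous_interval contH)
      show ?thesis unfolding D_def by (simp add: integral_diff[OF i1 i2])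
    qed
    also have "integral {a..b} (\<lambda>t. H (t + e k)) = integral {a + e k..b + e k} H"
      using integral_shift[OF contH[of "{a + e k..b + e k}"]] by (simp add: o_def)
    also have "\<dots> = P (b + e k) - P (a + e k)" using ab e[of k] by (intro PI) auto
    also have "integral {a..b} H = P b - P a" using ab by (intro PI) auto
    finally show ?thesis by (simp add: algebra_simps)
  qed
  have "(\<lambda>k. integral {a..b} (D' k)) \<longlonglongrightarrow> H b - H a"
    unfolding ID using ab by (intro tendsto_diff PL) auto
  then have "integral {a..b} g = H b - H a" using DC(2) LIMSEQ_unique by blast
  then show "integral {a..b} h' = h b - h a" using ab by (simp add: gi H_def cl_id)
qed

section \<open>Contour integrals along Lipschitz graphs\<close>

lemma lipschitz_Complex_graph:
  assumes "L-lipschitz_on UNIV S"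
  shows "cmod (Complex (S s) s - Complex (S t) t) \<le> (L + 1) * \<bar>s - t\<bar>"
proof -
  have "cmod (Complex (S s) s - Complex (S t) t) \<le> \<bar>S s - S t\<bar> + \<bar>s - t\<bar>"
    using cmod_le[of "Complex (S s) s - Complex (S t) t"] by simp
  also have "\<dots> \<le> L * \<bar>s - t\<bar> + \<bar>s - t\<bar>" using lipschitz_onD[OF assms, of s t]
    by (simp add: dist_real_def)
  finally show ?thesis by (simp add: algebra_simps)
qed

lemma continuous_on_Complex_graph:
  assumes "L-lipschitz_on UNIV S"
  shows "continuous_on A (\<lambda>t. Complex (S t) t)"
proof -
  have "continuous_on UNIV S" using assms lipschitz_on_continuous_on by blast
  then have "continuous_on A S" using continuous_on_subset by blast
  then show ?thesis by (intro continuous_on_Complex) auto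
qed

lemma truncated_screen_integral_primitive:
  fixes S :: "real \<Rightarrow> real" and F f :: "complex \<Rightarrow> complex"
  assumes S: "L-lipschitz_on UNIV S" and ab: "a \<le> b"
    and \<Omega>: "open \<Omega>" "\<And>t. t \<in> {a..b} \<Longrightarrow> Complex (S t) t \<in> \<Omega>"
    and F: "\<And>z. z \<in> \<Omega> \<Longrightarrow> (F has_field_derivative f z) (at z)"
  shows "screen_integrand S f absolutely_integrable_on {a..b}"
    and "truncated_screen_integral a b S f = F (Complex (S b) b) - F (Complex (S a) a)"
proof -
  define \<gamma> where "\<gamma> t = Complex (S t) t" for t
  have L0: "L \<ge> 0" using S lipschitz_on_nonneg by blast
  have c\<gamma>: "continuous_on A \<gamma>" for A unfolding \<gamma>_def using continuous_on_Complex_graph[OF S] .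
  have cpt: "compact (\<gamma> ` {a..b})" by (intro compact_continuous_image c\<gamma>) auto
  have sub: "\<gamma> ` {a..b} \<subseteq> \<Omega>" using \<Omega>(2) by (auto simp: \<gamma>_def)
  have ne: "\<gamma> ` {a..b} \<noteq> {}" using ab by auto
  obtain \<epsilon> where \<epsilon>: "\<epsilon> > 0" "{x. infdist x (\<gamma> ` {a..b}) \<le> \<epsilon>} \<subseteq> \<Omega>"
    using compact_in_open_separated[OF ne cpt \<Omega>(1) sub] by blast
  define C where "C = {x. infdist x (\<gamma> ` {a..b}) \<le> \<epsilon>}"
  have Cc: "compact C" unfolding C_def using ne cpt \<epsilon>(1) by (rule compact_infdist_le)
  have Fh: "F holomorphic_on \<Omega>" using F \<Omega>(1) holomorphic_on_open by blast
  have fd: "f z = deriv F z" if "z \<in> \<Omega>" for z using DERIV_imp_deriv[OF F[OF that]] by simp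
  have "deriv F holomorphic_on \<Omega>" using Fh \<Omega>(1) by (rule holomorphic_deriv)
  then have fh: "f holomorphic_on \<Omega>" using holomorphic_cong[OF refl fd] by simp
  have "compact (f ` C)" using Cc \<epsilon>(2) fh
    by (intro compact_continuous_image)
      (auto simp: C_def intro: continuous_on_subset holomorphic_on_imp_continuous_on)
  then obtain M where M: "\<And>z. z \<in> C \<Longrightarrow> cmod (f z) \<le> M" using compact_imp_bounded[of "f ` C"]
    unfolding bounded_iff by blast
  define h where "h t = F (\<gamma> t)" for t
  define \<delta> where "\<delta> = \<epsilon> / (L + 1)"
  have \<delta>: "\<delta> > 0" using \<epsilon> L0 by (simp add: \<delta>_def)
  have lip: "norm (h s - h t) \<le> (M * (L + 1)) * \<bar>s - t\<bar>"
    if st: "s \<in> {a..b}" "t \<in> {a..b}" "\<bar>s - t\<bar> \<le> \<delta>" for s t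
  proof -
    have le: "cmod (\<gamma> s - \<gamma> t) \<le> (L + 1) * \<bar>s - t\<bar>" unfolding \<gamma>_def
      by (rule lipschitz_Complex_graph[OF S])
    also have "\<dots> \<le> (L + 1) * \<delta>" using st L0 by (intro mult_left_mono) auto
    also have "\<dots> = \<epsilon>" using L0 by (simp add: \<delta>_def)
    finally have in_ball: "\<gamma> s \<in> cball (\<gamma> t) \<epsilon>" by (simp add: dist_norm norm_minus_commute)
    have cbC: "cball (\<gamma> t) \<epsilon> \<subseteq> C"
    proof
      fix z assume "z \<in> cball (\<gamma> t) \<epsilon>"
      then have "dist z (\<gamma> t) \<le> \<epsilon>" by (simp add: dist_commute)
      moreover have "\<gamma> t \<in> \<gamma> ` {a..b}" using st by (intro imageI)
      ultimately have "infdist z (\<gamma> ` {a..b}) \<le> \<epsilon>" by (intro infdist_le2)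
      then show "z \<in> C" by (simp add: C_def)
    qed
    have tball: "\<gamma> t \<in> cball (\<gamma> t) \<epsilon>" using \<epsilon>(1) by simp
    have M0: "M \<ge> 0" by (rule order_trans[OF norm_ge_zero M[OF subsetD[OF cbC tball]]])
    have F': "(F has_field_derivative f z) (at z within cball (\<gamma> t) \<epsilon>)" if "z \<in> cball (\<gamma> t) \<epsilon>" for z
    proof -
      have "z \<in> \<Omega>" using subsetD[OF cbC that] \<epsilon>(2) unfolding C_def by (rule rev_subsetD)
      then show ?thesis by (rule has_field_derivative_at_within[OF F])
    qed
    have "norm (F (\<gamma> s) - F (\<gamma> t)) \<le> M * norm (\<gamma> s - \<gamma> t)"
      by (rule field_differentiable_bound[of
        "cball (\<gamma> t) \<epsilon>" F f, OF convex_cball F' M[OF subsetD[OF cbC]] in_ball tball])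
    also have "\<dots> \<le> M * ((L + 1) * \<bar>s - t\<bar>)" by (rule mult_left_mono[OF le M0])
    finally show ?thesis unfolding h_def mult.assoc .
  qed
  define N where "N = {x. \<not> (\<exists>D. (S has_real_derivative D) (at x))}"
  have N: "negligible N" unfolding N_def by (rule lipschitz_differentiable_ae[OF S])
  have d: "(h has_vector_derivative screen_integrand S f t) (at t)" if t: "a < t" "t < b" "t \<notin> N"
    for t
  proof -
    obtain D where D: "(S has_real_derivative D) (at t)" using t(3) unfolding N_def by blast
    then have D': "deriv S t = D" by (rule DERIV_imp_deriv)
    have "(\<gamma> has_vector_derivative (of_real D + \<i>)) (at t)"
    proof -
      have 1: "((\<lambda>t. complex_of_real (S t)) has_vector_derivative of_real D) (at t)"
        using D by (rule has_vector_derivative_of_real)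
      have 2: "((\<lambda>t. complex_of_real t) has_vector_derivative of_real 1) (at t)"
        using DERIV_ident by (rule has_vector_derivative_of_real)
      have "((\<lambda>t. complex_of_real (S t) + \<i> * complex_of_real t)
          has_vector_derivative (of_real D + \<i> * of_real 1)) (at t)"
        using has_vector_derivative_add[OF 1 has_vector_derivative_mult_right[OF 2]] .
      then show ?thesis unfolding \<gamma>_def Complex_eq by (simp only: of_real_1 mult_1_right)
    qed
    then have w: "(F \<circ> \<gamma> has_vector_derivative (of_real D + \<i>) * f (\<gamma> t)) (at t)"
      by (rule field_vector_diff_chain_at[OF _ F]) (use t sub in \<open>auto simp: image_subset_iff\<close>)
    have e1: "F \<circ> \<gamma> = h" by (rule ext) (simp only: h_def o_def)
    have e2: "(of_real D + \<i>) * f (\<gamma> t) = screen_integrand S f t"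
      unfolding screen_integrand_def D' \<gamma>_def by (rule mult.commute)
    show ?thesis using w unfolding e1 e2 .
  qed
  have R: "screen_integrand S f absolutely_integrable_on {a..b}"
    "integral {a..b} (screen_integrand S f) = h b - h a"
    using integral_lipschitz_derivative[of a b \<delta> h "M * (L + 1)" N
      "screen_integrand S f"] ab \<delta> lip N d by blast+
  show "screen_integrand S f absolutely_integrable_on {a..b}" by (rule R(1))
  show "truncated_screen_integral a b S f = F (Complex (S b) b) - F (Complex (S a) a)"
    unfolding truncated_screen_integral_def set_lebesgue_integral_eq_integral(2)[OF R(1)] R(2) h_def
      \<gamma>_def ..
qed

text \<open>
  The integral of \<open>f\<close> along the positively oriented boundary of the region between the graph of \<open>S\<close>
  (on the left) and the line \<open>Re s = c\<close> (on the right), for imaginary parts from \<open>a\<close> to \<open>b\<close>. The line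
  is treated as the graph of a constant function.
\<close>

definition graph_boundary_integral ::
    "(complex \<Rightarrow> complex) \<Rightarrow> (real \<Rightarrow> real) \<Rightarrow> real \<Rightarrow> real \<Rightarrow> real \<Rightarrow> complex" where
  "graph_boundary_integral f S c a b =
     truncated_screen_integral a b (\<lambda>_. c) f - truncated_screen_integral a b S f
     + contour_integral (linepath (Complex (S a) a) (Complex c a)) f
     - contour_integral (linepath (Complex (S b) b) (Complex c b)) f"

text \<open>
  Integrability of \<open>f\<close> along each of the four pieces of this boundary.
\<close>

definition graph_boundary_integrable ::
    "(complex \<Rightarrow> complex) \<Rightarrow> (real \<Rightarrow> real) \<Rightarrow> real \<Rightarrow> real \<Rightarrow> real \<Rightarrow> bool" where
  "graph_boundary_integrable f S c a b \<longleftrightarrow>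
     screen_integrand (\<lambda>_. c) f absolutely_integrable_on {a..b} \<and>
     screen_integrand S f absolutely_integrable_on {a..b} \<and>
     f contour_integrable_on linepath (Complex (S a) a) (Complex c a) \<and>
     f contour_integrable_on linepath (Complex (S b) b) (Complex c b)"

text \<open>
  The closed region enclosed by this boundary, provided that \<open>S\<close> stays to the left of \<open>c\<close>.
\<close>

definition graph_region :: "(real \<Rightarrow> real) \<Rightarrow> real \<Rightarrow> real \<Rightarrow> real \<Rightarrow> complex set" where
  "graph_region S c a b = {s. S (Im s) \<le> Re s \<and> Re s \<le> c \<and> a \<le> Im s \<and> Im s \<le> b}"

lemma screen_integrand_add:
  "screen_integrand S (\<lambda>s. f s + g s) t = screen_integrand S f t + screen_integrand S g t"
  by (simp add: screen_integrand_def algebra_simps)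

lemma screen_integrand_cmult:
  "screen_integrand S (\<lambda>s. k * f s) t = k * screen_integrand S f t"
  by (simp add: screen_integrand_def algebra_simps)

lemma graph_boundary_add:
  assumes "graph_boundary_integrable f S c a b" "graph_boundary_integrable g S c a b"
  shows "graph_boundary_integrable (\<lambda>s. f s + g s) S c a b"
    and "graph_boundary_integral (\<lambda>s. f s + g s) S c a b
       = graph_boundary_integral f S c a b + graph_boundary_integral g S c a b"
proof -
  note A = assms[unfolded graph_boundary_integrable_def]
  have 1: "screen_integrand R (\<lambda>s. f s + g s) absolutely_integrable_on {a..b}"
    "truncated_screen_integral a b R (\<lambda>s. f s + g s)
        = truncated_screen_integral a b R f + truncated_screen_integral a b R g"
    if "screen_integrand R f absolutely_integrable_on {a..b}"
      "screen_integrand R g absolutely_integrable_on {a..b}" for R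
    unfolding truncated_screen_integral_def screen_integrand_add
    using set_integral_add[OF that] by auto
  show "graph_boundary_integrable (\<lambda>s. f s + g s) S c a b"
    using A 1(1) unfolding graph_boundary_integrable_def by (auto intro: contour_integrable_add)
  show "graph_boundary_integral (\<lambda>s. f s + g s) S c a b
       = graph_boundary_integral f S c a b + graph_boundary_integral g S c a b"
    using A 1(2) unfolding graph_boundary_integral_def by (simp add: contour_integral_add)
qed

lemma graph_boundary_cmult:
  assumes "graph_boundary_integrable f S c a b"
  shows "graph_boundary_integrable (\<lambda>s. k * f s) S c a b"
    and "graph_boundary_integral (\<lambda>s. k * f s) S c a b = k * graph_boundary_integral f S c a b"
proof -
  note A = assms[unfolded graph_boundary_integrable_def]
  have 1: "screen_integrand R (\<lambda>s. k * f s) absolutely_integrable_on {a..b}"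
    "truncated_screen_integral a b R (\<lambda>s. k * f s) = k * truncated_screen_integral a b R f"
    if "screen_integrand R f absolutely_integrable_on {a..b}" for R
    unfolding truncated_screen_integral_def screen_integrand_cmult
    using that by (auto simp: set_integral_mult_right intro: set_integrable_mult_right)
  show "graph_boundary_integrable (\<lambda>s. k * f s) S c a b"
    using A 1(1) unfolding graph_boundary_integrable_def by (auto intro: contour_integrable_lmul)
  show "graph_boundary_integral (\<lambda>s. k * f s) S c a b = k * graph_boundary_integral f S c a b"
    using A 1(2) unfolding graph_boundary_integral_def
      by (simp add: contour_integral_lmul algebra_simps)
qed

lemma closed_segment_horizontal:
  assumes "x \<le> y"
  shows "closed_segment (Complex x t) (Complex y t) = {s. x \<le> Re s \<and> Re s \<le> y \<and> Im s = t}"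
proof (intro equalityI subsetI)
  fix s assume "s \<in> closed_segment (Complex x t) (Complex y t)"
  then obtain u where u: "0 \<le> u" "u \<le> 1" "s = (1 - u) *\<^sub>R Complex x t + u *\<^sub>R Complex y t"
    unfolding closed_segment_def by blast
  have "Re s = (1 - u) * x + u * y" "Im s = (1 - u) * t + u * t" by (simp_all add: u(3))
  then have "Re s = x + u * (y - x)" "Im s = t" by (simp_all add: algebra_simps)
  moreover have "0 \<le> u * (y - x)" "u * (y - x) \<le> 1 * (y - x)"
    using u mult_right_mono[of u 1 "y - x"] assms by auto
  ultimately show "s \<in> {s. x \<le> Re s \<and> Re s \<le> y \<and> Im s = t}" by auto
next
  fix s assume "s \<in> {s. x \<le> Re s \<and> Re s \<le> y \<and> Im s = t}"
  then have s: "x \<le> Re s" "Re s \<le> y" "Im s = t" by auto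
  show "s \<in> closed_segment (Complex x t) (Complex y t)"
  proof (cases "x = y")
    case True
    then show ?thesis using s by (auto simp: complex_eq_iff)
  next
    case False
    define u where "u = (Re s - x) / (y - x)"
    have "u * (y - x) = Re s - x" using False by (simp add: u_def)
    moreover have "0 \<le> u" "u \<le> 1" using s assms False by (auto simp: u_def divide_le_eq)
    ultimately show ?thesis unfolding closed_segment_def using s
      by (intro CollectI exI[of _ u]) (auto simp: complex_eq_iff algebra_simps)
  qed
qed

lemma graph_boundary_cong:
  assumes "a \<le> b" "\<And>t. S t < c"
    and eq: "\<And>s. s \<in> graph_region S c a b - {s. S (Im s) < Re s \<and> Re s < c \<and> a < Im s \<and> Im s < b}
        \<Longrightarrow> f s = g s"
  shows "graph_boundary_integrable f S c a b \<longleftrightarrow> graph_boundary_integrable g S c a b"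
    and "graph_boundary_integral f S c a b = graph_boundary_integral g S c a b"
proof -
  have e1: "screen_integrand (\<lambda>_. c) f t = screen_integrand (\<lambda>_. c) g t" 
       "screen_integrand S f t = screen_integrand S g t" if "t \<in> {a..b}" for t
    unfolding screen_integrand_def
    by (rule arg_cong2[of _ _ _ _ "(*)", OF eq refl]; use that assms(2)[of t] in \<open>auto simp:
      graph_region_def\<close>)+
  have seg: "f x = g x" if "x \<in> closed_segment (Complex (S t) t) (Complex c t)" "t = a \<or> t = b"
    for x t
  proof (rule eq)
    have "Im x = t \<and> S t \<le> Re x \<and> Re x \<le> c"
      using that(1) unfolding closed_segment_horizontal[OF less_imp_le[OF assms(2)]] by auto
    then show "x \<in> graph_region S c a b - {s. S (Im s) < Re s \<and> Re s < c \<and> a < Im s \<and> Im s < b}"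
      using that(2) assms(1) by (auto simp: graph_region_def)
  qed
  have e2: "f contour_integrable_on linepath (Complex (S t) t) (Complex c t)
      \<longleftrightarrow> g contour_integrable_on linepath (Complex (S t) t) (Complex c t)"
    "contour_integral (linepath (Complex (S t) t) (Complex c t)) f
        = contour_integral (linepath (Complex (S t) t) (Complex c t)) g"
    if "t = a \<or> t = b" for t
  proof -
    have "\<And>x. x \<in> path_image (linepath (Complex (S t) t) (Complex c t)) \<Longrightarrow> f x = g x" using seg that
      by auto
    then show "contour_integral (linepath (Complex (S t) t) (Complex c t)) f
        = contour_integral (linepath (Complex (S t) t) (Complex c t)) g"
      by (intro contour_integral_eq)
    show "f contour_integrable_on linepath (Complex (S t) t) (Complex c t)
        \<longleftrightarrow> g contour_integrable_on linepath (Complex (S t) t) (Complex c t)"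
      using seg that by (auto intro: contour_integrable_eq)
  qed
  have e3: "screen_integrand (\<lambda>_. c) f absolutely_integrable_on {a..b}
      \<longleftrightarrow> screen_integrand (\<lambda>_. c) g absolutely_integrable_on {a..b}"
    "screen_integrand S f absolutely_integrable_on {a..b}
        \<longleftrightarrow> screen_integrand S g absolutely_integrable_on {a..b}"
    by (intro set_integrable_cong refl e1; assumption)+
  have e4: "truncated_screen_integral a b (\<lambda>_. c) f = truncated_screen_integral a b (\<lambda>_. c) g"
     "truncated_screen_integral a b S f = truncated_screen_integral a b S g"
    unfolding truncated_screen_integral_def using e1 by (auto intro!: set_lebesgue_integral_cong)
  show "graph_boundary_integrable f S c a b \<longleftrightarrow> graph_boundary_integrable g S c a b"
    unfolding graph_boundary_integrable_def using e2 e3 by simp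
  show "graph_boundary_integral f S c a b = graph_boundary_integral g S c a b"
    unfolding graph_boundary_integral_def using e2 e4 by simp
qed

lemma graph_boundary_primitive_parts:
  assumes S: "L-lipschitz_on UNIV S" and Sc: "\<And>t. S t < c" and ab: "a \<le> b"
    and "open \<Omega>" and F: "\<And>z. z \<in> \<Omega> \<Longrightarrow> (F has_field_derivative f z) (at z)"
    and sub: "graph_region S c a b - {s. S (Im s) < Re s \<and> Re s < c \<and> a < Im s \<and> Im s < b} \<subseteq> \<Omega>"
  shows "graph_boundary_integrable f S c a b" "graph_boundary_integral f S c a b = 0"
proof -
  have c: "0-lipschitz_on UNIV (\<lambda>_::real. c)" by (auto simp: lipschitz_on_def)
  have in1: "Complex c t \<in> \<Omega>" "Complex (S t) t \<in> \<Omega>" if "t \<in> {a..b}" for t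
    using that Sc[of t] by (auto intro!: subsetD[OF sub] simp: graph_region_def)
  note R = truncated_screen_integral_primitive[OF c ab \<open>open \<Omega>\<close> in1(1) F]
  note L = truncated_screen_integral_primitive[OF S ab \<open>open \<Omega>\<close> in1(2) F]
  have H: "(f has_contour_integral F (Complex c t) - F (Complex (S t) t))
      (linepath (Complex (S t) t) (Complex c t))"
    if "t = a \<or> t = b" for t
  proof -
    have "path_image (linepath (Complex (S t) t) (Complex c t)) \<subseteq> \<Omega>"
      using that ab Sc[of t]
        by (auto simp: closed_segment_horizontal[OF less_imp_le[OF Sc[of t]]] graph_region_def
        intro!: subsetD[OF sub])
    then show ?thesis
      using contour_integral_primitive[of \<Omega> F f
        "linepath (Complex (S t) t) (Complex c t)", OF has_field_derivative_at_within[OF F]]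
      by simp
  qed
  show "graph_boundary_integrable f S c a b"
    unfolding graph_boundary_integrable_def
      using R(1) L(1) H[of a] H[of b] has_contour_integral_integrable by blast
  show "graph_boundary_integral f S c a b = 0"
    unfolding graph_boundary_integral_def
      using R(2) L(2) contour_integral_unique[OF H[of a]] contour_integral_unique[OF H[of b]]
      by simp
qed

text \<open>
  The strip retracts horizontally to a segment of the line \<open>Re s = c\<close>, hence is contractible.
\<close>

lemma simply_connected_graph_strip:
  fixes S :: "real \<Rightarrow> real"
  assumes S: "\<And>t. S t < c" and \<eta>: "\<eta> > 0" and ab: "a \<le> b"
  shows "simply_connected {s. S (Im s) - \<eta> < Re s \<and> Re s < c + \<eta> \<and> a - \<eta> < Im s \<and> Im s < b + \<eta>}"
    (is "simply_connected ?W")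
proof (rule contractible_imp_simply_connected)
  have cont: "continuous_on ?W (\<lambda>s. Complex c (Im s))" "continuous_on ?W id"
    "continuous_on ?W (\<lambda>s. Complex c a)"
    by (auto intro!: continuous_intros continuous_on_Complex)
  have "homotopic_with_canon (\<lambda>z. True) ?W ?W id (\<lambda>s. Complex c (Im s))"
  proof (rule homotopic_with_linear[OF cont(2,1)])
    fix x assume x: "x \<in> ?W"
    show "closed_segment (id x) (Complex c (Im x)) \<subseteq> ?W"
    proof (cases "Re x \<le> c")
      case True
      have "closed_segment (id x) (Complex c (Im x))
          = closed_segment (Complex (Re x) (Im x)) (Complex c (Im x))" by simp
      also have "\<dots> \<subseteq> ?W" unfolding closed_segment_horizontal[OF True] using x \<eta> S by auto
      finally show ?thesis .
    next
      case False
      have "closed_segment (id x) (Complex c (Im x))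
          = closed_segment (Complex c (Im x)) (Complex (Re x) (Im x))"
        by (simp add: closed_segment_commute)
      also have "\<dots> \<subseteq> ?W" using False x \<eta> S[of "Im x"] by (subst closed_segment_horizontal) auto
      finally show ?thesis .
    qed
  qed
  moreover have "homotopic_with_canon (\<lambda>z. True) ?W ?W (\<lambda>s. Complex c (Im s)) (\<lambda>s. Complex c a)"
  proof (rule homotopic_with_linear[OF cont(1,3)])
    fix x assume x: "x \<in> ?W"
    have cv: "convex {s. Re s = c \<and> Im s > a - \<eta> \<and> Im s < b + \<eta>}"
    proof -
      have "{s. Re s = c \<and> Im s > a - \<eta> \<and> Im s < b + \<eta>}
          = {s. Re s = c} \<inter> {s. Im s > a - \<eta>} \<inter> {s. Im s < b + \<eta>}" by auto
      moreover have cr: "convex {s. Re s = c}" by (auto simp: convex_alt algebra_simps)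
      ultimately show ?thesis
        by (simp add: convex_Int convex_halfspace_Im_gt convex_halfspace_Im_lt cr)
    qed
    have "closed_segment (Complex c (Im x)) (Complex c a)
        \<subseteq> {s. Re s = c \<and> Im s > a - \<eta> \<and> Im s < b + \<eta>}"
      using x \<eta> ab by (intro closed_segment_subset cv) auto
    also have "\<dots> \<subseteq> ?W"
    proof
      fix s assume "s \<in> {s. Re s = c \<and> Im s > a - \<eta> \<and> Im s < b + \<eta>}"
      then show "s \<in> ?W" using S[of "Im s"] \<eta> by auto
    qed
    finally show "closed_segment (Complex c (Im x)) (Complex c a) \<subseteq> ?W" .
  qed
  ultimately have "homotopic_with_canon (\<lambda>z. True) ?W ?W id (\<lambda>s. Complex c a)"
    by (rule homotopic_with_trans)
  then show "contractible ?W" unfolding contractible_def by blast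
qed

lemma graph_boundary_holomorphic:
  assumes S: "L-lipschitz_on UNIV S" and Sc: "\<And>t. S t < c" and ab: "a \<le> b"
    and \<Omega>: "open \<Omega>" "graph_region S c a b \<subseteq> \<Omega>" and f: "f holomorphic_on \<Omega>"
  shows "graph_boundary_integrable f S c a b" "graph_boundary_integral f S c a b = 0"
proof -
  let ?K = "graph_region S c a b"
  have L0: "L \<ge> 0" using S lipschitz_on_nonneg by blast
  have lipS: "\<bar>S x - S y\<bar> \<le> L * \<bar>x - y\<bar>" for x y
    using lipschitz_onD[OF S, of x y] by (simp add: dist_real_def)
  have contS: "continuous_on UNIV S" using S lipschitz_on_continuous_on by blast
  have contSIm: "continuous_on A (\<lambda>s. S (Im s))" for A
    by (intro continuous_on_compose2[OF contS] continuous_intros) auto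
  have "?K = {s. S (Im s) \<le> Re s} \<inter> {s. Re s \<le> c} \<inter> {s. a \<le> Im s} \<inter> {s. Im s \<le> b}"
    by (auto simp: graph_region_def)
  moreover have "closed \<dots>"
    by (intro closed_Int closed_Collect_le contSIm continuous_intros)
  ultimately have clK: "closed ?K" by simp
  have "bounded ?K"
  proof -
    obtain m where m: "\<And>t. t \<in> {a..b} \<Longrightarrow> \<bar>S t\<bar> \<le> m"
    proof -
      have "compact (S ` {a..b})"
        by (intro compact_continuous_image continuous_on_subset[OF contS]) auto
      then have "bounded (S ` {a..b})" by (rule compact_imp_bounded)
      then show ?thesis using that unfolding bounded_iff by fastforce
    qed
    have "?K \<subseteq> cball 0 (m + \<bar>c\<bar> + \<bar>a\<bar> + \<bar>b\<bar>)"
    proof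
      fix s assume s: "s \<in> ?K"
      have "cmod s \<le> \<bar>Re s\<bar> + \<bar>Im s\<bar>" by (rule cmod_le)
      moreover have "\<bar>Im s\<bar> \<le> \<bar>a\<bar> + \<bar>b\<bar>" using s by (auto simp: graph_region_def)
      moreover have "\<bar>Re s\<bar> \<le> m + \<bar>c\<bar>" using s m[of "Im s"] by (auto simp: graph_region_def)
      ultimately show "s \<in> cball 0 (m + \<bar>c\<bar> + \<bar>a\<bar> + \<bar>b\<bar>)" by simp
    qed
    then show ?thesis using bounded_cball bounded_subset by blast
  qed
  then have cK: "compact ?K" using clK by (simp add: compact_eq_bounded_closed)
  obtain e where e: "e > 0" "(\<Union>x\<in>?K. ball x e) \<subseteq> \<Omega>"
    using compact_subset_open_imp_ball_epsilon_subset[OF cK \<Omega>] by blast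
  \<comment> \<open>A point of the strip \<open>W\<close> has distance at most \<open>(L + 2) \<eta> < e\<close> from the region: move the imaginary
  part by at most \<open>\<eta>\<close>, which changes \<open>S\<close> by at most \<open>L \<eta>\<close>, and then the real part.\<close>
  define \<eta> where "\<eta> = e / (L + 3)"
  have \<eta>: "\<eta> > 0" using e L0 by (simp add: \<eta>_def)
  define W where "W = {s. S (Im s) - \<eta> < Re s \<and> Re s < c + \<eta> \<and> a - \<eta> < Im s \<and> Im s < b + \<eta>}"
  have "W = {s. S (Im s) - \<eta> < Re s} \<inter> {s. Re s < c + \<eta>} \<inter> {s. a - \<eta> < Im s} \<inter> {s. Im s < b + \<eta>}"
    by (auto simp: W_def)
  moreover have "open \<dots>"
    by (intro open_Int open_Collect_less contSIm continuous_intros)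
  ultimately have oW: "open W" by simp
  have W\<Omega>: "W \<subseteq> \<Omega>"
  proof
    fix s assume s: "s \<in> W"
    define y where "y = max a (min b (Im s))"
    define x where "x = max (S y) (min c (Re s))"
    have yI: "\<bar>y - Im s\<bar> \<le> \<eta>" "a \<le> y" "y \<le> b" using s ab \<eta> by (auto simp: y_def W_def)
    have "L * \<bar>y - Im s\<bar> \<le> L * \<eta>" using yI L0 by (intro mult_left_mono) auto
    then have SS: "\<bar>S y - S (Im s)\<bar> \<le> L * \<eta>" using lipS[of y "Im s"] by linarith
    have L\<eta>: "L * \<eta> \<ge> 0" using L0 \<eta> by simp
    have xR: "\<bar>x - Re s\<bar> \<le> L * \<eta> + \<eta>" using s SS Sc[of y] \<eta> L\<eta> unfolding x_def W_def by auto
    have "Complex x y \<in> ?K" using yI Sc[of y] by (auto simp: graph_region_def x_def)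
    moreover have "dist (Complex x y) s < e"
    proof -
      have "dist (Complex x y) s \<le> \<bar>x - Re s\<bar> + \<bar>y - Im s\<bar>"
        using cmod_le[of "Complex x y - s"] by (simp add: dist_norm)
      also have "\<dots> \<le> (L + 2) * \<eta>" using xR yI by (simp add: algebra_simps)
      also have "\<dots> < (L + 3) * \<eta>" using \<eta> by simp
      also have "\<dots> = e" using L0 by (simp add: \<eta>_def)
      finally show ?thesis .
    qed
    ultimately show "s \<in> \<Omega>" using e(2) by (auto simp: subset_iff)
  qed
  have "simply_connected W" unfolding W_def by (rule simply_connected_graph_strip[OF Sc \<eta> ab])
  then obtain F where F: "\<And>z. z \<in> W \<Longrightarrow> (F has_field_derivative f z) (at z)"
    using simply_connected_eq_global_primitive[OF oW] holomorphic_on_subset[OF f W\<Omega>] by blast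
  have sub: "?K - {s. S (Im s) < Re s \<and> Re s < c \<and> a < Im s \<and> Im s < b} \<subseteq> W"
    using \<eta> by (auto simp: graph_region_def W_def)
  show "graph_boundary_integrable f S c a b" "graph_boundary_integral f S c a b = 0"
    using graph_boundary_primitive_parts[OF S Sc ab oW F sub] by auto
qed

lemma Ln_minus_Ln_uminus:
  assumes "Im z \<noteq> 0"
  shows "Ln z - Ln (- z) = (if Im z > 0 then \<i> * pi else - \<i> * pi)"
proof -
  have "z \<noteq> 0" using assms by auto
  then have "Ln (- z) = (if 0 \<le> Im z
      \<and> \<not> (Re z < 0 \<and> Im z = 0) then Ln z - \<i> * pi else Ln z + \<i> * pi)"
    using Ln_minus[of z] assms by auto
  then show ?thesis using assms by auto
qed

text \<open>
  On the line and the two horizontal segments a primitive of \<open>1/(s-p)\<close> is the logarithm \<open>Ln (s-p)\<close>,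
  cut to the left of \<open>p\<close>; on the graph it is \<open>Ln (p-s)\<close>, cut to the right. At the two corners on the
  graph the primitives differ by \<open>\<plusminus>\<pi>i\<close>.
\<close>

lemma graph_boundary_simple_pole:
  assumes S: "L-lipschitz_on UNIV S" and Sc: "\<And>t. S t < c" and ab: "a \<le> b"
    and p: "S (Im p) < Re p" "Re p < c" "a < Im p" "Im p < b"
  shows "graph_boundary_integrable (\<lambda>s. 1 / (s - p)) S c a b"
        "graph_boundary_integral (\<lambda>s. 1 / (s - p)) S c a b = 2 * of_real pi * \<i>"
proof -
  let ?f = "\<lambda>s. 1 / (s - p)"
  have c: "0-lipschitz_on UNIV (\<lambda>_::real. c)" by (auto simp: lipschitz_on_def)
  define W1 where "W1 = {s. s - p \<notin> \<real>\<^sub>\<le>\<^sub>0}"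
  define W2 where "W2 = {s. p - s \<notin> \<real>\<^sub>\<le>\<^sub>0}"
  have "W1 = (\<lambda>s. s - p) -` (- \<real>\<^sub>\<le>\<^sub>0)" "W2 = (\<lambda>s. p - s) -` (- \<real>\<^sub>\<le>\<^sub>0)" by (auto simp: W1_def W2_def)
  then have o: "open W1" "open W2"
    by (auto intro!: open_vimage continuous_intros simp: open_Compl)
  define F1 where "F1 s = Ln (s - p)" for s
  define F2 where "F2 s = Ln (p - s)" for s
  have d1: "(F1 has_field_derivative ?f z) (at z)" if "z \<in> W1" for z
    unfolding F1_def using that
      by (auto intro!: derivative_eq_intros simp: W1_def inverse_eq_divide)
  have d2: "(F2 has_field_derivative ?f z) (at z)" if "z \<in> W2" for z
  proof -
    have "p - z \<noteq> 0" using that by (auto simp: W2_def)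
    then have "- (1 / (p - z)) = 1 / (z - p)" by (simp add: divide_simps)
    moreover have "(F2 has_field_derivative - (1 / (p - z))) (at z)"
      unfolding F2_def using that
        by (auto intro!: derivative_eq_intros simp: W2_def inverse_eq_divide)
    ultimately show ?thesis by simp
  qed
  have i1: "Complex c t \<in> W1" for t using p by (auto simp: W1_def complex_nonpos_Reals_iff)
  have i2: "Complex (S t) t \<in> W2" for t using p by (auto simp: W2_def complex_nonpos_Reals_iff)
  note R = truncated_screen_integral_primitive[OF c ab o(1) i1 d1]
  note L = truncated_screen_integral_primitive[OF S ab o(2) i2 d2]
  have H: "(?f has_contour_integral F1 (Complex c t) - F1 (Complex (S t) t))
      (linepath (Complex (S t) t) (Complex c t))"
    if "t = a \<or> t = b" for t
  proof -
    have "path_image (linepath (Complex (S t) t) (Complex c t)) \<subseteq> W1"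
      using that p Sc[of t]
        by (auto simp: closed_segment_horizontal[OF less_imp_le[OF Sc[of t]]] W1_def
        complex_nonpos_Reals_iff)
    then show ?thesis
      using contour_integral_primitive[of W1 F1 ?f
        "linepath (Complex (S t) t) (Complex c t)", OF has_field_derivative_at_within[OF d1]]
      by simp
  qed
  show "graph_boundary_integrable ?f S c a b"
    unfolding graph_boundary_integrable_def
      using R(1) L(1) H[of a] H[of b] has_contour_integral_integrable by blast
  have "graph_boundary_integral ?f S c a b =
      (F1 (Complex (S b) b) - F2 (Complex (S b) b)) - (F1 (Complex (S a) a) - F2 (Complex (S a) a))"
    unfolding graph_boundary_integral_def
      using R(2) L(2) contour_integral_unique[OF H[of a]] contour_integral_unique[OF H[of b]]
      by simp
  also have "F1 (Complex (S b) b) - F2 (Complex (S b) b) = \<i> * pi"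
    using Ln_minus_Ln_uminus[of "Complex (S b) b - p"] p by (simp add: F1_def F2_def)
  also have "F1 (Complex (S a) a) - F2 (Complex (S a) a) = - \<i> * pi"
    using Ln_minus_Ln_uminus[of "Complex (S a) a - p"] p by (simp add: F1_def F2_def)
  finally show "graph_boundary_integral ?f S c a b = 2 * of_real pi * \<i>" by simp
qed

lemma graph_boundary_sum_simple_poles:
  assumes S: "L-lipschitz_on UNIV S" and Sc: "\<And>t. S t < c" and ab: "a \<le> b"
    and \<Omega>: "open \<Omega>" "graph_region S c a b \<subseteq> \<Omega>" and H: "H holomorphic_on \<Omega>"
    and P: "finite P" "P \<subseteq> {s. S (Im s) < Re s \<and> Re s < c \<and> a < Im s \<and> Im s < b}"
  shows "graph_boundary_integrable (\<lambda>s. H s + (\<Sum>p\<in>P. \<rho> p * (1 / (s - p)))) S c a b \<and>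
        graph_boundary_integral (\<lambda>s. H s + (\<Sum>p\<in>P. \<rho> p * (1 / (s - p)))) S c a b
            = 2 * of_real pi * \<i> * (\<Sum>p\<in>P. \<rho> p)"
  using P
proof (induction P rule: finite_induct)
  case empty
  then show ?case using graph_boundary_holomorphic[OF S Sc ab \<Omega> H] by simp
next
  case (insert q P)
  let ?h = "\<lambda>s. H s + (\<Sum>p\<in>P. \<rho> p * (1 / (s - p)))"
  have IH: "graph_boundary_integrable ?h S c a b" 
        "graph_boundary_integral ?h S c a b = 2 * of_real pi * \<i> * (\<Sum>p\<in>P. \<rho> p)" using insert by auto
  have q: "graph_boundary_integrable (\<lambda>s. 1 / (s - q)) S c a b"
        "graph_boundary_integral (\<lambda>s. 1 / (s - q)) S c a b = 2 * of_real pi * \<i>"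
    using graph_boundary_simple_pole[OF S Sc ab, of q] insert.prems by auto
  note c = graph_boundary_cmult[OF q(1), of "\<rho> q"]
  have eq: "(\<lambda>s. H s + (\<Sum>p\<in>insert q P. \<rho> p * (1 / (s - p)))) = (\<lambda>s. ?h s + \<rho> q * (1 / (s - q)))"
    using insert(1,2) by (auto simp: fun_eq_iff)
  have "graph_boundary_integral (\<lambda>s. ?h s + \<rho> q * (1 / (s - q))) S c a b
      = 2 * of_real pi * \<i> * (\<Sum>p\<in>insert q P. \<rho> p)"
    unfolding graph_boundary_add(2)[OF IH(1) c(1)] IH(2) c(2) q(2) using insert(1,2)
      by (simp add: algebra_simps)
  then show ?case unfolding eq using graph_boundary_add(1)[OF IH(1) c(1)] by blast
qed

lemma remove_sings_analytic_at_weak_limit: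
  assumes "isolated_singularity_at f p" and "(\<lambda>s. (s - p) * f s) \<midarrow>p\<rightarrow> 0"
  shows "remove_sings f analytic_on {p}"
proof -
  obtain r where r: "r > 0" "f analytic_on ball p r - {p}"
    using assms(1) unfolding isolated_singularity_at_def by blast
  then have "f holomorphic_on (ball p r - {p})" using analytic_imp_holomorphic by blast
  moreover have "p \<in> interior (ball p r)" using r by simp
  ultimately obtain g where g: "g holomorphic_on ball p r" "\<And>z. z \<in> ball p r - {p} \<Longrightarrow> g z = f z"
    using holomorphic_on_extend_lim assms(2) by blast
  have "isCont g p" using continuous_on_interior[OF holomorphic_on_imp_continuous_on[OF g(1)], of p]
    r(1) by simp
  then have "g \<midarrow>p\<rightarrow> g p" by (simp add: isCont_def)
  then have "f \<midarrow>p\<rightarrow> g p"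
    by (rule Lim_transform_within_open[of _ _ _ _ "ball p r"]) (use g r in auto)
  then show ?thesis using assms(1) by (intro remove_sings_analytic_at)
qed

text \<open>
  The residue theorem for the region between a Lipschitz graph and a vertical line, for simple
  poles. The hypothesis \<open>res\<close> also covers removable singularities, with \<open>\<rho> p = 0\<close>; this happens
  when a coefficient vanishes.
\<close>

lemma graph_boundary_residues:
  assumes S: "L-lipschitz_on UNIV S" and Sc: "\<And>t. S t < c" and ab: "a \<le> b"
    and P: "finite P" "P \<subseteq> {s. S (Im s) < Re s \<and> Re s < c \<and> a < Im s \<and> Im s < b}"
    and f: "\<And>s. s \<in> graph_region S c a b - P \<Longrightarrow> f analytic_on {s}"
    and iso: "\<And>p. p \<in> P \<Longrightarrow> isolated_singularity_at f p"
    and res: "\<And>p. p \<in> P \<Longrightarrow> (\<lambda>s. (s - p) * f s) \<midarrow>p\<rightarrow> \<rho> p"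
  shows "graph_boundary_integrable f S c a b"
    and "graph_boundary_integral f S c a b = 2 * of_real pi * \<i> * (\<Sum>p\<in>P. \<rho> p)"
proof -
  \<comment> \<open>The remainder without the principal parts has only removable singularities in the region.\<close>
  define g where "g s = f s - (\<Sum>p\<in>P. \<rho> p * (1 / (s - p)))" for s
  have an: "(\<lambda>s. \<Sum>p\<in>Q. \<rho> p * (1 / (s - p))) analytic_on {z}" if "z \<notin> Q" for z Q
    using that by (auto intro!: analytic_intros)
  have ga: "g analytic_on {s}" if "s \<in> graph_region S c a b - P" for s
    unfolding g_def using f[OF that] an[of s P] that by (intro analytic_on_diff) auto
  have gp: "remove_sings g analytic_on {p}" if p: "p \<in> P" for p
  proof (rule remove_sings_analytic_at_weak_limit)
    have "(\<lambda>s. \<Sum>q\<in>P. \<rho> q * (1 / (s - q))) meromorphic_on {p}" by (intro meromorphic_intros)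
    then show "isolated_singularity_at g p"
      unfolding g_def by (rule
        isolated_singularity_at_minus[OF iso[OF p] meromorphic_on_isolated_singularity])
    have split: "(\<Sum>q\<in>P. \<rho> q * (1 / (s - q)))
        = \<rho> p * (1 / (s - p)) + (\<Sum>q\<in>P - {p}. \<rho> q * (1 / (s - q)))" for s
      using P(1) p by (simp add: sum.remove)
    have "isCont (\<lambda>s. \<Sum>q\<in>P - {p}. \<rho> q * (1 / (s - q))) p" by (intro analytic_at_imp_isCont an) auto
    then have lim: "(\<lambda>s. \<Sum>q\<in>P - {p}. \<rho> q * (1 / (s - q))) \<midarrow>p\<rightarrow> (\<Sum>q\<in>P - {p}. \<rho> q * (1 / (p - q)))"
      by (simp add: isCont_def)
    have "(\<lambda>s. (s - p) * f s - \<rho> p - (s - p) * (\<Sum>q\<in>P - {p}. \<rho> q * (1 / (s - q)))) \<midarrow>p\<rightarrow>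
          \<rho> p - \<rho> p - (p - p) * (\<Sum>q\<in>P - {p}. \<rho> q * (1 / (p - q)))"
      by (intro tendsto_intros res[OF p] lim)
    then have L: "(\<lambda>s. (s - p) * f s - \<rho> p - (s - p) * (\<Sum>q\<in>P - {p}. \<rho> q * (1 / (s - q)))) \<midarrow>p\<rightarrow> 0"
      by simp
    have E: "(s - p) * f s - \<rho> p - (s - p) * (\<Sum>q\<in>P - {p}. \<rho> q * (1 / (s - q))) = (s - p) * g s"
      if "s \<noteq> p" for s
    proof -
      have "(s - p) * (\<rho> p * (1 / (s - p))) = \<rho> p" using that by simp
      then show ?thesis unfolding g_def split right_diff_distrib distrib_left by simp
    qed
    show "(\<lambda>s. (s - p) * g s) \<midarrow>p\<rightarrow> 0"
      by (rule Lim_transform_within[OF L zero_less_one]) (rule E, simp)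
  qed
  have "remove_sings g analytic_on (graph_region S c a b)"
  proof (subst analytic_on_analytic_at, intro ballI)
    fix s assume "s \<in> graph_region S c a b"
    then show "remove_sings g analytic_on {s}"
      using gp ga[of s] remove_sings_analytic_on by (cases "s \<in> P") auto
  qed
  then obtain \<Omega> where \<Omega>: "open \<Omega>" "graph_region S c a b \<subseteq> \<Omega>" "remove_sings g holomorphic_on \<Omega>"
    unfolding analytic_on_holomorphic by blast
  let ?h = "\<lambda>s. remove_sings g s + (\<Sum>p\<in>P. \<rho> p * (1 / (s - p)))"
  have eq: "f s = ?h s"
    if s: "s \<in> graph_region S c a b - {s. S (Im s) < Re s \<and> Re s < c \<and> a < Im s \<and> Im s < b}" for s
  proof -
    have "s \<in> graph_region S c a b - P" using s P(2) by blast
    then show ?thesis using ga by (simp add: g_def)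
  qed
  note cong = graph_boundary_cong[where f=f and g="?h" and S=S, OF ab Sc eq]
  note sm = graph_boundary_sum_simple_poles[OF S Sc ab \<Omega> P, of \<rho>]
  show "graph_boundary_integrable f S c a b" using cong(1) sm by blast
  show "graph_boundary_integral f S c a b = 2 * of_real pi * \<i> * (\<Sum>p\<in>P. \<rho> p)" using cong(2) sm
    by simp
qed

lemma integrable_inverse_one_plus_square: "integrable lborel (\<lambda>t::real. 1 / (1 + t\<^sup>2))"
proof -
  have d: "DERIV arctan x :> 1 / (1 + x\<^sup>2)" for x :: real
    using DERIV_arctan[of x] by (simp add: inverse_eq_divide)
  have pos: "(\<integral>\<^sup>+t. ennreal (1 / (1 + t\<^sup>2)) * indicator {0..} t \<partial>lborel)
      = ennreal (pi / 2 - arctan 0)"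
    by (rule nn_integral_FTC_atLeast[OF _ d _ tendsto_arctan_at_top]) auto
  have neg: "(\<integral>\<^sup>+t. ennreal (1 / (1 + t\<^sup>2)) * indicator {..0} t \<partial>lborel)
      = ennreal (pi / 2 - arctan 0)"
    unfolding pos[symmetric]
    by (subst nn_integral_real_affine[where c="-1"
      and t=0]) (auto simp: indicator_def intro!: nn_integral_cong)
  have "(\<integral>\<^sup>+t. ennreal (norm (1 / (1 + (t::real)\<^sup>2))) \<partial>lborel) \<le>
        (\<integral>\<^sup>+t. ennreal (1 / (1 + t\<^sup>2)) * indicator {0..} t + ennreal (1 / (1 + t\<^sup>2))
            * indicator {..0} t \<partial>lborel)"
    by (intro nn_integral_mono) (auto simp: indicator_def)
  also have "\<dots> = ennreal (pi / 2 - arctan 0) + ennreal (pi / 2 - arctan 0)"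
    by (subst nn_integral_add) (auto simp: pos neg)
  also have "\<dots> < \<infinity>" by (simp add: ennreal_add_less_top)
  finally show ?thesis by (intro integrableI_bounded) auto
qed

lemma integrable_lebesgue_inverse_one_plus_square:
  "integrable lebesgue (\<lambda>t::real. C / (1 + t\<^sup>2))"
proof -
  have "integrable lborel (\<lambda>t::real. C * (1 / (1 + t\<^sup>2)))"
    by (intro integrable_mult_right integrable_inverse_one_plus_square)
  then have "integrable lborel (\<lambda>t::real. C / (1 + t\<^sup>2))" by simp
  then show ?thesis using integrable_completion[of "\<lambda>t::real. C / (1 + t\<^sup>2)" lborel] by auto
qed

text \<open>
  A Lipschitz graph that avoids a real point stays away from it at a distance comparable to
  \<open>\<surd>(1 + t\<^sup>2)\<close>, which turns products of two such distances into an integrable majorant.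
\<close>

lemma graph_distance_lower_bound:
  assumes S: "L-lipschitz_on UNIV S" and k: "S 0 \<noteq> k"
  obtains m where "m > 0" "\<And>t. m * sqrt (1 + t\<^sup>2) \<le> cmod (Complex (S t) t - of_real k)"
proof -
  have cont: "continuous_on {-1..1} (\<lambda>t. cmod (Complex (S t) t - of_real k))"
    by (intro continuous_intros continuous_on_Complex_graph[OF S])
  have "{-1..1::real} \<noteq> {}" by simp
  then obtain t0 where t0: "t0 \<in> {-1..1}" "\<And>t. t \<in> {-1..1} \<Longrightarrow>
      cmod (Complex (S t0) t0 - of_real k) \<le> cmod (Complex (S t) t - of_real k)"
    using continuous_attains_inf[OF compact_Icc _ cont] by blast
  define m0 where "m0 = cmod (Complex (S t0) t0 - of_real k)"
  have m0: "m0 > 0" using k by (cases "t0 = 0") (auto simp: m0_def complex_eq_iff)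
  define m where "m = min m0 1 / 2"
  show ?thesis
  proof (rule that[of m])
    show "m > 0" using m0 by (simp add: m_def)
    fix t :: real
    have t: "\<bar>t\<bar> \<le> cmod (Complex (S t) t - of_real k)"
      using abs_Im_le_cmod[of "Complex (S t) t - of_real k"] by simp
    show "m * sqrt (1 + t\<^sup>2) \<le> cmod (Complex (S t) t - of_real k)"
    proof (cases "\<bar>t\<bar> \<le> 1")
      case True
      then have "t\<^sup>2 \<le> 1" by (simp add: abs_square_le_1)
      then have "sqrt (1 + t\<^sup>2) \<le> 2" by (intro real_le_lsqrt) auto
      then have "m * sqrt (1 + t\<^sup>2) \<le> m * 2" using m0 by (intro mult_left_mono) (auto simp: m_def)
      also have "\<dots> \<le> m0" by (simp add: m_def)
      also have "\<dots> \<le> cmod (Complex (S t) t - of_real k)" using t0(2)[of t] True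
        unfolding m0_def abs_le_iff by auto
      finally show ?thesis .
    next
      case False
      have "1 + t\<^sup>2 \<le> (2 * \<bar>t\<bar>)\<^sup>2" using False abs_square_le_1[of t]
        by (simp add: power_mult_distrib)
      then have "sqrt (1 + t\<^sup>2) \<le> 2 * \<bar>t\<bar>" by (intro real_le_lsqrt) auto
      then have "m * sqrt (1 + t\<^sup>2) \<le> (1/2) * (2 * \<bar>t\<bar>)" using m0
        by (intro mult_mono) (auto simp: m_def)
      then show ?thesis using t by simp
    qed
  qed
qed

lemma borel_measurable_deriv_lipschitz:
  fixes S :: "real \<Rightarrow> real"
  assumes S: "L-lipschitz_on UNIV S"
  shows "deriv S \<in> borel_measurable lebesgue"
proof -
  define N where "N = {x. \<not> (\<exists>D. (S has_real_derivative D) (at x))}"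
  have N: "negligible N" unfolding N_def by (rule lipschitz_differentiable_ae[OF S])
  \<comment> \<open>Measurability of the derivative, whose values at exceptional points are unspecified, is obtained
  from its integrability on bounded intervals.\<close>
  have "deriv S absolutely_integrable_on {- real n..real n}" for n
  proof (rule integral_lipschitz_derivative(1)[of _ _ 1 S L N])
    show "norm (S s - S t) \<le> L * \<bar>s - t\<bar>" for s t
      using lipschitz_onD[OF S, of s t] by (simp add: dist_real_def)
    show "(S has_vector_derivative deriv S t) (at t)" if "t \<notin> N" for t
      using that DERIV_imp_deriv unfolding N_def
      by (auto simp: has_real_derivative_iff_has_vector_derivative[symmetric])
  qed (use N in auto)
  then have m: "(\<lambda>t. indicat_real {- real n..real n} t *\<^sub>R deriv S t) \<in> borel_measurable lebesgue"
    for n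
    unfolding set_integrable_def by (rule borel_measurable_integrable)
  show ?thesis
  proof (rule borel_measurable_LIMSEQ_metric[OF m])
    fix t :: real
    obtain n0 :: nat where "\<bar>t\<bar> \<le> real n0" using real_arch_simple by blast
    then have "eventually (\<lambda>n. indicat_real {- real n..real n} t *\<^sub>R deriv S t = deriv S t)
        sequentially"
      by (intro eventually_sequentiallyI[of n0]) (auto simp: indicator_def)
    then show "(\<lambda>n. indicat_real {- real n..real n} t *\<^sub>R deriv S t) \<longlonglongrightarrow> deriv S t"
      by (rule tendsto_eventually)
  qed
qed

lemma screen_integrable_bound:
  assumes S: "L-lipschitz_on UNIV S"
    and f: "continuous_on UNIV (\<lambda>t. f (Complex (S t) t))"
    and bnd: "\<And>t. cmod (f (Complex (S t) t)) \<le> C / (1 + t\<^sup>2)"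
  shows "screen_integrable S f"
  unfolding screen_integrable_def
proof (rule Bochner_Integration.integrable_bound)
  show "integrable lebesgue (\<lambda>t::real. (C * (L + 1)) / (1 + t\<^sup>2))"
    by (rule integrable_lebesgue_inverse_one_plus_square)
  have "(\<lambda>t. f (Complex (S t) t)) \<in> borel_measurable lborel"
    using borel_measurable_continuous_onI[OF f] by simp
  then have fm: "(\<lambda>t. f (Complex (S t) t)) \<in> borel_measurable lebesgue"
    by (rule measurable_completion)
  have dm: "(\<lambda>t. complex_of_real (deriv S t) + \<i>) \<in> borel_measurable lebesgue"
    by (intro borel_measurable_add borel_measurable_const
        measurable_compose[OF borel_measurable_deriv_lipschitz[OF S]
          borel_measurable_continuous_onI[OF continuous_on_of_real_id]])
  show "screen_integrand S f \<in> borel_measurable lebesgue"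
    unfolding screen_integrand_def[abs_def] by (intro borel_measurable_times fm dm)
  define N where "N = {x. \<not> (\<exists>D. (S has_real_derivative D) (at x))}"
  have "N \<in> null_sets lebesgue" 
    using lipschitz_differentiable_ae[OF S] unfolding N_def negligible_iff_null_sets .
  then have ae: "AE t in lebesgue. t \<notin> N" by (rule AE_not_in)
  have b: "norm (screen_integrand S f t) \<le> norm ((C * (L + 1)) / (1 + t\<^sup>2))" if "t \<notin> N" for t
  proof -
    obtain D where D: "(S has_real_derivative D) (at t)" using \<open>t \<notin> N\<close> unfolding N_def by blast
    have DL: "\<bar>D\<bar> \<le> L"
    proof (rule tendsto_upperbound)
      show "((\<lambda>y. \<bar>(S y - S t) / (y - t)\<bar>) \<longlongrightarrow> \<bar>D\<bar>) (at t)"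
        using D by (intro tendsto_rabs) (simp add: has_field_derivative_iff)
      have "\<bar>(S y - S t) / (y - t)\<bar> \<le> L" if "y \<noteq> t" for y
        using lipschitz_onD[OF S, of y t] that by (simp add: dist_real_def divide_le_eq)
      then show "\<forall>\<^sub>F y in at t. \<bar>(S y - S t) / (y - t)\<bar> \<le> L"
        unfolding eventually_at by (intro exI[of _ 1]) simp
    qed simp
    have "cmod (of_real (deriv S t) + \<i>) \<le> L + 1"
      using norm_triangle_ineq[of "complex_of_real (deriv S t)" \<i>] DL DERIV_imp_deriv[OF D] by simp
    then have "norm (screen_integrand S f t) \<le> C / (1 + t\<^sup>2) * (L + 1)"
      unfolding screen_integrand_def norm_mult
      using bnd[of t] by (intro mult_mono order_trans[OF norm_ge_zero bnd]) auto
    also have "\<dots> = (C * (L + 1)) / (1 + t\<^sup>2)" by simp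
    also have "\<dots> \<le> norm ((C * (L + 1)) / (1 + t\<^sup>2))" unfolding real_norm_def by (rule abs_ge_self)
    finally show ?thesis .
  qed
  show "AE t in lebesgue. norm (screen_integrand S f t) \<le> norm ((C * (L + 1)) / (1 + t\<^sup>2))"
    using ae by (rule AE_mp) (use b in auto)
qed

lemma truncated_screen_integral_LIMSEQ:
  assumes f: "screen_integrable S f"
    and a: "filterlim a at_bot sequentially" and b: "filterlim b at_top sequentially"
  shows "(\<lambda>n. truncated_screen_integral (a n) (b n) S f) \<longlonglongrightarrow> screen_integral S f"
  unfolding truncated_screen_integral_def screen_integral_def set_lebesgue_integral_def
proof (rule integral_dominated_convergence[where w="\<lambda>t. norm (screen_integrand S f t)"])
  note i = f[unfolded screen_integrable_def]
  show m: "screen_integrand S f \<in> borel_measurable lebesgue" using i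
    by (rule borel_measurable_integrable)
  show "integrable lebesgue (\<lambda>t. norm (screen_integrand S f t))" using i by (rule integrable_norm)
  show "(\<lambda>t. indicat_real {a n..b n} t *\<^sub>R screen_integrand S f t) \<in> borel_measurable lebesgue"
    for n
    using m by (intro borel_measurable_scaleR borel_measurable_indicator) auto
  show "AE t in lebesgue. (\<lambda>n. indicat_real {a n..b n} t *\<^sub>R screen_integrand S f t)
      \<longlonglongrightarrow> screen_integrand S f t"
  proof (rule AE_I2)
    fix t :: real
    have "eventually (\<lambda>n. a n \<le> t) sequentially" "eventually (\<lambda>n. t \<le> b n) sequentially"
      using a b unfolding filterlim_at_bot filterlim_at_top by auto
    then have "eventually (\<lambda>n. indicat_real {a n..b n} t *\<^sub>R screen_integrand S f t
        = screen_integrand S f t) sequentially"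
      by eventually_elim (simp add: indicator_def)
    then show "(\<lambda>n. indicat_real {a n..b n} t *\<^sub>R screen_integrand S f t) \<longlonglongrightarrow> screen_integrand S f t"
      by (rule tendsto_eventually)
  qed
  show "AE t in lebesgue. norm (indicat_real {a n..b n} t *\<^sub>R screen_integrand S f t)
      \<le> norm (screen_integrand S f t)" for n
    by (rule AE_I2) (auto simp: indicator_def)
qed

lemma truncated_screen_integral_const_bound:
  assumes "screen_integrand (\<lambda>_. c) f absolutely_integrable_on {a..b}" and "a \<le> b"
    and M: "\<And>t. t \<in> {a..b} \<Longrightarrow> cmod (f (Complex c t)) \<le> M"
  shows "cmod (truncated_screen_integral a b (\<lambda>_. c) f) \<le> M * (b - a)"
proof -
  have e: "truncated_screen_integral a b (\<lambda>_. c) f = integral {a..b} (screen_integrand (\<lambda>_. c) f)"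
    unfolding truncated_screen_integral_def
      by (rule set_lebesgue_integral_eq_integral(2)[OF assms(1)])
  have M0: "0 \<le> M" using order_trans[OF norm_ge_zero M[of a]] assms(2) by auto
  have "(screen_integrand (\<lambda>_. c) f has_integral integral {a..b} (screen_integrand (\<lambda>_. c) f))
      (cbox a b)"
    using set_lebesgue_integral_eq_integral(1)[OF assms(1)] by (simp add: has_integral_integral)
  then have "norm (integral {a..b} (screen_integrand (\<lambda>_. c) f)) \<le> M * measure lborel (cbox a b)"
    by (rule has_integral_bound[OF M0]) (use M in \<open>auto simp: screen_integrand_def norm_mult\<close>)
  then show ?thesis using assms(2) by (simp add: e)
qed

section \<open>A Mellin inversion formula\<close>

text \<open>
  The integrand \<open>y\<^sup>s (\<delta>-\<kappa>) / ((s-\<kappa>)(\<delta>-s))\<close>, with \<open>\<kappa> < \<delta>\<close>.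
\<close>

definition mellin_kernel :: "real \<Rightarrow> real \<Rightarrow> real \<Rightarrow> complex \<Rightarrow> complex" where
  "mellin_kernel y \<kappa> \<delta> s =
     of_real y powr s * of_real (\<delta> - \<kappa>) / ((s - of_real \<kappa>) * (of_real \<delta> - s))"

lemma continuous_on_graph_analytic:
  assumes "L-lipschitz_on UNIV S" and f: "\<And>t. f analytic_on {Complex (S t) t}"
  shows "continuous_on UNIV (\<lambda>t. f (Complex (S t) t))"
proof (rule continuous_on_compose2[OF _ continuous_on_Complex_graph[OF assms(1)]])
  have "f analytic_on range (\<lambda>t. Complex (S t) t)"
    by (subst analytic_on_analytic_at) (use f in auto)
  then show "continuous_on (range (\<lambda>t. Complex (S t) t)) f"
    by (intro holomorphic_on_imp_continuous_on analytic_imp_holomorphic)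
qed auto

lemma analytic_on_of_real_powr:
  assumes "y > 0" and "f analytic_on A"
  shows "(\<lambda>s. of_real y powr f s) analytic_on A"
proof -
  have "(\<lambda>s. exp (f s * Ln (of_real y))) analytic_on A"
    using assms(2) by (intro analytic_intros)
  then show ?thesis using assms(1) by (simp add: powr_def)
qed

lemma norm_of_real_powr:
  assumes "y > 0"
  shows "cmod (of_real y powr s) = y powr Re s"
  using assms by (simp add: norm_powr_real_powr)

lemma mellin_kernel_analytic:
  assumes "y > 0" "s \<noteq> of_real \<kappa>" "s \<noteq> of_real \<delta>"
  shows "mellin_kernel y \<kappa> \<delta> analytic_on {s}"
  unfolding mellin_kernel_def[abs_def] using assms
  by (intro analytic_intros analytic_on_of_real_powr) auto

lemma norm_mellin_kernel:
  assumes "y > 0" "\<kappa> < \<delta>"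
  shows "cmod (mellin_kernel y \<kappa> \<delta> s)
      = y powr Re s * (\<delta> - \<kappa>) / (cmod (s - of_real \<kappa>) * cmod (of_real \<delta> - s))"
  using assms unfolding mellin_kernel_def
  by (simp add: norm_mult norm_divide norm_of_real_powr del: of_real_diff)

lemma mellin_kernel_screen_integrable:
  assumes "y > 0" "\<kappa> < c" "c < \<delta>"
  shows "screen_integrable (\<lambda>_. c) (mellin_kernel y \<kappa> \<delta>)"
proof -
  have c: "0-lipschitz_on UNIV (\<lambda>_::real. c)" by (auto simp: lipschitz_on_def)
  obtain m1 where m1: "m1 > 0" "\<And>t. m1 * sqrt (1 + t\<^sup>2) \<le> cmod (Complex c t - of_real \<kappa>)"
    using graph_distance_lower_bound[OF c, of \<kappa>] assms by auto
  obtain m2 where m2: "m2 > 0" "\<And>t. m2 * sqrt (1 + t\<^sup>2) \<le> cmod (Complex c t - of_real \<delta>)"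
    using graph_distance_lower_bound[OF c, of \<delta>] assms by auto
  show ?thesis
  proof (rule screen_integrable_bound[OF c])
    have "mellin_kernel y \<kappa> \<delta> analytic_on {Complex c t}" for t
      using assms by (intro mellin_kernel_analytic) (auto simp: complex_eq_iff)
    then show "continuous_on UNIV (\<lambda>t. mellin_kernel y \<kappa> \<delta> (Complex c t))"
      by (rule continuous_on_graph_analytic[OF c])
    fix t :: real
    have "(m1 * sqrt (1 + t\<^sup>2)) * (m2 * sqrt (1 + t\<^sup>2))
        \<le> cmod (Complex c t - of_real \<kappa>) * cmod (of_real \<delta> - Complex c t)"
      using m1 m2 by (intro mult_mono) (auto simp: norm_minus_commute)
    moreover have "(m1 * sqrt (1 + t\<^sup>2)) * (m2 * sqrt (1 + t\<^sup>2)) = m1 * m2 * (1 + t\<^sup>2)" 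
    proof -
      have "sqrt (1 + t\<^sup>2) * sqrt (1 + t\<^sup>2) = 1 + t\<^sup>2" by (simp add: add_nonneg_nonneg)
      then show ?thesis by (metis mult.assoc mult.commute)
    qed
    ultimately have le: "m1 * m2 * (1 + t\<^sup>2)
        \<le> cmod (Complex c t - of_real \<kappa>) * cmod (of_real \<delta> - Complex c t)" by simp
    have pos: "m1 * m2 * (1 + t\<^sup>2) > 0" using m1 m2 by (simp add: add_pos_nonneg)
    have "cmod (mellin_kernel y \<kappa> \<delta> (Complex c t)) \<le> y powr c * (\<delta> - \<kappa>) / (m1 * m2 * (1 + t\<^sup>2))"
      unfolding norm_mellin_kernel[OF assms(1) less_trans[OF assms(2,3)]]
      using le pos assms by (auto intro!: divide_left_mono mult_pos_pos)
    then show "cmod (mellin_kernel y \<kappa> \<delta> (Complex c t))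
        \<le> (y powr c * (\<delta> - \<kappa>) / (m1 * m2)) / (1 + t\<^sup>2)" by simp
  qed
qed

text \<open>
  For \<open>y \<ge> 1\<close> the line of integration is closed by a large rectangle on the left, which contains
  the pole \<open>\<kappa>\<close> and on whose other sides \<open>\<bar>y\<^sup>s\<bar> \<le> y\<^sup>c\<close>.
\<close>

lemma mellin_kernel_integral_ge_1:
  assumes y: "y \<ge> 1" and \<kappa>: "0 \<le> \<kappa>" "\<kappa> < c" "c < \<delta>"
  shows "screen_integral (\<lambda>_. c) (mellin_kernel y \<kappa> \<delta>) = 2 * of_real pi * \<i> * of_real (y powr \<kappa>)"
proof -
  let ?E = "mellin_kernel y \<kappa> \<delta>"
  have y0: "y > 0" and \<kappa>\<delta>: "\<kappa> < \<delta>" using y \<kappa> by auto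
  define M where "M = y powr c * (\<delta> - \<kappa>)"
  have M0: "M \<ge> 0" using \<kappa> by (simp add: M_def)
  have bnd: "cmod (?E s) \<le> M / R\<^sup>2"
    if "R > 0" "Re s \<le> c" "R \<le> cmod (s - of_real \<kappa>)" "R \<le> cmod (of_real \<delta> - s)" for s R
  proof -
    have "cmod (?E s) \<le> y powr c * (\<delta> - \<kappa>) / (R * R)"
      unfolding norm_mellin_kernel[OF y0 \<kappa>\<delta>] using that y \<kappa>
      by (intro frac_le mult_right_mono mult_mono powr_mono) auto
    then show ?thesis by (simp add: M_def power2_eq_square)
  qed
  \<comment> \<open>The rectangle has real parts from \<open>-R\<close> to \<open>c\<close> and imaginary parts from \<open>-R\<close> to \<open>R\<close>, where \<open>R > c\<close>.\<close>
  define R where "R n = real n + c + 1" for n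
  have R: "R n > 0" "R n > c" for n using \<kappa> by (auto simp: R_def)
  have main: "cmod (truncated_screen_integral (- R n) (R n) (\<lambda>_. c) ?E - 2 * of_real pi * \<i>
      * of_real (y powr \<kappa>)) \<le> 6 * M / R n" for n
  proof -
    define r where "r = R n"
    have r: "r > 0" "r > c" using R[of n] by (auto simp: r_def)
    have S: "0-lipschitz_on UNIV (\<lambda>_::real. -r)" by (auto simp: lipschitz_on_def)
    have Sc: "- r < c" using r \<kappa> by auto
    have rr: "- r \<le> r" using r by auto
    have an: "?E analytic_on {s}" if "s \<in> graph_region (\<lambda>_. -r) c (-r) r - {of_real \<kappa>}" for s
      using that \<kappa> y0 by (intro mellin_kernel_analytic) (auto simp: graph_region_def)
    have ext: "(\<lambda>s. of_real y powr s * of_real (\<delta> - \<kappa>) / (of_real \<delta> - s)) analytic_on {of_real \<kappa>}"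
      using y0 \<kappa> by (intro analytic_intros analytic_on_of_real_powr) auto
    have lim: "(\<lambda>s. of_real y powr s * of_real (\<delta> - \<kappa>) / (of_real \<delta> - s)) \<midarrow>complex_of_real \<kappa>\<rightarrow>
        of_real (y powr \<kappa>)"
    proof -
      have nz: "complex_of_real \<delta> - of_real \<kappa> \<noteq> 0" using \<kappa> by simp
      have "complex_of_real y powr of_real \<kappa> * of_real (\<delta> - \<kappa>) / (of_real \<delta> - of_real \<kappa>)
          = of_real (y powr \<kappa>)"
        using nz y0 by (simp add: powr_of_real)
      then show ?thesis
        using analytic_at_imp_isCont[OF ext] unfolding isCont_def by (simp only:)
    qed
    have res: "(\<lambda>s. (s - of_real \<kappa>) * ?E s) \<midarrow>of_real \<kappa>\<rightarrow> of_real (y powr \<kappa>)"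
      by (rule Lim_transform_within[OF lim zero_less_one]) (simp add: mellin_kernel_def)
    have "?E analytic_on ball (of_real \<kappa>) (\<delta> - \<kappa>) - {of_real \<kappa>}"
    proof (subst analytic_on_analytic_at, intro ballI)
      fix s assume s: "s \<in> ball (complex_of_real \<kappa>) (\<delta> - \<kappa>) - {of_real \<kappa>}"
      then have "s \<noteq> of_real \<delta>" using \<kappa>
        by (auto simp: dist_norm norm_of_real simp flip: of_real_diff)
      then show "?E analytic_on {s}" using s y0 by (intro mellin_kernel_analytic) auto
    qed
    then have iso: "isolated_singularity_at ?E (of_real \<kappa>)"
      unfolding isolated_singularity_at_def using \<kappa> by (intro exI[of _ "\<delta> - \<kappa>"]) auto
    have P: "{of_real \<kappa>} \<subseteq> {s. - r < Re s \<and> Re s < c \<and> - r < Im s \<and> Im s < r}"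
      using \<kappa> r by auto
    note G = graph_boundary_residues[where S="\<lambda>_. - r" and c=c and a="- r" and b=r
      and P="{of_real \<kappa>}" and f="?E" and \<rho>="\<lambda>_. of_real (y powr \<kappa>)" and L=0,
        OF S Sc rr _ P an]
    have GI: "graph_boundary_integrable ?E (\<lambda>_. - r) c (- r) r"
      using G(1) iso res by simp
    have GV: "graph_boundary_integral ?E (\<lambda>_. - r) c (- r) r
        = 2 * of_real pi * \<i> * of_real (y powr \<kappa>)"
      using G(2) iso res by simp
    note GI' = GI[unfolded graph_boundary_integrable_def]
    have bL: "cmod (truncated_screen_integral (-r) r (\<lambda>_. - r) ?E) \<le> M / r\<^sup>2 * (r - (- r))"
    proof (rule truncated_screen_integral_const_bound)
      fix t assume "t \<in> {- r..r}"
      show "cmod (?E (Complex (- r) t)) \<le> M / r\<^sup>2"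
      proof (rule bnd)
        show "r \<le> cmod (Complex (- r) t - of_real \<kappa>)"
          using abs_Re_le_cmod[of "Complex (- r) t - of_real \<kappa>"] r \<kappa> by simp
        show "r \<le> cmod (of_real \<delta> - Complex (- r) t)"
          using abs_Re_le_cmod[of "of_real \<delta> - Complex (- r) t"] r \<kappa> by simp
      qed (use r Sc in auto)
    qed (use GI' rr in auto)
    have bH: "cmod (contour_integral (linepath (Complex (- r) t) (Complex c t)) ?E)
        \<le> M / r\<^sup>2 * (2 * r)" if t: "\<bar>t\<bar> = r" for t
    proof -
      have "cmod (contour_integral (linepath (Complex (- r) t) (Complex c t)) ?E)
          \<le> M / r\<^sup>2 * cmod (Complex c t - Complex (- r) t)"
      proof (rule contour_integral_bound_linepath)
        show "?E contour_integrable_on linepath (Complex (- r) t) (Complex c t)"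
          using GI' t by (cases "t = r") (auto simp: abs_if split: if_splits)
        fix x assume "x \<in> closed_segment (Complex (- r) t) (Complex c t)"
        then have x: "Re x \<le> c" "Im x = t" using closed_segment_horizontal[of "-r" c t] Sc by auto
        show "cmod (?E x) \<le> M / r\<^sup>2"
        proof (rule bnd[OF r(1) x(1)])
          show "r \<le> cmod (x - of_real \<kappa>)" using abs_Im_le_cmod[of "x - of_real \<kappa>"] x t by simp
          show "r \<le> cmod (of_real \<delta> - x)" using abs_Im_le_cmod[of "of_real \<delta> - x"] x t by simp
        qed
      qed (use M0 in auto)
      also have "cmod (Complex c t - Complex (- r) t) = c + r" 
        using r \<kappa> by (simp add: cmod_def)
      also have "M / r\<^sup>2 * (c + r) \<le> M / r\<^sup>2 * (2 * r)" using r M0 by (intro mult_left_mono) auto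
      finally show ?thesis .
    qed
    have "truncated_screen_integral (- r) r (\<lambda>_. c) ?E - 2 * of_real pi * \<i> * of_real (y powr \<kappa>)
       = truncated_screen_integral (- r) r (\<lambda>_. - r) ?E
         - contour_integral (linepath (Complex (- r) (- r)) (Complex c (- r))) ?E
         + contour_integral (linepath (Complex (- r) r) (Complex c r)) ?E"
      unfolding GV[symmetric] graph_boundary_integral_def by (simp add: algebra_simps)
    also have "cmod \<dots> \<le> M / r\<^sup>2 * (2 * r) + M / r\<^sup>2 * (2 * r) + M / r\<^sup>2 * (2 * r)"
      using bL bH[of "- r"] bH[of r] r
      by (intro norm_triangle_le norm_triangle_le_diff add_mono) auto
    also have "\<dots> = 6 * M / r" using r by (simp add: power2_eq_square field_simps)
    finally show ?thesis by (simp add: r_def)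
  qed
  have Rtop: "filterlim R at_top sequentially"
    by (rule filterlim_at_top_mono[OF filterlim_real_sequentially]) (use \<kappa> in \<open>simp add: R_def\<close>)
  have Rbot: "filterlim (\<lambda>n. - R n) at_bot sequentially"
    using Rtop by (simp add: filterlim_uminus_at_bot)
  have L1: "(\<lambda>n. truncated_screen_integral (- R n) (R n) (\<lambda>_. c) ?E) \<longlonglongrightarrow> screen_integral (\<lambda>_. c) ?E"
    by (rule truncated_screen_integral_LIMSEQ[OF mellin_kernel_screen_integrable[OF y0 \<kappa>(2,3)] Rbot
      Rtop])
  have "(\<lambda>n. 6 * M / R n) \<longlonglongrightarrow> 0"
    by (rule tendsto_divide_0[OF tendsto_const filterlim_at_top_imp_at_infinity[OF Rtop]])
  then have "(\<lambda>n. truncated_screen_integral (- R n) (R n) (\<lambda>_. c) ?E - 2 * of_real pi * \<i>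
      * of_real (y powr \<kappa>)) \<longlonglongrightarrow> 0"
    by (rule Lim_null_comparison[rotated]) (intro always_eventually allI main)
  then have "(\<lambda>n. truncated_screen_integral (- R n) (R n) (\<lambda>_. c) ?E)
      \<longlonglongrightarrow> 2 * of_real pi * \<i> * of_real (y powr \<kappa>)"
    by (subst Lim_null)
  then show ?thesis using L1 LIMSEQ_unique by blast
qed

text \<open>
  The reflection \<open>s \<mapsto> \<kappa> + \<delta> - s\<close> exchanges \<open>y\<close> and \<open>1/y\<close>, and so reduces the case \<open>y \<le> 1\<close> to the
  case \<open>y \<ge> 1\<close>.
\<close>

lemma mellin_kernel_reflect:
  assumes "y > 0"
  shows "mellin_kernel y \<kappa> \<delta> s = of_real (y powr (\<kappa> + \<delta>))
      * mellin_kernel (1 / y) \<kappa> \<delta> (of_real (\<kappa> + \<delta>) - s)"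
proof -
  have "of_real (y powr (\<kappa> + \<delta>)) * of_real (1 / y) powr (of_real (\<kappa> + \<delta>) - s) = of_real y powr s"
  proof -
    have "complex_of_real (y powr (\<kappa> + \<delta>)) = exp (of_real (\<kappa> + \<delta>) * of_real (ln y))"
      using assms by (simp add: powr_def exp_of_real flip: of_real_mult of_real_add)
    moreover have "of_real (1 / y) powr (of_real (\<kappa> + \<delta>) - s)
        = exp ((of_real (\<kappa> + \<delta>) - s) * (- of_real (ln y)))"
      using assms by (simp add: powr_def Ln_of_real[of "1 / y", simplified] ln_div)
    moreover have "of_real y powr s = exp (s * of_real (ln y))"
      using assms by (simp add: powr_def Ln_of_real)
    ultimately show ?thesis by (simp add: algebra_simps flip: exp_add)
  qed
  moreover have "((of_real (\<kappa> + \<delta>) - s) - of_real \<kappa>) * (of_real \<delta> - (of_real (\<kappa> + \<delta>) - s))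
      = (s - of_real \<kappa>) * (of_real \<delta> - s)"
    by (simp add: algebra_simps)
  ultimately show ?thesis unfolding mellin_kernel_def
    by (metis (no_types, lifting) mult.assoc times_divide_eq_right)
qed

lemma mellin_kernel_integral:
  assumes y: "y > 0" and \<kappa>: "0 \<le> \<kappa>" "\<kappa> < c" "c < \<delta>"
  shows "screen_integral (\<lambda>_. c) (mellin_kernel y \<kappa> \<delta>)
       = 2 * of_real pi * \<i> * of_real (if y > 1 then y powr \<kappa> else y powr \<delta>)"
proof (cases "y > 1")
  case True
  then show ?thesis using mellin_kernel_integral_ge_1[of y \<kappa> c \<delta>] \<kappa> by simp
next
  case False
  define c' where "c' = \<kappa> + \<delta> - c"
  have c': "\<kappa> < c'" "c' < \<delta>" using \<kappa> by (auto simp: c'_def)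
  have y1: "1 / y \<ge> 1" using y False by simp
  let ?g = "screen_integrand (\<lambda>_. c') (mellin_kernel (1 / y) \<kappa> \<delta>)"
  have cont: "continuous_on UNIV ?g"
  proof -
    have c0: "0-lipschitz_on UNIV (\<lambda>_::real. c')" by (auto simp: lipschitz_on_def)
    have "mellin_kernel (1/y) \<kappa> \<delta> analytic_on {Complex c' t}" for t
      using c' y by (intro mellin_kernel_analytic) (auto simp: complex_eq_iff)
    then have "continuous_on UNIV (\<lambda>t. mellin_kernel (1/y) \<kappa> \<delta> (Complex c' t))"
      by (rule continuous_on_graph_analytic[OF c0])
    then show ?thesis unfolding screen_integrand_def
      by (intro continuous_intros) auto
  qed
  have gb: "?g \<in> borel_measurable borel" using cont by (rule borel_measurable_continuous_onI)
  have gb': "(\<lambda>t. ?g (- t)) \<in> borel_measurable borel" using gb by measurable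
  have g_eq: "screen_integrand (\<lambda>_. c) (mellin_kernel y \<kappa> \<delta>) t
      = of_real (y powr (\<kappa> + \<delta>)) * ?g (- t)" for t
  proof -
    have "of_real (\<kappa> + \<delta>) - Complex c t = Complex c' (- t)" by (simp add: complex_eq_iff c'_def)
    then show ?thesis unfolding screen_integrand_def mellin_kernel_reflect[OF y, of \<kappa> \<delta>
      "Complex c t"] by simp
  qed
  have "screen_integral (\<lambda>_. c) (mellin_kernel y \<kappa> \<delta>)
      = of_real (y powr (\<kappa> + \<delta>)) * (LINT t|lebesgue. ?g (- t))"
    unfolding screen_integral_def g_eq by simp
  also have "(LINT t|lebesgue. ?g (- t)) = (LINT t|lborel. ?g (- t))"
    using gb' by (intro integral_completion) simp
  also have "\<dots> = (LINT t|lborel. ?g t)"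
    using lborel_integral_real_affine[of "-1" ?g 0] by simp
  also have "\<dots> = (LINT t|lebesgue. ?g t)"
    using gb by (intro integral_completion[symmetric]) simp
  also have "\<dots> = 2 * of_real pi * \<i> * of_real ((1 / y) powr \<kappa>)"
    using mellin_kernel_integral_ge_1[OF y1 \<kappa>(1) c'] unfolding screen_integral_def by simp
  also have "of_real (y powr (\<kappa> + \<delta>)) * (2 * of_real pi * \<i> * of_real ((1 / y) powr \<kappa>))
      = 2 * of_real pi * \<i> * complex_of_real (y powr (\<kappa> + \<delta>) * (1 / y) powr \<kappa>)"
    by simp
  also have "y powr (\<kappa> + \<delta>) * (1 / y) powr \<kappa> = y powr \<delta>"
    using y by (simp add: powr_add powr_divide)
  finally show ?thesis using False by simp
qed

section \<open>The fractal string and its zeta function\<close>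

text \<open>
  Two nicely meromorphic functions that agree on a punctured neighbourhood of one point agree
  everywhere, including at their poles, where both have the value 0.
\<close>

lemma meromorphic_extension_eqI:
  assumes h: "h nicely_meromorphic_on UNIV" and eq: "\<And>s. s \<in> A \<Longrightarrow> h s = f s"
    and A: "eventually (\<lambda>s. s \<in> A) (at z0)"
  shows "meromorphic_extension A f = h"
  unfolding meromorphic_extension_def
proof (rule the_equality)
  show "h nicely_meromorphic_on UNIV \<and> (\<forall>s\<in>A. h s = f s)" using h eq by blast
  fix h' assume h': "h' nicely_meromorphic_on UNIV \<and> (\<forall>s\<in>A. h' s = f s)"
  have m: "h meromorphic_on UNIV" "h' meromorphic_on UNIV"
    using h h' unfolding nicely_meromorphic_on_def by auto
  have "(\<lambda>s. h' s - h s) meromorphic_on UNIV" using m by (intro meromorphic_intros)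
  then have "(\<forall>\<^sub>\<approx>s\<in>UNIV. h' s - h s = 0) \<or> (\<forall>\<^sub>\<approx>s\<in>UNIV. h' s - h s \<noteq> 0)"
    by (intro meromorphic_imp_constant_or_avoid) auto
  moreover have "\<not> (\<forall>\<^sub>\<approx>s\<in>UNIV. h' s - h s \<noteq> 0)"
  proof
    assume "\<forall>\<^sub>\<approx>s\<in>UNIV. h' s - h s \<noteq> 0"
    then have "eventually (\<lambda>s. h' s - h s \<noteq> 0) (at z0)"
      by (rule eventually_cosparse_imp_eventually_at) auto
    then have "eventually (\<lambda>s. False) (at z0)" using A
      by eventually_elim (use h' eq in auto)
    then show False by simp
  qed
  ultimately have "\<forall>\<^sub>\<approx>s\<in>UNIV. h' s - h s = 0" by blast
  then have ev: "eventually (\<lambda>s. h' s = h s) (at z)" for z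
    using eventually_cosparse_imp_eventually_at[of _ UNIV z] by (auto elim: eventually_mono)
  show "h' = h"
  proof
    fix z
    have p: "is_pole h' z \<longleftrightarrow> is_pole h z" by (rule is_pole_cong[OF ev refl])
    have 1: "(is_pole h z \<and> h z = 0) \<or> h \<midarrow>z\<rightarrow> h z" "(is_pole h' z \<and> h' z = 0) \<or> h' \<midarrow>z\<rightarrow> h' z"
      using h h' unfolding nicely_meromorphic_on_def by auto
    show "h' z = h z"
    proof (cases "is_pole h z")
      case True
      have "\<not> h \<midarrow>z\<rightarrow> h z" "\<not> h' \<midarrow>z\<rightarrow> h' z"
        using True p is_pole_def not_tendsto_and_filterlim_at_infinity[of "at z"]
          by (auto simp: is_pole_def)
      then show ?thesis using 1 by auto
    next
      case False
      then have l: "h \<midarrow>z\<rightarrow> h z" "h' \<midarrow>z\<rightarrow> h' z" using 1 p by auto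
      have "h \<midarrow>z\<rightarrow> h' z" using l(2) tendsto_cong[OF ev[of z]] by simp
      then show ?thesis using l(1) LIM_unique by blast
    qed
  qed
qed

lemma sum_prod_list_length:
  fixes x :: "'i \<Rightarrow> 'b::comm_semiring_1"
  assumes "finite A"
  shows "(\<Sum>w | w \<in> lists A \<and> length w = n. prod_list (map x w)) = (\<Sum>a\<in>A. x a) ^ n"
proof (induction n)
  case 0
  have "{w \<in> lists A. length w = 0} = {[]}" by auto
  then show ?case by simp
next
  case (Suc n)
  have eq: "{w \<in> lists A. length w = Suc n} = (\<lambda>(a, w). a # w) ` (A \<times> {w \<in> lists A. length w = n})"
    by (auto simp: length_Suc_conv image_iff)
  have "(\<Sum>w | w \<in> lists A \<and> length w = Suc n. prod_list (map x w))
      = (\<Sum>(a, w)\<in>A \<times> {w \<in> lists A. length w = n}. x a * prod_list (map x w))"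
    unfolding eq by (subst sum.reindex) (auto simp: inj_on_def case_prod_unfold)
  also have "\<dots> = (\<Sum>a\<in>A. x a) * (\<Sum>w | w \<in> lists A \<and> length w = n. prod_list (map x w))"
    by (simp add: sum_product sum.cartesian_product)
  finally show ?case by (simp add: Suc.IH)
qed

lemma finite_lists_fixed_length:
  "finite A \<Longrightarrow> finite {w \<in> lists A. length w = n}"
  using finite_lists_length_eq[of A n] by (simp add: lists_eq_set)

lemma finite_lists_length_less:
  assumes "finite A"
  shows "finite {w \<in> lists A. length w < n}"
proof -
  have "{w \<in> lists A. length w < n} = (\<Union>m<n. {w \<in> lists A. length w = m})" by auto
  then show ?thesis using finite_lists_fixed_length[OF assms] by auto
qed

lemma sum_prod_list_length_less:
  fixes x :: "'i \<Rightarrow> 'b::comm_semiring_1"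
  assumes A: "finite A"
  shows "(\<Sum>w | w \<in> lists A \<and> length w < n. prod_list (map x w)) = (\<Sum>m<n. (\<Sum>a\<in>A. x a) ^ m)"
proof -
  have "{w. w \<in> lists A \<and> length w < n} = (\<Union>m<n. {w. w \<in> lists A \<and> length w = m})" by auto
  then have "(\<Sum>w | w \<in> lists A \<and> length w < n. prod_list (map x w)) =
      (\<Sum>m<n. \<Sum>w | w \<in> lists A \<and> length w = m. prod_list (map x w))"
    using finite_lists_fixed_length[OF A] by (simp only:) (subst sum.UNION_disjoint; auto)
  then show ?thesis by (simp add: sum_prod_list_length[OF A])
qed

lemma has_sum_prod_list:
  fixes x :: "'i \<Rightarrow> complex"
  assumes A: "finite A" and q: "(\<Sum>a\<in>A. cmod (x a)) < 1"
  shows "(\<lambda>w. cmod (prod_list (map x w))) summable_on lists A"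
    and "((\<lambda>w. prod_list (map x w)) has_sum (1 / (1 - (\<Sum>a\<in>A. x a)))) (lists A)"
proof -
  let ?g = "\<lambda>w. prod_list (map x w)" and ?q = "\<Sum>a\<in>A. cmod (x a)"
  have q0: "?q \<ge> 0" by (simp add: sum_nonneg)
  have norm: "cmod (?g w) = prod_list (map (\<lambda>a. cmod (x a)) w)" for w
    by (induction w) (auto simp: norm_mult)
  show abs: "(\<lambda>w. cmod (?g w)) summable_on lists A"
  proof (rule nonneg_bdd_above_summable_on)
    have "(\<Sum>w\<in>F. cmod (?g w)) \<le> 1 / (1 - ?q)" if F: "F \<subseteq> lists A" "finite F" for F
    proof -
      define n where "n = Suc (Max (insert 0 (length ` F)))"
      have sub: "F \<subseteq> {w \<in> lists A. length w < n}" using F by (auto simp: n_def less_Suc_eq_le)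
      have "(\<Sum>w\<in>F. cmod (?g w)) \<le> (\<Sum>w | w \<in> lists A \<and> length w < n. cmod (?g w))"
        using sub finite_lists_length_less[OF A] by (intro sum_mono2) auto
      also have "\<dots> = (\<Sum>m<n. ?q ^ m)" unfolding norm by (rule sum_prod_list_length_less[OF A])
      also have "\<dots> \<le> (\<Sum>m. ?q ^ m)" using q q0
        by (intro sum_le_suminf) (auto simp: summable_geometric_iff)
      also have "\<dots> = 1 / (1 - ?q)" using q q0 by (intro suminf_geometric) simp
      finally show ?thesis .
    qed
    then show "bdd_above (sum (\<lambda>w. cmod (?g w)) ` {F. F \<subseteq> lists A \<and> finite F})"
      by (intro bdd_aboveI[of _ "1 / (1 - ?q)"]) auto
  qed auto
  have "?g summable_on lists A" using abs by (rule abs_summable_summable)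
  then have hs: "(?g has_sum (infsum ?g (lists A))) (lists A)" by (rule has_sum_infsum)
  define B where "B n = {w \<in> lists A. length w < n}" for n
  have "filterlim B (finite_subsets_at_top (lists A)) sequentially"
    unfolding filterlim_finite_subsets_at_top
  proof (intro allI impI)
    fix X assume X: "finite X \<and> X \<subseteq> lists A"
    have "X \<subseteq> B n" if "n \<ge> Suc (Max (insert 0 (length ` X)))" for n
    proof
      fix w assume "w \<in> X"
      then have "length w \<le> Max (insert 0 (length ` X))" using X by (intro Max_ge) auto
      then have "length w < n" using that by linarith
      then show "w \<in> B n" using \<open>w \<in> X\<close> X by (auto simp: B_def)
    qed
    then show "\<forall>\<^sub>F n in sequentially. finite (B n) \<and> X \<subseteq> B n \<and> B n \<subseteq> lists A"
      using finite_lists_length_less[OF A]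
      by (intro eventually_sequentiallyI[of "Suc (Max (insert 0 (length ` X)))"]) (auto simp: B_def)
  qed
  then have "(\<lambda>n. sum ?g (B n)) \<longlonglongrightarrow> infsum ?g (lists A)"
    using hs unfolding has_sum_def by (rule filterlim_compose[rotated])
  moreover have "sum ?g (B n) = (\<Sum>m<n. (\<Sum>a\<in>A. x a) ^ m)" for n
    unfolding B_def by (rule sum_prod_list_length_less[OF A])
  moreover have "cmod (\<Sum>a\<in>A. x a) < 1" using norm_sum[of x A] q by linarith
  then have "(\<lambda>n. \<Sum>m<n. (\<Sum>a\<in>A. x a) ^ m) \<longlonglongrightarrow> 1 / (1 - (\<Sum>a\<in>A. x a))"
    using geometric_sums[of "\<Sum>a\<in>A. x a"] unfolding sums_def by simp
  ultimately have "infsum ?g (lists A) = 1 / (1 - (\<Sum>a\<in>A. x a))"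
    using LIMSEQ_unique by simp
  then show "(?g has_sum (1 / (1 - (\<Sum>a\<in>A. x a)))) (lists A)" using hs by simp
qed

text \<open>
  The strictly decreasing function whose value 1 defines the similarity dimension.
\<close>

definition moran_sum :: "nat \<Rightarrow> (nat \<Rightarrow> real) \<Rightarrow> real \<Rightarrow> real" where
  "moran_sum N r t = (\<Sum>n=1..N. r n powr t)"

lemma moran_sum_strict_antimono:
  assumes "2 \<le> N" "\<And>n. n \<in> {1..N} \<Longrightarrow> 0 < r n \<and> r n < 1" "s < t"
  shows "moran_sum N r t < moran_sum N r s"
  unfolding moran_sum_def using assms
  by (intro sum_strict_mono) (auto intro!: powr_less_mono')

lemma similarity_dimension_properties:
  assumes N: "2 \<le> N" and r: "\<And>n. n \<in> {1..N} \<Longrightarrow> 0 < r n \<and> r n < 1"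
  shows "moran_sum N r (similarity_dimension N r) = 1"
    and "similarity_dimension N r < t \<longleftrightarrow> moran_sum N r t < 1"
proof -
  note mono = moran_sum_strict_antimono[of N r, OF N r]
  have cont: "continuous_on A (moran_sum N r)" for A
    unfolding moran_sum_def[abs_def] by (intro continuous_intros) (use r in force)
  have m0: "moran_sum N r 0 \<ge> 1"
  proof -
    have "moran_sum N r 0 = (\<Sum>n=1..N. 1)"
      unfolding moran_sum_def by (intro sum.cong refl) (use r in force)
    then show ?thesis using N by simp
  qed
  have "((\<lambda>t. moran_sum N r t) \<longlongrightarrow> (\<Sum>n=1..N. 0)) at_top"
    unfolding moran_sum_def
  proof (intro tendsto_sum)
    fix n assume n: "n \<in> {1..N}"
    have "filterlim (\<lambda>t. t * ln (r n)) at_bot at_top"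
      using filterlim_tendsto_neg_mult_at_bot[OF tendsto_const[of
        "ln (r n)"] _ filterlim_ident] r[OF n]
      by (simp add: mult.commute)
    then show "((\<lambda>t. r n powr t) \<longlongrightarrow> 0) at_top"
      using r[OF n] by (auto simp: powr_def intro: filterlim_compose[OF exp_at_bot])
  qed
  then have "eventually (\<lambda>t. moran_sum N r t < 1) at_top" by (intro order_tendstoD) auto
  then obtain b where b: "moran_sum N r b < 1" "b \<ge> 0"
    by (metis eventually_at_top_linorder linorder_le_cases order_refl)
  obtain t0 where t0: "moran_sum N r t0 = 1"
    using IVT2'[of "moran_sum N r" b 1 0] b m0 cont by auto
  have D: "similarity_dimension N r = t0"
    unfolding similarity_dimension_def moran_sum_def[symmetric]
  proof (rule the_equality)
    show "moran_sum N r t0 = 1" by (rule t0)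
    show "t = t0" if "moran_sum N r t = 1" for t
      using mono[of t t0] mono[of t0 t] that t0 by (cases t t0 rule: linorder_cases) auto
  qed
  show "moran_sum N r (similarity_dimension N r) = 1" using t0 D by simp
  show "similarity_dimension N r < t \<longleftrightarrow> moran_sum N r t < 1"
    using mono[of t t0] mono[of t0 t] t0 D by (cases t t0 rule: linorder_cases) auto
qed

lemma word_ratio_pos:
  assumes "\<And>n. n \<in> {1..N} \<Longrightarrow> 0 < r n" "w \<in> lists {1..N}"
  shows "0 < word_ratio r w"
  using assms(2) by (induction w) (use assms(1) in \<open>auto simp: word_ratio_def\<close>)

lemma word_ratio_powr:
  assumes "\<And>n. n \<in> {1..N} \<Longrightarrow> 0 < r n" "w \<in> lists {1..N}"
  shows "complex_of_real (word_ratio r w) powr s = prod_list (map (\<lambda>n. of_real (r n) powr s) w)"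
  using assms(2)
proof (induction w)
  case (Cons n w)
  have "word_ratio r (n # w) = r n * word_ratio r w" by (simp add: word_ratio_def)
  moreover have "0 < r n" "0 < word_ratio r w" using Cons assms(1) word_ratio_pos[of N r w] by auto
  ultimately have "complex_of_real (word_ratio r (n # w)) powr s
      = of_real (r n) powr s * of_real (word_ratio r w) powr s"
    by (simp add: powr_times_real)
  then show ?case using Cons by simp
qed (simp add: word_ratio_def)

lemma word_series_sums:
  assumes N: "2 \<le> N" and r: "\<And>n. n \<in> {1..N} \<Longrightarrow> 0 < r n \<and> r n < 1"
    and wd: "word_ordering N r wd" and l: "l = (\<lambda>j. word_ratio r (wd j))"
    and s: "similarity_dimension N r < Re s"
  shows "(\<lambda>j. complex_of_real (l (Suc j)) powr s) sums (1 / (1 - (\<Sum>n=1..N. of_real (r n) powr s)))"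
    and "summable (\<lambda>j. cmod (complex_of_real (l (Suc j)) powr s))"
proof -
  let ?x = "\<lambda>n. complex_of_real (r n) powr s"
  have "(\<Sum>n=1..N. cmod (?x n)) = moran_sum N r (Re s)"
    unfolding moran_sum_def by (intro sum.cong refl) (use r in \<open>force simp: norm_powr_real_powr\<close>)
  then have q: "(\<Sum>n\<in>{1..N}. cmod (?x n)) < 1"
    using s similarity_dimension_properties(2)[OF N r] by simp
  note H = has_sum_prod_list[OF finite_atLeastAtMost q]
  have bij: "bij_betw (\<lambda>j. wd (Suc j)) UNIV (lists {1..N})"
  proof -
    have "bij_betw Suc UNIV {1..}" by (rule bij_betwI[of _ _ _ "\<lambda>n. n - 1"]) auto
    then show ?thesis using bij_betw_trans[of Suc UNIV "{1..}" wd "lists {1..N}"] wd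
      by (simp add: word_ordering_def o_def)
  qed
  have e: "prod_list (map ?x (wd (Suc j))) = complex_of_real (l (Suc j)) powr s" for j
  proof -
    have "wd (Suc j) \<in> lists {1..N}" using bij by (auto simp: bij_betw_def)
    then show ?thesis unfolding l by (intro word_ratio_powr[symmetric, of N]) (use r in blast)+
  qed
  have "((\<lambda>j. prod_list (map ?x (wd (Suc j)))) has_sum (1 / (1 - (\<Sum>n\<in>{1..N}. ?x n)))) UNIV"
    using H(2) has_sum_reindex_bij_betw[OF bij, of "\<lambda>w. prod_list (map ?x w)"] by simp
  then show "(\<lambda>j. complex_of_real (l (Suc j)) powr s)
      sums (1 / (1 - (\<Sum>n=1..N. of_real (r n) powr s)))"
    unfolding e by (rule has_sum_imp_sums)
  have "(\<lambda>j. cmod (prod_list (map ?x (wd (Suc j))))) summable_on UNIV"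
    using H(1) summable_on_reindex_bij_betw[OF bij, of "\<lambda>w. cmod (prod_list (map ?x w))"] by simp
  then show "summable (\<lambda>j. cmod (complex_of_real (l (Suc j)) powr s))"
    unfolding e by (rule summable_on_imp_summable)
qed

text \<open>
  For \<open>Re s > D\<close> the series over all words is the geometric series of \<open>\<Sum>\<^sub>n r\<^sub>n\<^sup>s\<close>, so the zeta function
  is \<open>1/(1 - \<Sum>\<^sub>n r\<^sub>n\<^sup>s)\<close> with its removable singularities removed.
\<close>

lemma string_zeta_properties:
  assumes N: "2 \<le> N" and r: "\<And>n. n \<in> {1..N} \<Longrightarrow> 0 < r n \<and> r n < 1"
    and wd: "word_ordering N r wd" and l: "l = (\<lambda>j. word_ratio r (wd j))"
  defines "D \<equiv> similarity_dimension N r"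
  shows "string_zeta N r l nicely_meromorphic_on UNIV"
    and "\<And>s. D < Re s \<Longrightarrow> string_zeta N r l analytic_on {s}"
    and "\<And>s. D < Re s \<Longrightarrow> (\<lambda>j. complex_of_real (l (Suc j)) powr s) sums string_zeta N r l s"
proof -
  let ?X = "\<lambda>s. \<Sum>n=1..N. complex_of_real (r n) powr s"
  let ?f = "\<lambda>s. 1 / (1 - ?X s)"
  have Xan: "?X analytic_on A" for A
  proof (rule analytic_on_sum)
    fix n assume n: "n \<in> {1..N}"
    have "(\<lambda>s. exp (s * Ln (complex_of_real (r n)))) analytic_on A" by (intro analytic_intros)
    then show "(\<lambda>s. complex_of_real (r n) powr s) analytic_on A" using r[OF n]
      by (simp add: powr_def)
  qed
  have fm: "?f meromorphic_on UNIV"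
    by (intro meromorphic_intros analytic_on_imp_meromorphic_on[OF Xan])
  define h where "h = remove_sings ?f"
  have hn: "h nicely_meromorphic_on UNIV" unfolding h_def using fm
    by (rule remove_sings_nicely_meromorphic)
  have fa: "?f analytic_on {s}" if "D < Re s" for s
  proof -
    have "cmod (?X s) \<le> moran_sum N r (Re s)"
      unfolding moran_sum_def by (intro sum_norm_le) (use r in \<open>force simp: norm_powr_real_powr\<close>)
    also have "\<dots> < 1" using that similarity_dimension_properties(2)[OF N r] by (simp add: D_def)
    finally have "1 - ?X s \<noteq> 0" by auto
    then show ?thesis by (intro analytic_intros Xan) auto
  qed
  have ha: "h analytic_on {s}" "h s = ?f s" if "D < Re s" for s
    unfolding h_def using fa[OF that] by (auto intro: remove_sings_analytic_on)
  have sm: "(\<lambda>j. complex_of_real (l (Suc j)) powr s) sums h s" if "D < Re s" for s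
    using word_series_sums(1)[OF N r wd l, of s] that ha(2) by (simp add: D_def)
  have "eventually (\<lambda>s. s \<in> {s. D < Re s}) (at (of_real (D + 1)))"
    by (rule eventually_at_in_open') (auto intro: open_halfspace_Re_gt)
  then have "string_zeta N r l = h"
    unfolding string_zeta_def D_def[symmetric]
    by (intro meromorphic_extension_eqI hn) (use sm in \<open>auto simp: sums_iff\<close>)
  then show "string_zeta N r l nicely_meromorphic_on UNIV"
    "\<And>s. D < Re s \<Longrightarrow> string_zeta N r l analytic_on {s}"
    "\<And>s. D < Re s \<Longrightarrow> (\<lambda>j. complex_of_real (l (Suc j)) powr s) sums string_zeta N r l s"
    using hn ha sm by auto
qed

section \<open>Inner parallel volumes of tilings\<close>

lemma le_infdist_iff:
  assumes "B \<noteq> {}"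
  shows "a \<le> infdist x B \<longleftrightarrow> (\<forall>b\<in>B. a \<le> dist x b)"
proof
  assume "a \<le> infdist x B" then show "\<forall>b\<in>B. a \<le> dist x b" using infdist_le order_trans by blast
next
  assume "\<forall>b\<in>B. a \<le> dist x b"
  then show "a \<le> infdist x B" unfolding infdist_notempty[OF assms]
    by (intro cINF_greatest assms) auto
qed

lemma similarity_image_ball:
  fixes f :: "'a::euclidean_space \<Rightarrow> 'a"
  assumes \<rho>: "\<rho> > 0" and f: "\<And>x y. dist (f x) (f y) = \<rho> * dist x y"
  shows "bij f" "f ` ball x e = ball (f x) (\<rho> * e)"
proof -
  define g where "g x = (1 / \<rho>) *\<^sub>R (f x - f 0)" for x
  have d: "dist (g x) (g y) = dist x y" for x y
  proof -
    have "g x - g y = (1 / \<rho>) *\<^sub>R (f x - f y)" by (simp add: g_def algebra_simps)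
    then show ?thesis using f[of x y] \<rho> by (simp add: dist_norm)
  qed
  have "orthogonal_transformation g"
    unfolding orthogonal_transformation_isometry using d by (simp add: g_def)
  then have sg: "surj g" by (rule orthogonal_transformation_surj)
  have "surj f"
  proof (rule surjI)
    fix y show "f (inv g ((1 / \<rho>) *\<^sub>R (y - f 0))) = y"
    proof -
      have "g (inv g ((1 / \<rho>) *\<^sub>R (y - f 0))) = (1 / \<rho>) *\<^sub>R (y - f 0)" using sg
        by (rule surj_f_inv_f)
      then show ?thesis using \<rho> by (simp add: g_def)
    qed
  qed
  moreover have "inj f" using f \<rho> by (intro injI) (metis dist_eq_0_iff mult_eq_0_iff less_irrefl)
  ultimately show b: "bij f" by (simp add: bij_def)
  show "f ` ball x e = ball (f x) (\<rho> * e)"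
  proof (intro equalityI subsetI)
    fix y assume "y \<in> f ` ball x e" then show "y \<in> ball (f x) (\<rho> * e)" using f \<rho> by auto
  next
    fix y assume y: "y \<in> ball (f x) (\<rho> * e)"
    obtain z where z: "y = f z" using b by (meson bij_pointE)
    then show "y \<in> f ` ball x e" using y f \<rho> by auto
  qed
qed

lemma similarity_open_image:
  fixes f :: "'a::euclidean_space \<Rightarrow> 'a"
  assumes \<rho>: "\<rho> > 0" and f: "\<And>x y. dist (f x) (f y) = \<rho> * dist x y" and A: "open A"
  shows "open (f ` A)"
  unfolding open_contains_ball
proof
  fix y assume "y \<in> f ` A"
  then obtain x where x: "x \<in> A" "y = f x" by auto
  then obtain e where e: "e > 0" "ball x e \<subseteq> A" using A open_contains_ball by blast
  then have "ball y (\<rho> * e) \<subseteq> f ` A"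
    using image_mono[OF e(2), of f] similarity_image_ball(2)[OF \<rho> f, of x e] x(2) by simp
  then show "\<exists>e>0. ball y e \<subseteq> f ` A" using e \<rho> by (intro exI[of _ "\<rho> * e"]) auto
qed

text \<open>
  By Vitali's covering theorem an open set is a disjoint union of balls up to a null set; a
  similarity maps balls to balls and null sets to null sets.
\<close>

lemma similarity_emeasure_image:
  fixes f :: "'a::euclidean_space \<Rightarrow> 'a"
  assumes \<rho>: "\<rho> > 0" and f: "\<And>x y. dist (f x) (f y) = \<rho> * dist x y" and A: "open A"
  shows "emeasure lebesgue (f ` A) = ennreal (\<rho> ^ DIM('a)) * emeasure lebesgue A"
proof -
  let ?K = "{i. 0 < snd i \<and> ball (fst i) (snd i) \<subseteq> A}"
  obtain C where C: "countable C" "C \<subseteq> ?K"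
     "pairwise (\<lambda>i j. disjnt (ball (fst i) (snd i)) (ball (fst j) (snd j))) C"
     "negligible (A - (\<Union>i\<in>C. ball (fst i) (snd i)))"
  proof (rule Vitali_covering_theorem_balls[of A ?K fst snd])
    fix x d assume x: "x \<in> A" "0 < (d::real)"
    then obtain e where e: "e > 0" "ball x e \<subseteq> A" using A open_contains_ball by blast
    then show "\<exists>i. i \<in> ?K \<and> x \<in> ball (fst i) (snd i) \<and> snd i < d"
      using x by (intro exI[of _ "(x, min e (d/2))"]) auto
  qed
  define B where "B i = ball (fst i) (snd i)" for i :: "'a \<times> real"
  define I where "I = (\<Union>i\<in>C. B i)"
  have IA: "I \<subseteq> A" using C(2) by (auto simp: I_def B_def)
  have nA: "negligible (A - I)" using C(4) unfolding I_def B_def .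
  have disj: "disjoint_family_on B C"
    using C(3) by (auto simp: disjoint_family_on_def pairwise_def disjnt_def B_def)
  have bij: "bij f" using similarity_image_ball(1)[OF \<rho> f] .
  have disjf: "disjoint_family_on (\<lambda>i. f ` B i) C"
    using disj bij_is_inj[OF bij] unfolding disjoint_family_on_def by (metis image_Int image_empty)
  have fB: "f ` B i = ball (f (fst i)) (\<rho> * snd i)" for i
    unfolding B_def by (rule similarity_image_ball(2)[OF \<rho> f])
  have nf: "negligible (f ` (A - I))"
  proof (rule negligible_locally_Lipschitz_image[OF _ nA])
    fix x assume "x \<in> A - I"
    show "\<exists>T C. open T \<and> x \<in> T \<and> (\<forall>y\<in>(A - I) \<inter> T. norm (f y - f x) \<le> C * norm (y - x))"
      using f by (intro exI[of _ UNIV] exI[of _ \<rho>]) (auto simp: dist_norm)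
  qed simp
  have e: "emeasure lebesgue (f ` B i) = ennreal (\<rho> ^ DIM('a)) * emeasure lebesgue (B i)" if "i \<in> C"
    for i
  proof -
    have "snd i > 0" using that C(2) by auto
    then show ?thesis unfolding fB unfolding B_def using \<rho>
      by (simp add: emeasure_ball ennreal_mult[symmetric] power_mult_distrib algebra_simps)
  qed
  have oI: "open I" by (auto simp: I_def B_def)
  have "emeasure lebesgue A = emeasure lebesgue I"
  proof -
    have "emeasure lebesgue (I \<union> (A - I)) = emeasure lebesgue I"
      using nA oI by (intro emeasure_Un_null_set) (auto simp: negligible_iff_null_sets)
    moreover have "I \<union> (A - I) = A" using IA by auto
    ultimately show ?thesis by simp
  qed
  also have "\<dots> = (\<integral>\<^sup>+i. emeasure lebesgue (B i) \<partial>count_space C)"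
    unfolding I_def using C(1) disj by (intro emeasure_UN_countable) (auto simp: B_def)
  finally have 1: "emeasure lebesgue A = (\<integral>\<^sup>+i. emeasure lebesgue (B i) \<partial>count_space C)" .
  have fI: "f ` I = (\<Union>i\<in>C. f ` B i)" by (auto simp: I_def)
  have "emeasure lebesgue (f ` A) = emeasure lebesgue (f ` I)"
  proof -
    have "emeasure lebesgue (f ` I \<union> f ` (A - I)) = emeasure lebesgue (f ` I)"
      using nf similarity_open_image[OF \<rho> f oI]
        by (intro emeasure_Un_null_set) (auto simp: negligible_iff_null_sets)
    moreover have "f ` I \<union> f ` (A - I) = f ` A" using IA by auto
    ultimately show ?thesis by simp
  qed
  also have "\<dots> = (\<integral>\<^sup>+i. emeasure lebesgue (f ` B i) \<partial>count_space C)"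
    unfolding fI using C(1) disjf by (intro emeasure_UN_countable) (auto simp: fB)
  also have "\<dots> = (\<integral>\<^sup>+i. ennreal (\<rho> ^ DIM('a)) * emeasure lebesgue (B i) \<partial>count_space C)"
    by (intro nn_integral_cong) (use e in auto)
  also have "\<dots> = ennreal (\<rho> ^ DIM('a)) * emeasure lebesgue A" unfolding 1
    by (simp add: nn_integral_cmult)
  finally show ?thesis .
qed

lemma similarity_measure_image:
  fixes f :: "'a::euclidean_space \<Rightarrow> 'a"
  assumes \<rho>: "\<rho> > 0" and f: "\<And>x y. dist (f x) (f y) = \<rho> * dist x y" and A: "open A"
  shows "measure lebesgue (f ` A) = \<rho> ^ DIM('a) * measure lebesgue A"
  using similarity_emeasure_image[OF assms] \<rho> by (simp add: measure_def enn2real_mult)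

lemma infdist_similarity_image:
  fixes f :: "'a::euclidean_space \<Rightarrow> 'a"
  assumes \<rho>: "\<rho> > 0" and f: "\<And>x y. dist (f x) (f y) = \<rho> * dist x y" and B: "B \<noteq> {}"
  shows "infdist (f x) (f ` B) = \<rho> * infdist x B"
proof -
  have "a \<le> infdist (f x) (f ` B) \<longleftrightarrow> a \<le> \<rho> * infdist x B" for a
  proof -
    have "a \<le> infdist (f x) (f ` B) \<longleftrightarrow> (\<forall>b\<in>B. a / \<rho> \<le> dist x b)"
      using B f \<rho> by (simp add: le_infdist_iff divide_le_eq mult.commute)
    also have "\<dots> \<longleftrightarrow> a / \<rho> \<le> infdist x B" using B by (simp add: le_infdist_iff)
    also have "\<dots> \<longleftrightarrow> a \<le> \<rho> * infdist x B" using \<rho> by (simp add: divide_le_eq mult.commute)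
    finally show ?thesis .
  qed
  then show ?thesis by (meson order_antisym order_refl)
qed

lemma open_deep_points: "open {x \<in> A. \<epsilon> < infdist x (- A)}" if "open A"
proof -
  have "{x \<in> A. \<epsilon> < infdist x (- A)} = A \<inter> {x. \<epsilon> < infdist x (- A)}" by auto
  moreover have "open {x. \<epsilon> < infdist x (- A)}" by (intro open_Collect_less continuous_intros)
  ultimately show ?thesis using that by auto
qed

lemma sets_inner_parallel: "open A \<Longrightarrow> {x \<in> A. infdist x (- A) \<le> \<epsilon>} \<in> sets borel"
proof -
  assume A: "open A"
  have "{x \<in> A. infdist x (- A) \<le> \<epsilon>} = A - {x \<in> A. \<epsilon> < infdist x (- A)}" by auto
  then show ?thesis using open_deep_points[OF A] A by auto
qed

lemma inner_volume_eq_diff: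
  fixes A :: "'a::euclidean_space set"
  assumes "open A" "bounded A"
  shows "inner_volume A \<epsilon> = measure lebesgue A - measure lebesgue {x \<in> A. \<epsilon> < infdist x (- A)}"
proof -
  have "{x \<in> A. infdist x (- A) \<le> \<epsilon>} = A - {x \<in> A. \<epsilon> < infdist x (- A)}" by auto
  moreover have "A \<in> lmeasurable" using assms by (intro bounded_set_imp_lmeasurable) auto
  moreover have "{x \<in> A. \<epsilon> < infdist x (- A)} \<in> sets lebesgue"
    using open_deep_points[OF assms(1), of \<epsilon>] by auto
  moreover have "{x \<in> A. \<epsilon> < infdist x (- A)} \<in> lmeasurable"
    using assms open_deep_points[OF assms(1)]
      by (intro bounded_set_imp_lmeasurable) (auto intro: bounded_subset)
  ultimately show ?thesis unfolding inner_volume_def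
    by (simp add: measurable_measure_Diff fmeasurableD)
qed

lemma inner_volume_similarity_image:
  fixes f :: "'a::euclidean_space \<Rightarrow> 'a"
  assumes \<rho>: "\<rho> > 0" and f: "\<And>x y. dist (f x) (f y) = \<rho> * dist x y" and A: "open A" "bounded A"
  shows "inner_volume (f ` A) \<epsilon> = \<rho> ^ DIM('a) * inner_volume A (\<epsilon> / \<rho>)"
proof -
  have ne: "- A \<noteq> {}" using A(2) not_bounded_UNIV by (metis Compl_UNIV_eq double_complement)
  have bij: "bij f" using similarity_image_ball(1)[OF \<rho> f] .
  have o: "open (f ` A)" by (rule similarity_open_image[OF \<rho> f A(1)])
  have b: "bounded (f ` A)"
  proof -
    obtain c e where ce: "A \<subseteq> ball c e" using A(2) bounded_subset_ballD by blast
    have "f ` A \<subseteq> ball (f c) (\<rho> * e)"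
      using image_mono[OF ce, of f] similarity_image_ball(2)[OF \<rho> f, of c e] by simp
    then show ?thesis using bounded_ball bounded_subset by blast
  qed
  have c: "- f ` A = f ` (- A)" using bij by (metis bij_image_Compl_eq)
  have eq: "{x \<in> f ` A. \<epsilon> < infdist x (- f ` A)} = f ` {x \<in> A. \<epsilon> / \<rho> < infdist x (- A)}"
    unfolding c using infdist_similarity_image[OF \<rho> f ne] \<rho>
      by (auto simp: divide_less_eq mult.commute)
  show ?thesis
    unfolding inner_volume_eq_diff[OF o b] inner_volume_eq_diff[OF A] eq
      similarity_measure_image[OF \<rho> f open_deep_points[OF A(1)]]
        similarity_measure_image[OF \<rho> f A(1)]
    by (simp add: algebra_simps)
qed

text \<open>
  A ball inside a disjoint union of open sets is connected, so it lies in one of them. Hence the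
  distance to the complement can be computed within a single set.
\<close>

lemma infdist_compl_disjoint_union:
  fixes A :: "nat \<Rightarrow> 'a::euclidean_space set"
  assumes o: "\<And>i. open (A i)" and disj: "disjoint_family A" and b: "bounded (\<Union>i. A i)"
    and x: "x \<in> A i"
  shows "infdist x (- (\<Union>i. A i)) = infdist x (- A i)"
proof -
  define T where "T = (\<Union>i. A i)"
  have AT: "A i \<subseteq> T" for i by (auto simp: T_def)
  have neT: "- T \<noteq> {}" using b not_bounded_UNIV unfolding T_def[symmetric]
    by (metis Compl_UNIV_eq double_complement)
  then have le1: "infdist x (- A i) \<le> infdist x (- T)" using AT[of i] by (intro infdist_mono) auto
  have nei: "- A i \<noteq> {}" using neT AT[of i] by auto
  have ball: "ball x (infdist x (- T)) \<subseteq> A i"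
  proof (rule ccontr)
    assume "\<not> ?thesis"
    then obtain y where y: "y \<in> ball x (infdist x (- T))" "y \<notin> A i" by (auto simp only: subset_iff)
    let ?B = "ball x (infdist x (- T))"
    have sub: "?B \<subseteq> A i \<union> (\<Union>j\<in>-{i}. A j)"
    proof
      fix z assume z: "z \<in> ?B"
      have "z \<in> T"
      proof (rule ccontr)
        assume "z \<notin> T"
        then have "infdist x (- T) \<le> dist x z" by (intro infdist_le) auto
        then show False using z by simp
      qed
      then show "z \<in> A i \<union> (\<Union>j\<in>-{i}. A j)" by (auto simp: T_def)
    qed
    have "connected ?B" by simp
    moreover have "open (A i)" "open (\<Union>j\<in>-{i}. A j)" using o by auto
    moreover have "A i \<inter> (\<Union>j\<in>-{i}. A j) \<inter> ?B = {}" using disj by (auto simp: disjoint_family_on_def)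
    moreover have "A i \<inter> ?B \<noteq> {}"
    proof -
      have "x \<in> ?B" using y(1) by (auto intro: le_less_trans[OF zero_le_dist])
      then show ?thesis using x by auto
    qed
    moreover have "(\<Union>j\<in>-{i}. A j) \<inter> ?B \<noteq> {}" using y sub by blast
    ultimately show False using sub connectedD[of ?B "A i" "\<Union>j\<in>-{i}. A j"] by blast
  qed
  have le2: "infdist x (- T) \<le> infdist x (- A i)"
    unfolding le_infdist_iff[OF nei] using ball by (meson ComplD mem_ball not_le subsetD)
  show ?thesis using le1 le2 unfolding T_def by simp
qed

lemma inner_volume_disjoint_union:
  fixes A :: "nat \<Rightarrow> 'a::euclidean_space set"
  assumes o: "\<And>i. open (A i)" and disj: "disjoint_family A" and b: "bounded (\<Union>i. A i)"
  shows "(\<lambda>i. inner_volume (A i) \<epsilon>) sums inner_volume (\<Union>i. A i) \<epsilon>"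
proof -
  let ?T = "\<Union>i. A i"
  have eq: "{x \<in> ?T. infdist x (- ?T) \<le> \<epsilon>} = (\<Union>i. {x \<in> A i. infdist x (- A i) \<le> \<epsilon>})"
  proof (intro set_eqI iffI)
    fix x assume "x \<in> {x \<in> ?T. infdist x (- ?T) \<le> \<epsilon>}"
    then obtain i where i: "x \<in> A i" "infdist x (- ?T) \<le> \<epsilon>" by blast
    then have "infdist x (- A i) \<le> \<epsilon>" using infdist_compl_disjoint_union[OF o disj b i(1)] by simp
    then show "x \<in> (\<Union>i. {x \<in> A i. infdist x (- A i) \<le> \<epsilon>})" using i by blast
  next
    fix x assume "x \<in> (\<Union>i. {x \<in> A i. infdist x (- A i) \<le> \<epsilon>})"
    then obtain i where i: "x \<in> A i" "infdist x (- A i) \<le> \<epsilon>" by blast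
    then have "infdist x (- ?T) \<le> \<epsilon>" using infdist_compl_disjoint_union[OF o disj b i(1)] by simp
    then show "x \<in> {x \<in> ?T. infdist x (- ?T) \<le> \<epsilon>}" using i by blast
  qed
  have bd: "bounded {x \<in> ?T. infdist x (- ?T) \<le> \<epsilon>}" using b by (rule bounded_subset) auto
  have ms: "{x \<in> ?T. infdist x (- ?T) \<le> \<epsilon>} \<in> sets borel" using o by (intro sets_inner_parallel) auto
  have fin: "emeasure lebesgue (\<Union>i. {x \<in> A i. infdist x (- A i) \<le> \<epsilon>}) \<noteq> \<infinity>"
    unfolding eq[symmetric] using bounded_set_imp_lmeasurable[OF bd] ms
      by (auto simp: fmeasurable_def)
  show ?thesis
    unfolding inner_volume_def eq
  proof (rule measure_UNION[OF _ _ fin])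
    show "range (\<lambda>i. {x \<in> A i. infdist x (- A i) \<le> \<epsilon>}) \<subseteq> sets lebesgue"
      using sets_inner_parallel[OF o] by auto
    show "disjoint_family (\<lambda>i. {x \<in> A i. infdist x (- A i) \<le> \<epsilon>})"
      using disj by (auto simp: disjoint_family_on_def)
  qed
qed

lemma inradius_bounded_open:
  fixes A :: "'a::euclidean_space set"
  assumes A: "open A" "bounded A" "A \<noteq> {}"
  shows "inradius A > 0" and "\<epsilon> \<ge> inradius A \<Longrightarrow> inner_volume A \<epsilon> = measure lebesgue A"
proof -
  let ?R = "{\<rho>. 0 \<le> \<rho> \<and> (\<exists>x. ball x \<rho> \<subseteq> A)}"
  obtain B where B: "A \<subseteq> ball 0 B" using A(2) bounded_subset_ballD by blast
  have bd: "bdd_above ?R"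
  proof (rule bdd_aboveI)
    fix \<rho> assume "\<rho> \<in> ?R"
    then obtain x where x: "0 \<le> \<rho>" "ball x \<rho> \<subseteq> A" by blast
    then have "ball x \<rho> \<subseteq> cball 0 B" using B ball_subset_cball by blast
    then have "dist x 0 + \<rho> \<le> B \<or> \<rho> \<le> 0" unfolding ball_subset_cball_iff .
    then show "\<rho> \<le> max 0 B" using zero_le_dist[of x 0] by linarith
  qed
  have up: "\<rho> \<le> inradius A" if "0 \<le> \<rho>" "ball x \<rho> \<subseteq> A" for \<rho> x
    unfolding inradius_def using bd that by (intro cSup_upper) auto
  obtain x e where "e > 0" "ball x e \<subseteq> A" using A(1,3) open_contains_ball by (metis ex_in_conv)
  then show "inradius A > 0" using up[of e x] by auto
  assume \<epsilon>: "\<epsilon> \<ge> inradius A"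
  have "infdist x (- A) \<le> \<epsilon>" if "x \<in> A" for x
  proof -
    have "ball x (infdist x (- A)) \<subseteq> A"
    proof
      fix y assume y: "y \<in> ball x (infdist x (- A))"
      show "y \<in> A"
      proof (rule ccontr)
        assume "y \<notin> A"
        then have "infdist x (- A) \<le> dist x y" by (intro infdist_le) auto
        then show False using y by simp
      qed
    qed
    then show ?thesis using up[of "infdist x (- A)" x] \<epsilon> infdist_nonneg[of x "- A"] by auto
  qed
  then have "{x \<in> A. infdist x (- A) \<le> \<epsilon>} = A" by auto
  then show "inner_volume A \<epsilon> = measure lebesgue A" by (simp add: inner_volume_def)
qed

lemma word_map_Nil: "word_map \<Phi> [] = id"
  by (simp add: word_map_def)

lemma word_map_Cons: "word_map \<Phi> (n # w) = \<Phi> n \<circ> word_map \<Phi> w"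
  by (simp add: word_map_def)

lemma word_map_similarity:
  assumes "\<And>n x y. n \<in> {1..N} \<Longrightarrow> dist (\<Phi> n x) (\<Phi> n y) = r n * dist x y" "w \<in> lists {1..N}"
  shows "dist (word_map \<Phi> w x) (word_map \<Phi> w y) = word_ratio r w * dist x y"
  using assms(2) by (induction w)
    (use assms(1) in \<open>auto simp: word_map_Nil word_map_Cons word_ratio_def\<close>)

lemma word_map_subset:
  assumes "feasible_open_set N \<Phi> U" "w \<in> lists {1..N}"
  shows "word_map \<Phi> w ` U \<subseteq> U"
  using assms(2)
proof (induction w)
  case (Cons n w)
  have "word_map \<Phi> (n # w) ` U = \<Phi> n ` (word_map \<Phi> w ` U)" by (simp add: word_map_Cons image_comp)
  also have "\<dots> \<subseteq> \<Phi> n ` U" using Cons by (intro image_mono) auto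
  also have "\<dots> \<subseteq> U" using assms(1) Cons by (auto simp: feasible_open_set_def)
  finally show ?case .
qed (simp add: word_map_Nil)

text \<open>
  If neither word is a prefix of the other, the tiles lie in disjoint images of \<open>U\<close>; otherwise, after
  cancelling the common prefix, one of them is \<open>G\<close> and the other lies in \<open>\<Phi>(U)\<close>.
\<close>

lemma tiles_disjoint:
  assumes U: "feasible_open_set N \<Phi> U" and inj: "\<And>n. n \<in> {1..N} \<Longrightarrow> inj (\<Phi> n)"
    and G: "G \<subseteq> U" "G \<inter> set_map N \<Phi> (closure U) = {}"
    and wv: "w \<in> lists {1..N}" "v \<in> lists {1..N}" "w \<noteq> v"
  shows "word_map \<Phi> w ` G \<inter> word_map \<Phi> v ` G = {}"
  using wv
proof (induction w arbitrary: v)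
  case Nil
  then obtain n v' where v: "v = n # v'" by (cases v) auto
  have "word_map \<Phi> v ` G \<subseteq> \<Phi> n ` closure U"
    using word_map_subset[OF U, of v'] Nil v G closure_subset[of U]
      by (fastforce simp: word_map_Cons)
  also have "\<dots> \<subseteq> set_map N \<Phi> (closure U)" using Nil v by (auto simp: set_map_def)
  finally show ?case using G(2) by (auto simp: word_map_Nil)
next
  case (Cons n w)
  have n: "n \<in> {1..N}" "w \<in> lists {1..N}" using Cons.hyps Cons.prems by auto
  show ?case
  proof (cases v)
    case Nil
    have "word_map \<Phi> (n # w) ` G \<subseteq> \<Phi> n ` closure U"
      using word_map_subset[OF U n(2)] G closure_subset[of U] by (fastforce simp: word_map_Cons)
    also have "\<dots> \<subseteq> set_map N \<Phi> (closure U)" using n by (auto simp: set_map_def)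
    finally show ?thesis using G(2) Nil by (auto simp: word_map_Nil)
  next
    case v: (Cons m v')
    have m: "m \<in> {1..N}" "v' \<in> lists {1..N}" using Cons.prems v by auto
    have im: "word_map \<Phi> (n # w) ` G = \<Phi> n ` (word_map \<Phi> w ` G)"
      "word_map \<Phi> (m # v') ` G = \<Phi> m ` (word_map \<Phi> v' ` G)"
      by (auto simp: word_map_Cons)
    show ?thesis
    proof (cases "n = m")
      case True
      then have "w \<noteq> v'" using Cons.prems v by auto
      then have "word_map \<Phi> w ` G \<inter> word_map \<Phi> v' ` G = {}" using Cons.IH m n by auto
      then show ?thesis unfolding v im using True inj[OF n(1)] by (simp add: image_Int[symmetric])
    next
      case False
      have "word_map \<Phi> w ` G \<subseteq> U" "word_map \<Phi> v' ` G \<subseteq> U"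
        using word_map_subset[OF U n(2)] word_map_subset[OF U m(2)] G(1) by blast+
      then have "\<Phi> n ` (word_map \<Phi> w ` G) \<subseteq> \<Phi> n ` U" "\<Phi> m ` (word_map \<Phi> v' ` G) \<subseteq> \<Phi> m ` U" by auto
      moreover have "\<Phi> n ` U \<inter> \<Phi> m ` U = {}" using U n m False by (auto simp: feasible_open_set_def)
      ultimately show ?thesis unfolding v im by blast
    qed
  qed
qed

lemma single_generator_properties:
  fixes \<Phi> :: "nat \<Rightarrow> 'a::euclidean_space \<Rightarrow> 'a"
  assumes cs: "contractive_similarities N \<Phi> r" and U: "feasible_open_set N \<Phi> U"
    and gen: "generators N \<Phi> U = {G}"
  shows "G = U - set_map N \<Phi> (closure U)" "open G" "bounded G" "G \<noteq> {}"
proof -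
  have "\<Union>(components (U - set_map N \<Phi> (closure U))) = U - set_map N \<Phi> (closure U)"
    by (rule Union_components)
  then show G: "G = U - set_map N \<Phi> (closure U)" using gen unfolding generators_def
    by (metis cSup_singleton)
  have "compact (set_map N \<Phi> (closure U))"
    unfolding set_map_def
  proof (intro compact_UN compact_continuous_image)
    fix n assume n: "n \<in> {1..N}"
    have "(r n)-lipschitz_on (closure U) (\<Phi> n)"
      using cs n by (intro lipschitz_onI) (auto simp: contractive_similarities_def less_imp_le)
    then show "continuous_on (closure U) (\<Phi> n)" by (rule lipschitz_on_continuous_on)
    show "compact (closure U)" using U by (auto simp: feasible_open_set_def)
  qed auto
  then show "open G" using U unfolding G feasible_open_set_def
    by (auto intro: open_Diff compact_imp_closed)
  show "bounded G" using U unfolding G feasible_open_set_def by (auto intro: bounded_subset)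
  show "G \<noteq> {}" using gen in_components_nonempty unfolding generators_def by (metis insertI1)
qed

text \<open>
  The sets \<open>\<Phi>\<^sub>n(U)\<close> and \<open>G\<close> are pairwise disjoint subsets of \<open>U\<close>, and the nonempty open set \<open>G\<close> has
  positive volume. Thus the existence of a generator forces \<open>D < d\<close>.
\<close>

lemma moran_sum_dim_less_1:
  fixes \<Phi> :: "nat \<Rightarrow> 'a::euclidean_space \<Rightarrow> 'a"
  assumes cs: "contractive_similarities N \<Phi> r" and U: "feasible_open_set N \<Phi> U"
    and gen: "generators N \<Phi> U = {G}"
  shows "moran_sum N r (real DIM('a)) < 1"
proof -
  note G = single_generator_properties[OF assms]
  have r: "0 < r n" "\<And>x y. dist (\<Phi> n x) (\<Phi> n y) = r n * dist x y" if "n \<in> {1..N}" for n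
    using cs that by (auto simp: contractive_similarities_def)
  have Uo: "open U" "bounded U" using U by (auto simp: feasible_open_set_def)
  have Ul: "U \<in> lmeasurable" using Uo by (intro bounded_set_imp_lmeasurable) auto
  have o: "open (\<Phi> n ` U)" if "n \<in> {1..N}" for n
    by (rule similarity_open_image[OF r[OF that] Uo(1)])
  have sub: "\<Phi> n ` U \<subseteq> U" if "n \<in> {1..N}" for n using U that by (auto simp: feasible_open_set_def)
  have l: "\<Phi> n ` U \<in> lmeasurable" if "n \<in> {1..N}" for n
    using o[OF that] sub[OF that] Uo
      by (intro bounded_set_imp_lmeasurable) (auto intro: bounded_subset)
  have Gl: "G \<in> lmeasurable" using G by (intro bounded_set_imp_lmeasurable) auto
  have mU: "measure lebesgue (\<Union>n\<in>{1..N}. \<Phi> n ` U) = (\<Sum>n=1..N. r n ^ DIM('a) * measure lebesgue U)"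
  proof -
    have "measure lebesgue (\<Union>n\<in>{1..N}. \<Phi> n ` U) = (\<Sum>n\<in>{1..N}. measure lebesgue (\<Phi> n ` U))"
    proof (rule measure_finite_Union)
      show "disjoint_family_on (\<lambda>n. \<Phi> n ` U) {1..N}" using U
        by (auto simp: feasible_open_set_def disjoint_family_on_def)
      show "emeasure lebesgue (\<Phi> n ` U) \<noteq> \<infinity>" if "n \<in> {1..N}" for n using l[OF that]
        by (auto simp: fmeasurable_def)
    qed (use o in auto)
    also have "\<dots> = (\<Sum>n=1..N. r n ^ DIM('a) * measure lebesgue U)"
      by (intro sum.cong refl similarity_measure_image r Uo)
    finally show ?thesis .
  qed
  have UNl: "(\<Union>n\<in>{1..N}. \<Phi> n ` U) \<in> lmeasurable" using l by (intro fmeasurable.finite_UN) auto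
  have disj: "(\<Union>n\<in>{1..N}. \<Phi> n ` U) \<inter> G = {}"
    unfolding G(1) set_map_def using closure_subset[of U] by blast
  have "measure lebesgue (\<Union>n\<in>{1..N}. \<Phi> n ` U) + measure lebesgue G
      = measure lebesgue ((\<Union>n\<in>{1..N}. \<Phi> n ` U) \<union> G)"
    using measure_Un3[OF UNl Gl] disj by simp
  also have "\<dots> \<le> measure lebesgue U"
  proof (rule measure_mono_fmeasurable)
    show "(\<Union>n\<in>{1..N}. \<Phi> n ` U) \<union> G \<subseteq> U" using sub G(1) by blast
    show "(\<Union>n\<in>{1..N}. \<Phi> n ` U) \<union> G \<in> sets lebesgue" using UNl Gl by (intro sets.Un fmeasurableD)
  qed (rule Ul)
  finally have le: "(\<Sum>n=1..N. r n ^ DIM('a)) * measure lebesgue U + measure lebesgue G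
      \<le> measure lebesgue U"
    unfolding mU by (simp add: sum_distrib_right)
  have pos: "measure lebesgue A > 0" if "open A" "A \<noteq> {}" "A \<in> lmeasurable" for A :: "'a set"
  proof -
    have "\<not> negligible A" using that open_not_negligible by blast
    then have "measure lebesgue A \<noteq> 0" using that(3) negligible_iff_measure0 by blast
    then show ?thesis using measure_nonneg[of lebesgue A] by linarith
  qed
  have "(\<Sum>n=1..N. r n ^ DIM('a)) * measure lebesgue U < 1 * measure lebesgue U"
    using le pos[OF G(2,4) Gl] by linarith
  moreover have "measure lebesgue U > 0" using pos Uo U Ul by (auto simp: feasible_open_set_def)
  ultimately have "(\<Sum>n=1..N. r n ^ DIM('a)) < 1" by simp
  moreover have "moran_sum N r (real DIM('a)) = (\<Sum>n=1..N. r n ^ DIM('a))"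
    unfolding moran_sum_def by (intro sum.cong refl) (use r in \<open>simp add: powr_realpow\<close>)
  ultimately show ?thesis by simp
qed

lemma inner_volume_tiling_sums:
  fixes \<Phi> :: "nat \<Rightarrow> 'a::euclidean_space \<Rightarrow> 'a"
  assumes cs: "contractive_similarities N \<Phi> r" and U: "feasible_open_set N \<Phi> U"
    and gen: "generators N \<Phi> U = {G}" and wd: "word_ordering N r wd"
    and l: "l = (\<lambda>j. word_ratio r (wd j))"
  shows "(\<lambda>j. l (Suc j) ^ DIM('a) * inner_volume G (\<epsilon> / l (Suc j)))
      sums inner_volume (\<Union>(tiling N \<Phi> U)) \<epsilon>"
proof -
  note G = single_generator_properties[OF cs U gen]
  have r: "0 < r n" "\<And>x y. dist (\<Phi> n x) (\<Phi> n y) = r n * dist x y" if "n \<in> {1..N}" for n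
    using cs that by (auto simp: contractive_similarities_def)
  define A where "A j = word_map \<Phi> (wd (Suc j)) ` G" for j
  have bij: "bij_betw wd {1..} (lists {1..N})" using wd by (simp add: word_ordering_def)
  have W: "wd (Suc j) \<in> lists {1..N}" for j using bij by (auto simp: bij_betw_def)
  have sim: "dist (word_map \<Phi> (wd (Suc j)) x) (word_map \<Phi> (wd (Suc j)) y) = l (Suc j) * dist x y"
    for j x y
    unfolding l using word_map_similarity[of N \<Phi> r, OF r(2) W] by blast
  have lpos: "l (Suc j) > 0" for j unfolding l using word_ratio_pos[of N r, OF r(1) W] by blast
  have inj: "inj (\<Phi> n)" if "n \<in> {1..N}" for n
    using similarity_image_ball(1)[OF r[OF that]] by (simp add: bij_is_inj)
  have UA: "(\<Union>j. A j) = \<Union>(tiling N \<Phi> U)"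
  proof -
    have "\<Union>(tiling N \<Phi> U) = (\<Union>w\<in>lists {1..N}. word_map \<Phi> w ` G)"
      unfolding tiling_def gen by auto
    also have "\<dots> = (\<Union>j\<in>{1..}. word_map \<Phi> (wd j) ` G)"
      unfolding bij_betw_imp_surj_on[OF bij, symmetric] by (rule image_image[THEN arg_cong])
    also have "{1..} = range Suc"
      by (auto simp: image_iff Suc_le_D intro: bexI[of _ "_ - 1"] dest: Suc_le_D)
    finally show ?thesis by (auto simp: A_def)
  qed
  have disj: "disjoint_family A"
    unfolding disjoint_family_on_def
  proof (intro ballI impI)
    fix i j :: nat assume "i \<noteq> j"
    then have ne: "wd (Suc i) \<noteq> wd (Suc j)" using bij by (auto simp: bij_betw_def inj_on_def)
    show "A i \<inter> A j = {}" unfolding A_def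
      by (rule tiles_disjoint[OF U inj _ _ W W ne]) (use G(1) in auto)
  qed
  have o: "open (A j)" for j unfolding A_def by (rule similarity_open_image[OF lpos sim G(2)])
  have b: "bounded (\<Union>j. A j)"
  proof (rule bounded_subset)
    show "bounded U" using U by (simp add: feasible_open_set_def)
    have "A j \<subseteq> U" for j using word_map_subset[OF U W[of j]] G(1) by (auto simp: A_def)
    then show "(\<Union>j. A j) \<subseteq> U" by blast
  qed
  have "inner_volume (A j) \<epsilon> = l (Suc j) ^ DIM('a) * inner_volume G (\<epsilon> / l (Suc j))" for j
    unfolding A_def by (rule inner_volume_similarity_image[OF lpos sim G(2,3)])
  then show ?thesis using inner_volume_disjoint_union[OF o disj b, of \<epsilon>] unfolding UA by simp
qed

section \<open>The kernel of the tube formula\<close>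

text \<open>
  The factor \<open>B\<close> in the integrand \<open>\<zeta>(s) B(s)\<close> of the error term. It is meromorphic with possible
  poles only at \<open>0, \<dots>, d\<close>, and decays quadratically in vertical strips.
\<close>

definition tube_kernel ::
    "'a::euclidean_space set \<Rightarrow> (nat \<Rightarrow> real \<Rightarrow> real) \<Rightarrow> real \<Rightarrow> complex \<Rightarrow> complex" where
  "tube_kernel G \<kappa> \<epsilon> s =
     of_real \<epsilon> powr (of_nat DIM('a) - s) / (of_nat DIM('a) - s) *
     (\<Sum>k=0..DIM('a)-1. of_real (inradius G) powr (s - of_nat k) / (s - of_nat k)
        * of_nat (DIM('a) - k) * of_real (\<kappa> k (inradius G)))"

lemma error_integrand_eq:
  "error_integrand \<zeta> G \<kappa> \<epsilon> s = \<zeta> s * tube_kernel G \<kappa> \<epsilon> s"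
proof -
  have "a * z / e * x = z * (a / e * x)" for a z e x :: complex
    by (simp only: times_divide_eq_left times_divide_eq_right mult.commute mult.left_commute
      mult.assoc)
  then show ?thesis unfolding error_integrand_def tube_kernel_def by blast
qed

lemma tube_kernel_analytic:
  fixes G :: "'a::euclidean_space set"
  assumes "\<epsilon> > 0" "inradius G > 0" "s \<notin> of_nat ` {0..DIM('a)}"
  shows "tube_kernel G \<kappa> \<epsilon> analytic_on {s}"
proof -
  have "(\<lambda>s. of_real (inradius G) powr (s - of_nat k) / (s - of_nat k)
        * of_nat (DIM('a) - k) * of_real (\<kappa> k (inradius G))) analytic_on {s}"
          if "k \<in> {0..DIM('a)-1}" for k
  proof -
    have "s \<noteq> of_nat k" using assms(3) that by auto
    then show ?thesis using assms(2) by (intro analytic_intros analytic_on_of_real_powr) auto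
  qed
  moreover have "s \<noteq> of_nat DIM('a)" using assms(3) by auto
  moreover have "(\<lambda>s. complex_of_real \<epsilon> powr (of_nat DIM('a) - s)) analytic_on {s}"
    by (rule analytic_on_of_real_powr[OF assms(1)]) (intro analytic_intros)
  moreover have "(\<lambda>s. complex_of_nat DIM('a) - s) analytic_on {s}" by (intro analytic_intros)
  ultimately show ?thesis unfolding tube_kernel_def[abs_def]
    by (intro analytic_on_mult[OF analytic_on_divide analytic_on_sum]) auto
qed

lemma tube_kernel_meromorphic:
  fixes G :: "'a::euclidean_space set"
  assumes "\<epsilon> > 0" "inradius G > 0"
  shows "tube_kernel G \<kappa> \<epsilon> meromorphic_on UNIV"
  unfolding tube_kernel_def[abs_def]
  by (intro meromorphic_intros analytic_on_imp_meromorphic_on[OF analytic_on_of_real_powr] assms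
    analytic_intros)

lemma tube_kernel_limit_at_nat:
  fixes G :: "'a::euclidean_space set"
  assumes "\<epsilon> > 0" "inradius G > 0" and k: "k < DIM('a)"
  shows "(\<lambda>s. (s - of_nat k) * tube_kernel G \<kappa> \<epsilon> s)
      \<midarrow>of_nat k\<rightarrow> of_real (\<kappa> k (inradius G)) * of_real \<epsilon> ^ (DIM('a) - k)"
proof -
  let ?d = "DIM('a)" and ?g = "inradius G"
  let ?t = "\<lambda>j s. complex_of_real ?g powr (s - of_nat j) / (s - of_nat j) * of_nat (?d - j)
      * of_real (\<kappa> j ?g)"
  let ?A = "\<lambda>s. complex_of_real \<epsilon> powr (of_nat ?d - s) / (of_nat ?d - s)"
  let ?R = "\<lambda>s. ?A s * ((s - of_nat k) * (\<Sum>j\<in>{0..?d-1} - {k}. ?t j s)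
       + of_real ?g powr (s - of_nat k) * of_nat (?d - k) * of_real (\<kappa> k ?g))"
  have kd: "complex_of_nat ?d \<noteq> of_nat k" using k by simp
  have "?t j analytic_on {of_nat k}" if "j \<in> {0..?d-1} - {k}" for j
  proof -
    have "complex_of_nat k \<noteq> of_nat j" using that by auto
    then show ?thesis using assms(2) by (intro analytic_intros analytic_on_of_real_powr) auto
  qed
  then have "?R analytic_on {of_nat k}"
    using assms kd by (intro analytic_on_mult analytic_on_add analytic_on_sum analytic_on_divide
      analytic_on_of_real_powr analytic_intros) auto
  then have "?R \<midarrow>of_nat k\<rightarrow> ?R (of_nat k)" using analytic_at_imp_isCont unfolding isCont_def by blast
  moreover have "?R (of_nat k) = of_real (\<kappa> k ?g) * of_real \<epsilon> ^ (?d - k)"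
  proof -
    have "complex_of_real \<epsilon> powr (of_nat ?d - of_nat k) = of_real \<epsilon> ^ (?d - k)"
      using assms(1) k by (simp add: powr_nat' flip: of_nat_diff)
    moreover have "complex_of_nat ?d - of_nat k = of_nat (?d - k)" using k
      by (simp add: of_nat_diff)
    moreover have nz: "complex_of_nat (?d - k) \<noteq> 0" using k by simp
    moreover have "complex_of_real ?g powr (of_nat k - of_nat k) = 1" using assms(2) by simp
    moreover have "a / z * ((of_nat k - of_nat k) * b + 1 * z * x) = x * a" if "z \<noteq> 0"
      for a b x z :: complex
    proof -
      have "a / z * (z * x) = x * a"
        by (simp only: divide_inverse mult.assoc mult.assoc[of
          "inverse z" z, symmetric] left_inverse[OF that] mult_1_left mult.commute[of a])
      then show ?thesis by (simp only: diff_self mult_zero_left add_0_left mult_1_left)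
    qed
    ultimately show ?thesis by (simp only: not_False_eq_True)
  qed
  ultimately have L: "?R \<midarrow>of_nat k\<rightarrow> of_real (\<kappa> k ?g) * of_real \<epsilon> ^ (?d - k)" by simp
  have E: "?R s = (s - of_nat k) * tube_kernel G \<kappa> \<epsilon> s" if "s \<noteq> of_nat k" for s
  proof -
    let ?X = "\<Sum>j\<in>{0..?d-1} - {k}. ?t j s"
    have "(\<Sum>j=0..?d-1. ?t j s) = ?t k s + ?X"
      using k by (intro sum.remove) auto
    then have tk: "tube_kernel G \<kappa> \<epsilon> s = ?A s * (?t k s + ?X)" unfolding tube_kernel_def
      by (simp only:)
    have st: "of_real ?g powr (s - of_nat k) * of_nat (?d - k) * of_real (\<kappa> k ?g)
        = (s - of_nat k) * ?t k s"
      using that by simp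
    have "a * (z * x + z * b) = z * (a * (b + x))" for a b x z :: complex
      by (simp add: algebra_simps)
    then show ?thesis unfolding tk st by blast
  qed
  show ?thesis by (rule Lim_transform_within[OF L zero_less_one]) (rule E, simp)
qed

lemma norm_sum_quotient_bound:
  assumes A: "cmod A \<le> a" and R: "R > 0" "R \<le> cmod e" and k: "\<And>k. k \<in> K \<Longrightarrow> R \<le> cmod (v k)"
    and p: "\<And>k. k \<in> K \<Longrightarrow> cmod (p k) \<le> q k" and "finite K"
  shows "cmod (A / e * (\<Sum>k\<in>K. p k / v k * m k * x k))
      \<le> a * (\<Sum>k\<in>K. q k * cmod (m k) * cmod (x k)) / R\<^sup>2"
proof -
  have a0: "a \<ge> 0" using A norm_ge_zero order_trans by blast
  have "cmod (A / e) \<le> a / R" unfolding norm_divide using A R a0 by (intro frac_le) auto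
  moreover have "cmod (\<Sum>k\<in>K. p k / v k * m k * x k) \<le> (\<Sum>k\<in>K. q k / R * cmod (m k) * cmod (x k))"
  proof (rule sum_norm_le)
    fix j assume j: "j \<in> K"
    have q0: "q j \<ge> 0" using p[OF j] norm_ge_zero order_trans by blast
    have "cmod (p j / v j) \<le> q j / R" unfolding norm_divide using p[OF j] k[OF j] R q0
      by (intro frac_le) auto
    then show "cmod (p j / v j * m j * x j) \<le> q j / R * cmod (m j) * cmod (x j)"
      unfolding norm_mult by (intro mult_right_mono) auto
  qed
  ultimately have "cmod (A / e * (\<Sum>k\<in>K. p k / v k * m k * x k))
      \<le> a / R * (\<Sum>k\<in>K. q k / R * cmod (m k) * cmod (x k))"
    unfolding norm_mult using a0 R by (intro mult_mono) auto
  also have "(\<Sum>k\<in>K. q k / R * cmod (m k) * cmod (x k)) = (\<Sum>k\<in>K. q k * cmod (m k) * cmod (x k)) / R"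
    by (simp add: sum_divide_distrib)
  also have "a / R * ((\<Sum>k\<in>K. q k * cmod (m k) * cmod (x k)) / R)
      = a * (\<Sum>k\<in>K. q k * cmod (m k) * cmod (x k)) / R\<^sup>2"
    by (simp add: power2_eq_square)
  finally show ?thesis .
qed

lemma powr_bounded_strip:
  fixes y :: real
  assumes "y > 0" "u \<le> x" "x \<le> v"
  shows "y powr x \<le> y powr u + y powr v"
proof (cases "y \<ge> 1")
  case True
  then have "y powr x \<le> y powr v" using assms by (intro powr_mono) auto
  then show ?thesis by (smt (verit) powr_ge_zero)
next
  case False
  then have "y powr x \<le> y powr u" using assms by (intro powr_mono') auto
  then show ?thesis by (smt (verit) powr_ge_zero)
qed

lemma tube_kernel_bound:
  fixes G :: "'a::euclidean_space set"
  assumes "\<epsilon> > 0" "inradius G > 0"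
  obtains M where "M \<ge> 0" "\<And>s R. u \<le> Re s \<Longrightarrow> Re s \<le> v \<Longrightarrow> R > 0 \<Longrightarrow>
      (\<And>k. k \<le> DIM('a) \<Longrightarrow> R \<le> cmod (s - of_nat k)) \<Longrightarrow> cmod (tube_kernel G \<kappa> \<epsilon> s) \<le> M / R\<^sup>2"
proof -
  let ?d = "DIM('a)" and ?g = "inradius G"
  define a where "a = \<epsilon> powr (?d - v) + \<epsilon> powr (?d - u)"
  define q where "q k = ?g powr (u - real k) + ?g powr (v - real k)" for k
  define M where "M = a * (\<Sum>k=0..?d-1. q k * cmod (of_nat (?d - k))
      * cmod (complex_of_real (\<kappa> k ?g)))"
  show ?thesis
  proof (rule that[of M])
    show "M \<ge> 0" unfolding M_def a_def q_def
      by (intro mult_nonneg_nonneg sum_nonneg add_nonneg_nonneg) auto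
    fix s R assume s: "u \<le> Re s" "Re s \<le> v" and R: "R > 0" "\<And>k. k \<le> ?d \<Longrightarrow> R \<le> cmod (s - of_nat k)"
    show "cmod (tube_kernel G \<kappa> \<epsilon> s) \<le> M / R\<^sup>2"
      unfolding tube_kernel_def M_def
    proof (rule norm_sum_quotient_bound[OF _ R(1)])
      show "cmod (of_real \<epsilon> powr (of_nat ?d - s)) \<le> a"
        unfolding norm_of_real_powr[OF assms(1)] a_def using s assms
          by (intro powr_bounded_strip) auto
      show "R \<le> cmod (of_nat ?d - s)" using R(2)[of ?d] by (simp add: norm_minus_commute)
      show "R \<le> cmod (s - of_nat k)" if "k \<in> {0..?d - 1}" for k using that R(2)[of k] by auto
      show "cmod (of_real ?g powr (s - of_nat k)) \<le> q k" for k
        unfolding norm_of_real_powr[OF assms(2)] q_def using s assms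
          by (intro powr_bounded_strip) auto
    qed auto
  qed
qed

lemma tube_kernel_graph_bound:
  fixes G :: "'a::euclidean_space set"
  assumes "\<epsilon> > 0" "inradius G > 0" and S: "L-lipschitz_on UNIV S" and b: "bounded (range S)"
    and S0: "\<And>k. k \<le> DIM('a) \<Longrightarrow> S 0 \<noteq> real k"
  obtains C where "C \<ge> 0" "\<And>t. cmod (tube_kernel G \<kappa> \<epsilon> (Complex (S t) t)) \<le> C / (1 + t\<^sup>2)"
proof -
  have ex: "\<exists>m. m > 0 \<and> (\<forall>t. m * sqrt (1 + t\<^sup>2) \<le> cmod (Complex (S t) t - of_nat k))"
    if kd: "k \<le> DIM('a)" for k
  proof -
    obtain m where "m > 0" "\<And>t. m * sqrt (1 + t\<^sup>2) \<le> cmod (Complex (S t) t - of_real (real k))"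
      using graph_distance_lower_bound[OF S S0[OF kd]] by blast
    then show ?thesis by auto
  qed
  have "\<exists>m. \<forall>k\<in>{..DIM('a)}. m k > 0 \<and>
      (\<forall>t. m k * sqrt (1 + t\<^sup>2) \<le> cmod (Complex (S t) t - of_nat k))"
    by (rule bchoice) (use ex in auto)
  then obtain m :: "nat \<Rightarrow> real" where m: "\<And>k. k \<le> DIM('a) \<Longrightarrow> m k > 0"
    "\<And>k t. k \<le> DIM('a) \<Longrightarrow> m k * sqrt (1 + t\<^sup>2) \<le> cmod (Complex (S t) t - of_nat k)"
      by (auto simp: Ball_def)
  define m0 where "m0 = Min (m ` {..DIM('a)})"
  have m0: "m0 > 0" "\<And>k. k \<le> DIM('a) \<Longrightarrow> m0 \<le> m k" using m(1) by (auto simp: m0_def)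
  obtain B where B: "\<And>t. \<bar>S t\<bar> \<le> B" using b unfolding bounded_iff by auto
  obtain M where M: "M \<ge> 0" "\<And>s R. - B \<le> Re s \<Longrightarrow> Re s \<le> B \<Longrightarrow> R > 0 \<Longrightarrow>
      (\<And>k. k \<le> DIM('a) \<Longrightarrow> R \<le> cmod (s - of_nat k)) \<Longrightarrow> cmod (tube_kernel G \<kappa> \<epsilon> s) \<le> M / R\<^sup>2"
    by (rule tube_kernel_bound[OF assms(1,2), of "-B" B \<kappa>]) blast
  show ?thesis
  proof (rule that[of "M / m0\<^sup>2"])
    show "M / m0\<^sup>2 \<ge> 0" using M by simp
    fix t :: real
    have pos: "sqrt (1 + t\<^sup>2) > 0" by (simp add: add_pos_nonneg)
    have "cmod (tube_kernel G \<kappa> \<epsilon> (Complex (S t) t)) \<le> M / (m0 * sqrt (1 + t\<^sup>2))\<^sup>2"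
    proof (rule M(2))
      show "- B \<le> Re (Complex (S t) t)" "Re (Complex (S t) t) \<le> B" using B[of t]
        by (auto simp: abs_le_iff)
      show "m0 * sqrt (1 + t\<^sup>2) > 0" using m0 pos by simp
      fix k assume k: "k \<le> DIM('a)"
      have "m0 * sqrt (1 + t\<^sup>2) \<le> m k * sqrt (1 + t\<^sup>2)" using m0(2)[OF k] pos
        by (intro mult_right_mono) auto
      then show "m0 * sqrt (1 + t\<^sup>2) \<le> cmod (Complex (S t) t - of_nat k)" using m(2)[OF k, of t]
        by linarith
    qed
    also have "(m0 * sqrt (1 + t\<^sup>2))\<^sup>2 = m0\<^sup>2 * (1 + t\<^sup>2)"
      by (simp add: power_mult_distrib add_nonneg_nonneg)
    finally show "cmod (tube_kernel G \<kappa> \<epsilon> (Complex (S t) t)) \<le> (M / m0\<^sup>2) / (1 + t\<^sup>2)" by simp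
  qed
qed

text \<open>
  The form in which the residue at a simple pole is used.
\<close>

lemma simple_pole_limit:
  assumes "isolated_singularity_at f z" "is_pole f z" "zorder f z = -1"
  shows "(\<lambda>s. (s - z) * f s) \<midarrow>z\<rightarrow> residue f z"
proof -
  have ne: "not_essential f z" using assms(2) by (rule is_pole_imp_not_essential)
  have fr: "\<exists>\<^sub>F w in at z. f w \<noteq> 0"
    using non_zero_neighbour_pole[OF assms(2)] by (intro eventually_frequently) auto
  obtain r where r: "r > 0" "zor_poly f z holomorphic_on cball z r"
     "\<And>w. w \<in> cball z r - {z} \<Longrightarrow> f w = zor_poly f z w * (w - z) powi (zorder f z)"
    using zorder_exist[OF assms(1) ne fr] by metis
  have "isCont (zor_poly f z) z"
    using continuous_on_interior[OF holomorphic_on_imp_continuous_on[OF r(2)], of z] r(1) by simp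
  then have L: "zor_poly f z \<midarrow>z\<rightarrow> residue f z"
    using residue_simple_pole[OF assms] by (simp add: isCont_def)
  show ?thesis
  proof (rule Lim_transform_within[OF L r(1)])
    fix w assume "0 < dist w z" "dist w z < r"
    then have "w \<in> cball z r - {z}" by (auto simp: dist_commute)
    then show "zor_poly f z w = (w - z) * f w" using r(3) assms(3) by (simp add: power_int_minus)
  qed
qed

text \<open>
  The value at a pole is a mere convention, so boundedness on a horizontal line does not exclude a
  pole on it by the value there; it is the divergence along the line that excludes it.
\<close>

lemma no_pole_if_bounded_on_horizontal:
  assumes "\<And>\<alpha>. cmod (\<zeta> (Complex \<alpha> t)) \<le> c"
  shows "\<not> is_pole \<zeta> (Complex x t)"
proof
  assume p: "is_pole \<zeta> (Complex x t)"
  have "filterlim (\<lambda>\<alpha>. Complex \<alpha> t) (at (Complex x t)) (at x)"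
    unfolding filterlim_at
  proof
    have "isCont (\<lambda>\<alpha>. Complex \<alpha> t) x"
      using continuous_on_interior[OF
        continuous_on_Complex[OF continuous_on_id continuous_on_const], of x UNIV t] by simp
    then show "(\<lambda>\<alpha>. Complex \<alpha> t) \<midarrow>x\<rightarrow> Complex x t" by (simp add: isCont_def)
    show "\<forall>\<^sub>F \<alpha> in at x. Complex \<alpha> t \<in> UNIV \<and> Complex \<alpha> t \<noteq> Complex x t"
      by (auto simp: eventually_at intro!: exI[of _ 1])
  qed
  then have "filterlim (\<lambda>\<alpha>. \<zeta> (Complex \<alpha> t)) at_infinity (at x)"
    using p unfolding is_pole_def by (rule filterlim_compose[rotated])
  then have "eventually (\<lambda>\<alpha>. c + 1 \<le> cmod (\<zeta> (Complex \<alpha> t))) (at x)"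
    using filterlim_at_infinity_imp_norm_at_top unfolding filterlim_at_top by blast
  then have "eventually (\<lambda>\<alpha>. False) (at x)"
  proof (rule eventually_mono)
    fix \<alpha> assume "c + 1 \<le> cmod (\<zeta> (Complex \<alpha> t))"
    then show False using assms[of \<alpha>] by linarith
  qed
  then show False by simp
qed

lemma finite_poles_in_bounded:
  assumes "\<zeta> meromorphic_on UNIV" "bounded B"
  shows "finite {\<omega> \<in> B. is_pole \<zeta> \<omega>}"
proof -
  have "{z. \<not> \<zeta> analytic_on {z}} sparse_in UNIV"
    using meromorphic_on_imp_sparse_singularities[OF assms(1)] .
  then have "{z. \<not> \<zeta> analytic_on {z}} sparse_in closure B" by (rule sparse_in_subset) auto
  then have "finite (closure B \<inter> {z. \<not> \<zeta> analytic_on {z}})"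
    using assms(2) by (intro sparse_in_compact_finite) auto
  moreover have "{\<omega> \<in> B. is_pole \<zeta> \<omega>} \<subseteq> closure B \<inter> {z. \<not> \<zeta> analytic_on {z}}"
    using closure_subset[of B] analytic_at_imp_no_pole by blast
  ultimately show ?thesis using finite_subset by blast
qed

lemma finite_truncated_dims:
  assumes "\<zeta> meromorphic_on UNIV" "bounded (range S)" "\<And>s. is_pole \<zeta> s \<Longrightarrow> Re s \<le> D"
  shows "finite {\<omega> \<in> visible_dims \<zeta> S. a < Im \<omega> \<and> Im \<omega> < b}"
proof -
  obtain B where B: "\<And>t. \<bar>S t\<bar> \<le> B" using assms(2) unfolding bounded_iff by auto
  have "{\<omega> \<in> visible_dims \<zeta> S. a < Im \<omega> \<and> Im \<omega> < b}
      \<subseteq> {\<omega> \<in> cball 0 (B + \<bar>D\<bar> + \<bar>a\<bar> + \<bar>b\<bar>). is_pole \<zeta> \<omega>}"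
  proof
    fix \<omega> assume w: "\<omega> \<in> {\<omega> \<in> visible_dims \<zeta> S. a < Im \<omega> \<and> Im \<omega> < b}"
    then have p: "is_pole \<zeta> \<omega>" "S (Im \<omega>) \<le> Re \<omega>" by (auto simp: visible_dims_def window_def)
    have "cmod \<omega> \<le> \<bar>Re \<omega>\<bar> + \<bar>Im \<omega>\<bar>" by (rule cmod_le)
    moreover have "\<bar>Re \<omega>\<bar> \<le> B + \<bar>D\<bar>" using p(2) B[of "Im \<omega>"] assms(3)[OF p(1)] by linarith
    moreover have "\<bar>Im \<omega>\<bar> \<le> \<bar>a\<bar> + \<bar>b\<bar>" using w by auto
    ultimately show "\<omega> \<in> {\<omega> \<in> cball 0 (B + \<bar>D\<bar> + \<bar>a\<bar> + \<bar>b\<bar>). is_pole \<zeta> \<omega>}" using p by auto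
  qed
  then show ?thesis using finite_poles_in_bounded[OF assms(1) bounded_cball] finite_subset by blast
qed

lemma error_integrand_graph_residues:
  fixes G :: "'a::euclidean_space set" and \<kappa> :: "nat \<Rightarrow> real \<Rightarrow> real"
  assumes \<zeta>: "\<zeta> nicely_meromorphic_on UNIV" and \<zeta>D: "\<And>s. D < Re s \<Longrightarrow> \<zeta> analytic_on {s}"
    and scr: "screen \<zeta> D S" and simple: "simple_visible_poles \<zeta> DIM('a) S"
    and S0: "\<And>k. k \<le> DIM('a) \<Longrightarrow> S 0 \<noteq> real k"
    and c: "D < c" "real DIM('a) - 1 < c" "c < real DIM('a)"
    and ab: "a < 0" "0 < b" and bnd: "\<And>t \<alpha>. t = a \<or> t = b \<Longrightarrow> cmod (\<zeta> (Complex \<alpha> t)) \<le> z0"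
    and \<epsilon>: "\<epsilon> > 0" "inradius G > 0"
  defines "E \<equiv> error_integrand \<zeta> G \<kappa> \<epsilon>"
  shows "graph_boundary_integrable E S c a b"
    and "graph_boundary_integral E S c a b = 2 * of_real pi * \<i> *
      ((\<Sum>\<omega>\<in>{\<omega>\<in>visible_dims \<zeta> S. a < Im \<omega> \<and> Im \<omega> < b}. dim_coeff \<zeta> G \<kappa> \<omega>
          * of_real \<epsilon> powr (of_nat DIM('a) - \<omega>))
       + (\<Sum>k\<in>visible_integer_dims DIM('a) S - {DIM('a)}. integer_coeff \<zeta> G \<kappa> k
           * of_real \<epsilon> ^ (DIM('a) - k)))"
proof -
  let ?d = "DIM('a)" and ?B = "tube_kernel G \<kappa> \<epsilon>"
  obtain L where S: "L-lipschitz_on UNIV S" using scr by (auto simp: screen_def)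
  have SD: "S t \<le> D" and Sb: "bounded (range S)" and Sp: "\<not> is_pole \<zeta> (Complex (S t) t)" for t
    using scr by (auto simp: screen_def)
  have Sc: "S t < c" for t using SD[of t] c by linarith
  have \<zeta>m: "\<zeta> meromorphic_on UNIV" using \<zeta> by (simp add: nicely_meromorphic_on_def)
  have pD: "Re s \<le> D" if "is_pole \<zeta> s" for s using \<zeta>D[of s] analytic_at_imp_no_pole that by force
  have \<zeta>an: "\<zeta> analytic_on {s}" if "\<not> is_pole \<zeta> s" for s
    using nicely_meromorphic_on_imp_analytic_at[OF \<zeta> _ that] by simp
  have E: "E = (\<lambda>s. \<zeta> s * ?B s)" by (rule ext) (simp add: E_def error_integrand_eq)
  have Em: "E meromorphic_on UNIV"
    unfolding E by (intro meromorphic_on_mult \<zeta>m tube_kernel_meromorphic \<epsilon>)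
  have iso: "isolated_singularity_at E p" for p
    using Em meromorphic_on_subset[of E UNIV "{p}"]
      by (intro meromorphic_on_isolated_singularity) auto
  define P1 where "P1 = {\<omega>\<in>visible_dims \<zeta> S. a < Im \<omega> \<and> Im \<omega> < b}"
  define K where "K = visible_integer_dims ?d S - {?d}"
  define P2 where "P2 = (of_nat ` K :: complex set)"
  have fin: "finite P1" "finite P2" "finite K"
    using finite_truncated_dims[OF \<zeta>m Sb pD]
      by (auto simp: P1_def P2_def K_def visible_integer_dims_def)
  have disj: "P1 \<inter> P2 = {}"
    using simple by (auto simp: P1_def P2_def K_def simple_visible_poles_def
      visible_integer_dims_def)
  have KK: "k < ?d" "S 0 \<le> real k" if "k \<in> K" for k
    using that by (auto simp: K_def visible_integer_dims_def window_def)
  \<comment> \<open>Poles lie strictly to the right of the screen, because the screen avoids the poles of \<open>\<zeta>\<close> and the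
  integers.\<close>
  have sub: "P1 \<union> P2 \<subseteq> {s. S (Im s) < Re s \<and> Re s < c \<and> a < Im s \<and> Im s < b}"
  proof
    fix s assume "s \<in> P1 \<union> P2"
    then show "s \<in> {s. S (Im s) < Re s \<and> Re s < c \<and> a < Im s \<and> Im s < b}"
    proof
      assume s: "s \<in> P1"
      then have p: "is_pole \<zeta> s" "S (Im s) \<le> Re s"
        by (auto simp: P1_def visible_dims_def window_def)
      have "S (Im s) \<noteq> Re s"
      proof
        assume "S (Im s) = Re s"
        then have "s = Complex (S (Im s)) (Im s)" by (simp add: complex_eq_iff)
        then show False using Sp[of "Im s"] p(1) by simp
      qed
      then show ?thesis using s p pD[OF p(1)] c by (auto simp: P1_def)
    next
      assume "s \<in> P2"
      then obtain k where k: "k \<in> K" "s = of_nat k" by (auto simp: P2_def)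
      have "real k \<le> real ?d - 1" using KK[OF k(1)] by linarith
      then show ?thesis using KK[OF k(1)] S0[of k] c ab k(2) by auto
    qed
  qed
  have an: "E analytic_on {s}" if s: "s \<in> graph_region S c a b - (P1 \<union> P2)" for s
  proof -
    have s': "S (Im s) \<le> Re s" "Re s \<le> c" "a \<le> Im s" "Im s \<le> b" "s \<notin> P1" "s \<notin> P2"
      using s by (auto simp: graph_region_def)
    have "\<not> is_pole \<zeta> s"
    proof
      assume p: "is_pole \<zeta> s"
      \<comment> \<open>There are no poles at the heights \<open>a\<close> and \<open>b\<close>, so restricting to \<open>a < Im \<omega> < b\<close> loses none.\<close>
      have "Im s \<noteq> a" "Im s \<noteq> b"
        using no_pole_if_bounded_on_horizontal[of \<zeta> "Im s" z0 "Re s"] bnd p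
          by (auto simp: complex_eq_iff)
      then show False using p s' by (auto simp: P1_def visible_dims_def window_def)
    qed
    moreover have "s \<notin> of_nat ` {0..?d}"
    proof
      assume "s \<in> of_nat ` {0..?d}"
      then obtain k where k: "k \<le> ?d" "s = of_nat k" by auto
      have "k \<noteq> ?d" using s' k c by auto
      then have "k \<in> K" using k s' by (auto simp: K_def visible_integer_dims_def window_def)
      then show False using s' k by (auto simp: P2_def)
    qed
    ultimately show ?thesis unfolding E by (intro analytic_on_mult \<zeta>an tube_kernel_analytic \<epsilon>)
  qed
  \<comment> \<open>On \<open>P2\<close> the number \<open>nat \<lfloor>Re p\<rfloor>\<close> recovers \<open>k\<close> from \<open>p = of_nat k\<close>.\<close>
  define \<rho> where "\<rho> p = (if p \<in> P2 then of_real (\<kappa> (nat \<lfloor>Re p\<rfloor>) (inradius G)) * \<zeta> p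
      * of_real \<epsilon> ^ (?d - nat \<lfloor>Re p\<rfloor>)
      else dim_coeff \<zeta> G \<kappa> p * of_real \<epsilon> powr (of_nat ?d - p))" for p
  have res: "(\<lambda>s. (s - p) * E s) \<midarrow>p\<rightarrow> \<rho> p" if p: "p \<in> P1 \<union> P2" for p
  proof (cases "p \<in> P2")
    case True
    then obtain k where k: "k \<in> K" "p = of_nat k" by (auto simp: P2_def)
    have "\<not> is_pole \<zeta> p"
    proof
      assume "is_pole \<zeta> p"
      then have "p \<in> visible_dims \<zeta> S \<inter> of_nat ` {0..?d}"
        using k KK[OF k(1)] by (auto simp: visible_dims_def window_def)
      then show False using simple by (auto simp: simple_visible_poles_def)
    qed
    then have "\<zeta> \<midarrow>p\<rightarrow> \<zeta> p" using analytic_at_imp_isCont[OF \<zeta>an] unfolding isCont_def by blast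
    then have "(\<lambda>s. \<zeta> s * ((s - p) * ?B s)) \<midarrow>p\<rightarrow> \<zeta> p
        * (of_real (\<kappa> k (inradius G)) * of_real \<epsilon> ^ (?d - k))"
      unfolding k(2) by (intro tendsto_mult tube_kernel_limit_at_nat \<epsilon> KK(1)[OF k(1)])
    moreover have "(\<lambda>s. \<zeta> s * ((s - p) * ?B s)) = (\<lambda>s. (s - p) * E s)" unfolding E
      by (simp add: fun_eq_iff)
    moreover have "\<zeta> p * (of_real (\<kappa> k (inradius G)) * of_real \<epsilon> ^ (?d - k)) = \<rho> p"
      using True by (simp add: \<rho>_def k(2))
    ultimately show ?thesis by (simp only:)
  next
    case False
    then have p1: "p \<in> P1" using p by blast
    then have pv: "p \<in> visible_dims \<zeta> S" "is_pole \<zeta> p" by (auto simp: P1_def visible_dims_def)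
    have ord: "zorder \<zeta> p = -1" and nint: "p \<notin> of_nat ` {0..?d}" using simple pv
      by (auto simp: simple_visible_poles_def)
    have "(\<lambda>s. (s - p) * \<zeta> s) \<midarrow>p\<rightarrow> residue \<zeta> p"
      using \<zeta>m meromorphic_on_subset[of \<zeta> UNIV "{p}"]
        by (intro simple_pole_limit meromorphic_on_isolated_singularity pv ord) auto
    moreover have "?B \<midarrow>p\<rightarrow> ?B p"
      using analytic_at_imp_isCont[OF tube_kernel_analytic[OF \<epsilon> nint]] unfolding isCont_def .
    ultimately have "(\<lambda>s. ((s - p) * \<zeta> s) * ?B s) \<midarrow>p\<rightarrow> residue \<zeta> p * ?B p" by (rule tendsto_mult)
    moreover have "(\<lambda>s. ((s - p) * \<zeta> s) * ?B s) = (\<lambda>s. (s - p) * E s)" unfolding E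
      by (simp add: fun_eq_iff)
    moreover have "residue \<zeta> p * ?B p = \<rho> p"
    proof -
      have "(\<Sum>k=0..?d-1. of_real (inradius G) powr (p - of_nat k) * of_nat (?d - k) / (p - of_nat k)
          * of_real (\<kappa> k (inradius G)))
         = (\<Sum>k=0..?d-1. of_real (inradius G) powr (p - of_nat k) / (p - of_nat k) * of_nat (?d - k)
             * complex_of_real (\<kappa> k (inradius G)))"
        by (intro sum.cong refl) simp
      then show ?thesis using False by (simp add: \<rho>_def dim_coeff_def tube_kernel_def)
    qed
    ultimately show ?thesis by (simp only:)
  qed
  have ab': "a \<le> b" using ab by simp
  have finP: "finite (P1 \<union> P2)" using fin by simp
  note R = graph_boundary_residues[OF S Sc ab' finP sub an iso res]
  show "graph_boundary_integrable E S c a b" by (rule R(1))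
  have "(\<Sum>p\<in>P1 \<union> P2. \<rho> p) = (\<Sum>p\<in>P1. \<rho> p) + (\<Sum>p\<in>P2. \<rho> p)"
    using fin disj by (intro sum.union_disjoint)
  also have "(\<Sum>p\<in>P1. \<rho> p) = (\<Sum>\<omega>\<in>P1. dim_coeff \<zeta> G \<kappa> \<omega> * of_real \<epsilon> powr (of_nat ?d - \<omega>))"
    using disj by (intro sum.cong refl) (auto simp: \<rho>_def)
  also have "(\<Sum>p\<in>P2. \<rho> p) = (\<Sum>k\<in>K. integer_coeff \<zeta> G \<kappa> k * of_real \<epsilon> ^ (?d - k))"
  proof -
    have "(\<Sum>p\<in>P2. \<rho> p) = (\<Sum>k\<in>K. \<rho> (of_nat k))"
      unfolding P2_def by (subst sum.reindex) (auto simp: inj_on_def)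
    also have "\<dots> = (\<Sum>k\<in>K. integer_coeff \<zeta> G \<kappa> k * of_real \<epsilon> ^ (?d - k))"
      by (intro sum.cong refl) (auto simp: \<rho>_def P2_def integer_coeff_def)
    finally show ?thesis .
  qed
  finally show "graph_boundary_integral E S c a b = 2 * of_real pi * \<i> *
      ((\<Sum>\<omega>\<in>{\<omega>\<in>visible_dims \<zeta> S. a < Im \<omega> \<and> Im \<omega> < b}. dim_coeff \<zeta> G \<kappa> \<omega>
          * of_real \<epsilon> powr (of_nat DIM('a) - \<omega>))
       + (\<Sum>k\<in>visible_integer_dims DIM('a) S - {DIM('a)}. integer_coeff \<zeta> G \<kappa> k
           * of_real \<epsilon> ^ (DIM('a) - k)))"
    using R(2) unfolding P1_def K_def by simp
qed

section \<open>The tube formula on a vertical line\<close>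

text \<open>
  The contribution of the index \<open>k\<close> to the volume of a tile of scale \<open>x\<close> per unit of \<open>\<kappa>\<^sub>k\<close>: the
  Steiner term of the scaled tile, frozen at the inradius as soon as \<open>\<epsilon>/x \<ge> g\<close>.
\<close>

definition tile_weight :: "nat \<Rightarrow> real \<Rightarrow> real \<Rightarrow> nat \<Rightarrow> real \<Rightarrow> real" where
  "tile_weight d g \<epsilon> k x = (if \<epsilon> / x < g then x ^ k * \<epsilon> ^ (d - k) else x ^ d * g ^ (d - k))"

text \<open>
  The substitution \<open>y = x g / \<epsilon>\<close>, which identifies the contribution of a tile of scale \<open>x\<close> to the
  integrand with a linear combination of Mellin kernels.
\<close>

lemma tube_kernel_eq_mellin:
  fixes G :: "'a::euclidean_space set"
  assumes \<epsilon>: "\<epsilon> > 0" "inradius G > 0" and x: "x > 0"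
  shows "of_real x powr s * tube_kernel G \<kappa> \<epsilon> s =
    (\<Sum>k=0..DIM('a)-1. of_real (\<kappa> k (inradius G) * (\<epsilon> ^ DIM('a) / inradius G ^ k))
        * mellin_kernel (x * inradius G / \<epsilon>) (real k) (real DIM('a)) s)"
proof -
  let ?d = "DIM('a)" and ?g = "inradius G"
  have y: "complex_of_real (x * ?g / \<epsilon>) powr s
      = of_real x powr s * of_real ?g powr s / of_real \<epsilon> powr s"
  proof -
    have "complex_of_real x powr s * of_real ?g powr s = of_real (x * ?g / \<epsilon> * \<epsilon>) powr s"
      using \<epsilon> x powr_times_real[of "complex_of_real x" "complex_of_real ?g" s] by simp
    also have "\<dots> = of_real (x * ?g / \<epsilon>) powr s * of_real \<epsilon> powr s"
      using \<epsilon> x powr_times_real[of "complex_of_real (x * ?g / \<epsilon>)" "complex_of_real \<epsilon>" s] by simp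
    finally show ?thesis using \<epsilon>(1) by simp
  qed
  have e: "complex_of_real \<epsilon> powr (of_nat ?d - s) = of_real \<epsilon> ^ ?d / of_real \<epsilon> powr s"
    using \<epsilon>(1) by (simp add: powr_diff powr_nat')
  have gk: "complex_of_real ?g powr (s - of_nat k) = of_real ?g powr s / of_real ?g ^ k" for k
    using \<epsilon>(2) by (simp add: powr_diff powr_nat')
  have alg: "X * (E / W / D * (P / Q / V * M * K)) = K * (E / Q) * (X * P / W * M / (V * D))"
    for X E W D P Q V M K :: complex
    by (simp add: divide_inverse mult_ac)
  have term_eq: "of_real x powr s * (of_real \<epsilon> powr (of_nat ?d - s) / (of_nat ?d - s) *
      (of_real ?g powr (s - of_nat k) / (s - of_nat k) * of_nat (?d - k) * of_real (\<kappa> k ?g)))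
     = of_real (\<kappa> k ?g * (\<epsilon> ^ ?d / ?g ^ k)) * mellin_kernel (x * ?g / \<epsilon>) (real k) (real ?d) s"
       if k: "k \<in> {0..?d-1}" for k
  proof -
    have kd: "k \<le> ?d" using k by (simp add: le_diff_conv2 trans_le_add1) 
    have m: "mellin_kernel (x * ?g / \<epsilon>) (real k) (real ?d) s =
       of_real x powr s * of_real ?g powr s / of_real \<epsilon> powr s * of_nat (?d - k)
           / ((s - of_nat k) * (of_nat ?d - s))"
      unfolding mellin_kernel_def y using kd by (simp add: of_nat_diff)
    have c: "complex_of_real (\<kappa> k ?g * (\<epsilon> ^ ?d / ?g ^ k))
        = of_real (\<kappa> k ?g) * (of_real \<epsilon> ^ ?d / of_real ?g ^ k)" by simp
    show ?thesis unfolding m c e gk by (rule alg)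
  qed
  have "of_real x powr s * tube_kernel G \<kappa> \<epsilon> s
      = (\<Sum>k=0..?d-1. of_real x powr s * (of_real \<epsilon> powr (of_nat ?d - s) / (of_nat ?d - s) *
      (of_real ?g powr (s - of_nat k) / (s - of_nat k) * of_nat (?d - k) * of_real (\<kappa> k ?g))))"
    unfolding tube_kernel_def sum_distrib_left ..
  also have "\<dots> = (\<Sum>k=0..?d-1. of_real (\<kappa> k ?g * (\<epsilon> ^ ?d / ?g ^ k))
      * mellin_kernel (x * ?g / \<epsilon>) (real k) (real ?d) s)"
    by (intro sum.cong refl term_eq)
  finally show ?thesis .
qed

lemma tile_weight_mellin:
  assumes "\<epsilon> > 0" "g > 0" "x > 0" "k \<le> d"
  shows "\<epsilon> ^ d / g ^ k * (if x * g / \<epsilon> > 1 then (x * g / \<epsilon>) powr real k else (x * g / \<epsilon>) powr real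
      d) = tile_weight d g \<epsilon> k x"
proof -
  have pos: "x * g / \<epsilon> > 0" using assms by simp
  have iff: "x * g / \<epsilon> > 1 \<longleftrightarrow> \<epsilon> / x < g" using assms by (simp add: field_simps)
  have 1: "\<epsilon> ^ d / g ^ k * (x * g / \<epsilon>) ^ k = x ^ k * \<epsilon> ^ (d - k)"
  proof -
    have "\<epsilon> ^ d = \<epsilon> ^ k * \<epsilon> ^ (d - k)" using assms(4) by (simp flip: power_add)
    then show ?thesis using assms by (simp add: power_divide power_mult_distrib)
  qed
  have 2: "\<epsilon> ^ d / g ^ k * (x * g / \<epsilon>) ^ d = x ^ d * g ^ (d - k)"
  proof -
    have "g ^ d = g ^ k * g ^ (d - k)" using assms(4) by (simp flip: power_add)
    then show ?thesis using assms by (simp add: power_divide power_mult_distrib)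
  qed
  show ?thesis using 1 2 iff pos by (simp add: tile_weight_def powr_realpow)
qed

lemma screen_integral_scaled_tube_kernel:
  fixes G :: "'a::euclidean_space set"
  assumes \<epsilon>: "\<epsilon> > 0" "inradius G > 0" and x: "x > 0"
    and c: "real DIM('a) - 1 < c" "c < real DIM('a)"
  shows "screen_integrable (\<lambda>_. c) (\<lambda>s. of_real x powr s * tube_kernel G \<kappa> \<epsilon> s)"
    and "screen_integral (\<lambda>_. c) (\<lambda>s. of_real x powr s * tube_kernel G \<kappa> \<epsilon> s)
       = 2 * of_real pi * \<i> * of_real
           (\<Sum>k=0..DIM('a)-1. \<kappa> k (inradius G) * tile_weight DIM('a) (inradius G) \<epsilon> k x)"
proof -
  let ?d = "DIM('a)" and ?g = "inradius G"
  let ?a = "\<lambda>k. complex_of_real (\<kappa> k ?g * (\<epsilon> ^ ?d / ?g ^ k))"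
    and ?m = "\<lambda>k. mellin_kernel (x * ?g / \<epsilon>) (real k) (real ?d)"
  have y: "x * ?g / \<epsilon> > 0" using \<epsilon> x by simp
  have kd: "real k < c" "k \<le> ?d" if "k \<in> {0..?d-1}" for k
  proof -
    have "k < ?d" using that DIM_positive[where 'a='a] unfolding atLeastAtMost_iff by linarith
    then have "real k \<le> real ?d - 1" by linarith
    then show "real k < c" "k \<le> ?d" using c \<open>k < ?d\<close> by linarith+
  qed
  have si: "screen_integrand (\<lambda>_. c) (\<lambda>s. of_real x powr s * tube_kernel G \<kappa> \<epsilon> s)
     = (\<lambda>t. \<Sum>k=0..?d-1. ?a k * screen_integrand (\<lambda>_. c) (?m k) t)"
    unfolding screen_integrand_def tube_kernel_eq_mellin[OF \<epsilon> x]
      by (simp add: sum_distrib_right mult.assoc)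
  have i: "integrable lebesgue (screen_integrand (\<lambda>_. c) (?m k))" if "k \<in> {0..?d-1}" for k
    using mellin_kernel_screen_integrable[OF y kd(1)[OF that] c(2)]
      by (simp add: screen_integrable_def)
  show "screen_integrable (\<lambda>_. c) (\<lambda>s. of_real x powr s * tube_kernel G \<kappa> \<epsilon> s)"
    unfolding screen_integrable_def si
      by (intro Bochner_Integration.integrable_sum integrable_mult_right i)
  have "screen_integral (\<lambda>_. c) (\<lambda>s. of_real x powr s * tube_kernel G \<kappa> \<epsilon> s)
      = (\<Sum>k=0..?d-1. ?a k * screen_integral (\<lambda>_. c) (?m k))"
    unfolding screen_integral_def si
      by (subst Bochner_Integration.integral_sum) (auto intro!: integrable_mult_right i)
  also have "\<dots> = (\<Sum>k=0..?d-1. 2 * of_real pi * \<i> * of_real (\<kappa> k ?g * tile_weight ?d ?g \<epsilon> k x))"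
  proof (intro sum.cong refl)
    fix k assume k: "k \<in> {0..?d-1}"
    let ?v = "if x * ?g / \<epsilon> > 1 then (x * ?g / \<epsilon>) powr real k else (x * ?g / \<epsilon>) powr real ?d"
    have "?a k * screen_integral (\<lambda>_. c) (?m k) = ?a k * (2 * of_real pi * \<i> * of_real ?v)"
      using mellin_kernel_integral[OF y _ kd(1)[OF k] c(2)] by simp
    also have "\<dots> = 2 * of_real pi * \<i> * of_real (\<kappa> k ?g * (\<epsilon> ^ ?d / ?g ^ k * ?v))" by simp
    finally show "?a k * screen_integral (\<lambda>_. c) (?m k)
        = 2 * of_real pi * \<i> * of_real (\<kappa> k ?g * tile_weight ?d ?g \<epsilon> k x)"
      unfolding tile_weight_mellin[OF \<epsilon> x kd(2)[OF k]] .
  qed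
  finally show "screen_integral (\<lambda>_. c) (\<lambda>s. of_real x powr s * tube_kernel G \<kappa> \<epsilon> s)
       = 2 * of_real pi * \<i> * of_real (\<Sum>k=0..?d-1. \<kappa> k ?g * tile_weight ?d ?g \<epsilon> k x)"
    by (simp add: sum_distrib_left)
qed

text \<open>
  Sum and integral may be interchanged because \<open>\<bar>\<ell>\<^sub>j\<^sup>s\<bar> = \<ell>\<^sub>j\<^sup>c\<close> is constant on the line and summable,
  while the kernel itself is integrable there.
\<close>

lemma screen_integral_error_integrand_sums:
  fixes G :: "'a::euclidean_space set"
  assumes \<epsilon>: "\<epsilon> > 0" "inradius G > 0" and c: "real DIM('a) - 1 < c" "c < real DIM('a)"
    and l: "\<And>j. l (Suc j) > (0::real)" and sm: "summable (\<lambda>j. l (Suc j) powr c)"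
    and \<zeta>: "\<And>s. Re s = c \<Longrightarrow> (\<lambda>j. of_real (l (Suc j)) powr s) sums \<zeta> s"
  shows "screen_integrable (\<lambda>_. c) (error_integrand \<zeta> G \<kappa> \<epsilon>)"
    and "(\<lambda>j. 2 * of_real pi * \<i> * complex_of_real
        (\<Sum>k=0..DIM('a)-1. \<kappa> k (inradius G) * tile_weight DIM('a) (inradius G) \<epsilon> k (l (Suc j))))
          sums screen_integral (\<lambda>_. c) (error_integrand \<zeta> G \<kappa> \<epsilon>)"
proof -
  let ?B = "tube_kernel G \<kappa> \<epsilon>"
  define f where "f j = screen_integrand (\<lambda>_. c) (\<lambda>s. of_real (l (Suc j)) powr s * ?B s)" for j
  define b where "b = screen_integrand (\<lambda>_. c) ?B"
  note K = screen_integral_scaled_tube_kernel[OF \<epsilon> _ c, of _ \<kappa>]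
  have fi: "integrable lebesgue (f j)" for j
    using K(1)[OF l] by (simp add: f_def screen_integrable_def)
  have fb: "f j t = of_real (l (Suc j)) powr Complex c t * b t" for j t
    by (simp add: f_def b_def screen_integrand_def)
  have nf: "norm (f j t) = l (Suc j) powr c * norm (b t)" for j t
    unfolding fb norm_mult norm_of_real_powr[OF l] by simp
  have E: "(\<lambda>j. f j t) sums screen_integrand (\<lambda>_. c) (error_integrand \<zeta> G \<kappa> \<epsilon>) t" for t
  proof -
    have "(\<lambda>j. of_real (l (Suc j)) powr Complex c t * b t) sums (\<zeta> (Complex c t) * b t)"
      by (intro sums_mult2 \<zeta>) simp
    then show ?thesis unfolding fb
      by (simp add: b_def screen_integrand_def error_integrand_eq mult.assoc)
  qed
  have s1: "AE t in lebesgue. summable (\<lambda>j. norm (f j t))"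
    unfolding nf by (intro AE_I2 summable_mult2 sm)
  have s2: "summable (\<lambda>j. LINT t|lebesgue. norm (f j t))"
    unfolding nf by (simp add: summable_mult2[OF sm])
  have eq: "(\<lambda>t. \<Sum>j. f j t) = screen_integrand (\<lambda>_. c) (error_integrand \<zeta> G \<kappa> \<epsilon>)"
    using E by (auto simp: sums_iff)
  show "screen_integrable (\<lambda>_. c) (error_integrand \<zeta> G \<kappa> \<epsilon>)"
    using integrable_suminf[OF fi s1 s2] unfolding eq screen_integrable_def .
  have "integral\<^sup>L lebesgue (f j) = 2 * of_real pi * \<i>
      * complex_of_real (\<Sum>k=0..DIM('a)-1. \<kappa> k (inradius G)
      * tile_weight DIM('a) (inradius G) \<epsilon> k (l (Suc j)))" for j
    using K(2)[OF l] unfolding f_def screen_integral_def .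
  then show "(\<lambda>j. 2 * of_real pi * \<i>
      * complex_of_real (\<Sum>k=0..DIM('a)-1. \<kappa> k (inradius G)
      * tile_weight DIM('a) (inradius G) \<epsilon> k (l (Suc j))))
          sums screen_integral (\<lambda>_. c) (error_integrand \<zeta> G \<kappa> \<epsilon>)"
    using sums_integral[OF fi s1 s2] unfolding eq screen_integral_def by simp
qed

text \<open>
  The volume of a scaled inner parallel set, split into the part with constant coefficients
  \<open>\<kappa>\<^sub>k(g)\<close> and the fluctuation. For \<open>\<epsilon>/x \<ge> g\<close> it is the full volume \<open>\<lambda>(G) = V(G, g)\<close>, to which the
  representation applies with \<open>\<epsilon> = g\<close>.
\<close>

lemma steiner_tile:
  fixes G :: "'a::euclidean_space set"
  assumes G: "open G" "bounded G" "G \<noteq> {}" and st: "steiner_representation G \<kappa>"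
    and \<epsilon>: "\<epsilon> > 0" and x: "x > 0"
  shows "x ^ DIM('a) * inner_volume G (\<epsilon> / x) =
     (\<Sum>k=0..DIM('a). \<kappa> k (inradius G) * tile_weight DIM('a) (inradius G) \<epsilon> k x)
     + (if \<epsilon> / x < inradius G then \<Sum>k=0..DIM('a). x ^ k
         * (extended_coeff G \<kappa> k (\<epsilon> / x) - \<kappa> k (inradius G)) * \<epsilon> ^ (DIM('a) - k) else 0)"
proof -
  let ?d = "DIM('a)" and ?g = "inradius G"
  have g: "?g > 0" by (rule inradius_bounded_open(1)[OF G])
  have rep: "inner_volume G e = (\<Sum>k=0..?d. \<kappa> k e * e ^ (?d - k))" if "0 < e" "e \<le> ?g" for e
    using st that by (auto simp: steiner_representation_def)
  show ?thesis
  proof (cases "\<epsilon> / x < ?g")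
    case True
    have "x ^ ?d * inner_volume G (\<epsilon> / x) = (\<Sum>k=0..?d. x ^ ?d * (\<kappa> k (\<epsilon> / x) * (\<epsilon> / x) ^ (?d - k)))"
      using True \<epsilon> x by (simp add: rep sum_distrib_left)
    also have "\<dots> = (\<Sum>k=0..?d. \<kappa> k (\<epsilon> / x) * (x ^ k * \<epsilon> ^ (?d - k)))"
    proof (intro sum.cong refl)
      fix k assume "k \<in> {0..?d}"
      then have "x ^ ?d = x ^ k * x ^ (?d - k)" by (simp flip: power_add)
      then show "x ^ ?d * (\<kappa> k (\<epsilon> / x) * (\<epsilon> / x) ^ (?d - k)) = \<kappa> k (\<epsilon> / x) * (x ^ k * \<epsilon> ^ (?d - k))"
        using x by (simp add: power_divide)
    qed
    also have "\<dots> = (\<Sum>k=0..?d. \<kappa> k ?g * tile_weight ?d ?g \<epsilon> k x + x ^ k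
        * (extended_coeff G \<kappa> k (\<epsilon> / x) - \<kappa> k ?g) * \<epsilon> ^ (?d - k))"
      using True by (intro sum.cong refl)
        (simp add: tile_weight_def extended_coeff_def min_def algebra_simps)
    finally show ?thesis using True by (simp add: sum.distrib)
  next
    case False
    then have "inner_volume G (\<epsilon> / x) = measure lebesgue G"
      by (intro inradius_bounded_open(2)[OF G]) simp
    also have "\<dots> = inner_volume G ?g" by (rule inradius_bounded_open(2)[OF G order_refl, symmetric])
    also have "\<dots> = (\<Sum>k=0..?d. \<kappa> k ?g * ?g ^ (?d - k))" using g by (intro rep) auto
    finally show ?thesis using False by (simp add: tile_weight_def sum_distrib_left mult_ac)
  qed
qed

text \<open>
  Since the scales are nonincreasing and tend to 0, the indices that contribute to the fluctuations
  form a finite initial segment.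
\<close>

lemma scale_cutoff_set:
  assumes mono: "\<And>i j. 1 \<le> i \<Longrightarrow> i \<le> j \<Longrightarrow> l j \<le> l i" and pos: "\<And>j. 1 \<le> j \<Longrightarrow> l j > (0::real)"
    and \<epsilon>: "\<epsilon> > 0" and lim: "(\<lambda>j. l (Suc j)) \<longlonglongrightarrow> 0" and g: "inradius G > 0"
  shows "{j. 1 \<le> j \<and> \<epsilon> / l j < inradius G} = {1..scale_cutoff l G \<epsilon>}"
proof -
  let ?A = "{j. 1 \<le> j \<and> \<epsilon> / l j < inradius G}"
  have "eventually (\<lambda>j. l (Suc j) < \<epsilon> / inradius G) sequentially"
    using lim \<epsilon> g by (intro order_tendstoD) auto
  then obtain n where n: "\<And>j. j \<ge> n \<Longrightarrow> l (Suc j) < \<epsilon> / inradius G"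
    by (auto simp: eventually_sequentially)
  have "?A \<subseteq> {..n}"
  proof
    fix j assume j: "j \<in> ?A"
    show "j \<in> {..n}"
    proof (rule ccontr)
      assume "j \<notin> {..n}"
      then obtain i where i: "j = Suc i" "i \<ge> n" by (cases j) auto
      have "l j < \<epsilon> / inradius G" using n[OF i(2)] i(1) by simp
      then show False using j g pos[of j] by (auto simp: field_simps)
    qed
  qed
  then have fin: "finite ?A" using finite_subset by blast
  show ?thesis
  proof (intro set_eqI iffI)
    fix j assume "j \<in> ?A"
    then show "j \<in> {1..scale_cutoff l G \<epsilon>}" unfolding scale_cutoff_def using fin
      by (auto intro!: Max_ge)
  next
    fix j assume j: "j \<in> {1..scale_cutoff l G \<epsilon>}"
    have "scale_cutoff l G \<epsilon> \<in> ?A \<union> {0}" unfolding scale_cutoff_def using fin by (intro Max_in) auto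
    then have J: "scale_cutoff l G \<epsilon> \<ge> 1" "\<epsilon> / l (scale_cutoff l G \<epsilon>) < inradius G" using j by auto
    have "l (scale_cutoff l G \<epsilon>) \<le> l j" using j by (intro mono) auto
    then have "\<epsilon> / l j \<le> \<epsilon> / l (scale_cutoff l G \<epsilon>)" using \<epsilon> pos[OF J(1)]
      by (intro divide_left_mono mult_pos_pos) (auto intro: less_le_trans)
    then show "j \<in> ?A" using J j by auto
  qed
qed

lemma fluctuation_sums:
  fixes G :: "'a::euclidean_space set"
  assumes "{j. 1 \<le> j \<and> \<epsilon> / l j < inradius G} = {1..scale_cutoff l G \<epsilon>}"
  shows "(\<lambda>j. if \<epsilon> / l (Suc j) < inradius G
            then \<Sum>k=0..DIM('a). l (Suc j) ^ k
                * (extended_coeff G \<kappa> k (\<epsilon> / l (Suc j)) - \<kappa> k (inradius G))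
                * \<epsilon> ^ (DIM('a) - k) else 0)
         sums (\<Sum>k=0..DIM('a). fluctuation l G \<kappa> k \<epsilon> * \<epsilon> ^ (DIM('a) - k))" (is "?f sums _")
proof -
  let ?J = "scale_cutoff l G \<epsilon>"
  let ?X = "\<lambda>j k. l j ^ k * (extended_coeff G \<kappa> k (\<epsilon> / l j) - \<kappa> k (inradius G)) * \<epsilon> ^ (DIM('a) - k)"
  have iff: "\<epsilon> / l (Suc j) < inradius G \<longleftrightarrow> j < ?J" for j
  proof -
    have "\<epsilon> / l (Suc j) < inradius G \<longleftrightarrow> Suc j \<in> {j. 1 \<le> j \<and> \<epsilon> / l j < inradius G}" by simp
    also have "\<dots> \<longleftrightarrow> j < ?J" unfolding assms by auto
    finally show ?thesis .
  qed
  have "?f sums (\<Sum>j<?J. ?f j)" by (rule sums_finite) (auto simp: iff)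
  also have "(\<Sum>j<?J. ?f j) = (\<Sum>j<?J. \<Sum>k=0..DIM('a). ?X (Suc j) k)"
    by (intro sum.cong refl) (simp add: iff)
  also have "\<dots> = (\<Sum>k=0..DIM('a). \<Sum>j<?J. ?X (Suc j) k)" by (rule sum.swap)
  also have "\<dots> = (\<Sum>k=0..DIM('a). fluctuation l G \<kappa> k \<epsilon> * \<epsilon> ^ (DIM('a) - k))"
    by (simp only: fluctuation_def sum_distrib_right One_nat_def sum.atLeast1_atMost_eq)
  finally show ?thesis .
qed

lemma tube_formula_vertical_line:
  fixes \<Phi> :: "nat \<Rightarrow> 'a::euclidean_space \<Rightarrow> 'a" and G :: "'a set"
  assumes cs: "contractive_similarities N \<Phi> r" and U: "feasible_open_set N \<Phi> U"
    and gen: "generators N \<Phi> U = {G}" and wd: "word_ordering N r wd"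
    and st: "steiner_representation G \<kappa>" and l: "l = (\<lambda>j. word_ratio r (wd j))"
    and \<epsilon>: "\<epsilon> > 0"
    and c: "similarity_dimension N r < c" "real DIM('a) - 1 < c" "c < real DIM('a)"
  defines "E \<equiv> error_integrand (string_zeta N r l) G \<kappa> \<epsilon>"
  shows "screen_integrable (\<lambda>_. c) E"
    and "complex_of_real (inner_volume (\<Union>(tiling N \<Phi> U)) \<epsilon>
        - (\<Sum>k=0..DIM('a). fluctuation l G \<kappa> k \<epsilon> * \<epsilon> ^ (DIM('a) - k)))
       = integer_coeff (string_zeta N r l) G \<kappa> DIM('a) + 1 / (2 * of_real pi * \<i>)
           * screen_integral (\<lambda>_. c) E"
proof -
  let ?d = "DIM('a)" and ?g = "inradius G" and ?\<zeta> = "string_zeta N r l"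
  let ?w = "\<lambda>k j. \<kappa> k ?g * tile_weight ?d ?g \<epsilon> k (l (Suc j))"
  have N: "2 \<le> N" and r: "\<And>n. n \<in> {1..N} \<Longrightarrow> 0 < r n \<and> r n < 1"
    using cs by (auto simp: contractive_similarities_def)
  note G = single_generator_properties[OF cs U gen]
  note Z = string_zeta_properties[OF N r wd l]
  have g: "?g > 0" by (rule inradius_bounded_open(1)[OF G(2-4)])
  have lp: "l j > 0" if "1 \<le> j" for j
  proof -
    have "wd j \<in> lists {1..N}" using wd that by (auto simp: word_ordering_def bij_betw_def)
    then show ?thesis unfolding l using word_ratio_pos[of N r] r by blast
  qed
  then have lpos: "l (Suc j) > 0" for j by simp
  have sm: "summable (\<lambda>j. l (Suc j) powr c)"
    using word_series_sums(2)[OF N r wd l, of "of_real c"] c(1) norm_of_real_powr[OF lpos] by simp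
  have c0: "c > 0" using c(2) DIM_positive[where 'a='a] by linarith
  have lim: "(\<lambda>j. l (Suc j)) \<longlonglongrightarrow> 0"
  proof (rule order_tendstoI)
    show "\<forall>\<^sub>F j in sequentially. a < l (Suc j)" if "a < 0" for a
      using lpos that by (intro always_eventually allI) (auto intro: less_trans)
    fix a :: real assume a: "0 < a"
    have "\<forall>\<^sub>F j in sequentially. l (Suc j) powr c < a powr c"
      using summable_LIMSEQ_zero[OF sm] a by (intro order_tendstoD) auto
    then show "\<forall>\<^sub>F j in sequentially. l (Suc j) < a"
    proof eventually_elim
      case (elim j)
      show ?case
      proof (rule ccontr)
        assume "\<not> l (Suc j) < a"
        then have "a powr c \<le> l (Suc j) powr c" using a c0 by (intro powr_mono2) auto
        then show False using elim by simp
      qed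
    qed
  qed
  have mono: "l j \<le> l i" if "1 \<le> i" "i \<le> j" for i j using wd that
    by (auto simp: word_ordering_def l)
  have cut: "{j. 1 \<le> j \<and> \<epsilon> / l j < ?g} = {1..scale_cutoff l G \<epsilon>}"
    by (rule scale_cutoff_set[OF mono lp \<epsilon> lim g])
  have \<zeta>c: "(\<lambda>j. of_real (l (Suc j)) powr s) sums ?\<zeta> s" if "Re s = c" for s
    using Z(3)[of s] that c(1) by simp
  note I = screen_integral_error_integrand_sums[OF \<epsilon> g c(2,3) lpos sm \<zeta>c, of \<kappa>]
  show "screen_integrable (\<lambda>_. c) E" using I(1) by (simp add: E_def)
  have A: "(\<lambda>j. \<Sum>k=0..?d. ?w k j) sums (inner_volume (\<Union>(tiling N \<Phi> U)) \<epsilon>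
       - (\<Sum>k=0..?d. fluctuation l G \<kappa> k \<epsilon> * \<epsilon> ^ (?d - k)))"
  proof -
    have eq: "(\<Sum>k=0..?d. ?w k j) = l (Suc j) ^ ?d * inner_volume G (\<epsilon> / l (Suc j))
        - (if \<epsilon> / l (Suc j) < ?g then \<Sum>k=0..?d. l (Suc j) ^ k
            * (extended_coeff G \<kappa> k (\<epsilon> / l (Suc j)) - \<kappa> k ?g) * \<epsilon> ^ (?d - k) else 0)" for j
      using steiner_tile[OF G(2-4) st \<epsilon> lpos[of j]] by linarith
    show ?thesis unfolding eq
      by (intro sums_diff inner_volume_tiling_sums[OF cs U gen wd l] fluctuation_sums[OF cut])
  qed
  have split: "(\<Sum>k=0..?d. ?w k j) = (\<Sum>k=0..?d-1. ?w k j) + \<kappa> ?d ?g * l (Suc j) ^ ?d" for j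
  proof -
    have Sd: "Suc (?d - 1) = ?d" using DIM_positive[where 'a='a] by simp
    have "(\<Sum>k=0..?d. ?w k j) = (\<Sum>k=0..?d-1. ?w k j) + ?w ?d j"
      using sum.atLeast0_atMost_Suc[of "\<lambda>k. ?w k j" "?d - 1"] unfolding Sd .
    then show ?thesis by (simp add: tile_weight_def)
  qed
  let ?q = "2 * of_real pi * \<i> :: complex"
  have S1: "(\<lambda>j. complex_of_real (\<Sum>k=0..?d-1. ?w k j)) sums (1 / ?q * screen_integral (\<lambda>_. c) E)"
  proof -
    have "(\<lambda>j. 1 / ?q * (?q * complex_of_real (\<Sum>k=0..?d-1. ?w k j)))
        sums (1 / ?q * screen_integral (\<lambda>_. c) E)"
      unfolding E_def by (rule sums_mult[OF I(2)])
    moreover have "1 / q * (q * x) = x" if "q \<noteq> 0" for q x :: complex using that by simp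
    then have "1 / ?q * (?q * x) = x" for x by simp
    ultimately show ?thesis by (simp only:)
  qed
  have S2: "(\<lambda>j. complex_of_real (\<kappa> ?d ?g * l (Suc j) ^ ?d)) sums integer_coeff ?\<zeta> G \<kappa> ?d"
  proof -
    have "(\<lambda>j. complex_of_real (\<kappa> ?d ?g) * of_real (l (Suc j)) powr of_nat ?d)
        sums (of_real (\<kappa> ?d ?g) * ?\<zeta> (of_nat ?d))"
    proof (intro sums_mult Z(3))
      show "similarity_dimension N r < Re (of_nat ?d)" unfolding complex_Re_of_nat using c
        by linarith
    qed
    moreover have "complex_of_real (l (Suc j)) powr of_nat ?d = of_real (l (Suc j)) ^ ?d" for j
      using lpos[of j] by (simp add: powr_nat')
    ultimately show ?thesis by (simp add: integer_coeff_def)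
  qed
  have "(\<lambda>j. complex_of_real (\<Sum>k=0..?d. ?w k j))
      sums (1 / ?q * screen_integral (\<lambda>_. c) E + integer_coeff ?\<zeta> G \<kappa> ?d)"
    unfolding split of_real_add by (intro sums_add S1 S2)
  moreover have "(\<lambda>j. complex_of_real (\<Sum>k=0..?d. ?w k j))
      sums complex_of_real (inner_volume (\<Union>(tiling N \<Phi> U)) \<epsilon>
       - (\<Sum>k=0..?d. fluctuation l G \<kappa> k \<epsilon> * \<epsilon> ^ (?d - k)))"
    using A by (rule sums_of_real)
  ultimately show "complex_of_real (inner_volume (\<Union>(tiling N \<Phi> U)) \<epsilon>
      - (\<Sum>k=0..?d. fluctuation l G \<kappa> k \<epsilon> * \<epsilon> ^ (?d - k)))
       = integer_coeff ?\<zeta> G \<kappa> ?d + 1 / ?q * screen_integral (\<lambda>_. c) E"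
    using sums_unique2 by (simp only: add.commute) 
qed

section \<open>The tube formula on a screen\<close>

lemma horizontal_integral_tendsto_0:
  fixes G :: "'a::euclidean_space set"
  assumes \<epsilon>: "\<epsilon> > 0" "inradius G > 0" and Sb: "bounded (range S)" and Sc: "\<And>t. S t < c"
    and \<tau>: "filterlim (\<lambda>n. \<bar>\<tau> n\<bar>) at_top sequentially"
    and bnd: "\<And>n \<alpha>. cmod (\<zeta> (Complex \<alpha> (\<tau> n))) \<le> z0"
    and int: "eventually (\<lambda>n. error_integrand \<zeta> G \<kappa> \<epsilon> contour_integrable_on linepath
        (Complex (S (\<tau> n)) (\<tau> n)) (Complex c (\<tau> n))) sequentially"
  shows "(\<lambda>n. contour_integral (linepath (Complex (S (\<tau> n)) (\<tau> n)) (Complex c (\<tau> n)))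
      (error_integrand \<zeta> G \<kappa> \<epsilon>)) \<longlonglongrightarrow> 0"
proof -
  let ?E = "error_integrand \<zeta> G \<kappa> \<epsilon>"
  obtain B where B: "\<And>t. \<bar>S t\<bar> \<le> B" using Sb unfolding bounded_iff by auto
  obtain M where M: "M \<ge> 0" "\<And>s R. - B \<le> Re s \<Longrightarrow> Re s \<le> c \<Longrightarrow> R > 0 \<Longrightarrow>
      (\<And>k. k \<le> DIM('a) \<Longrightarrow> R \<le> cmod (s - of_nat k)) \<Longrightarrow> cmod (tube_kernel G \<kappa> \<epsilon> s) \<le> M / R\<^sup>2"
    by (rule tube_kernel_bound[OF \<epsilon>, of "-B" c \<kappa>]) blast
  have z0: "z0 \<ge> 0" using order_trans[OF norm_ge_zero bnd] .
  define C where "C = z0 * M * (c + B)"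
  have le: "cmod (contour_integral (linepath (Complex (S t) t) (Complex c t)) ?E) \<le> C / \<bar>t\<bar>\<^sup>2"
    if i: "?E contour_integrable_on linepath (Complex (S t) t) (Complex c t)"
      and t: "\<bar>t\<bar> > 0" "t = \<tau> n" for t n
  proof -
    have "cmod (contour_integral (linepath (Complex (S t) t) (Complex c t)) ?E)
        \<le> (z0 * (M / \<bar>t\<bar>\<^sup>2)) * cmod (Complex c t - Complex (S t) t)"
    proof (rule contour_integral_bound_linepath[OF i])
      show "0 \<le> z0 * (M / \<bar>t\<bar>\<^sup>2)" using z0 M by simp
      fix s assume "s \<in> closed_segment (Complex (S t) t) (Complex c t)"
      then have s: "S t \<le> Re s" "Re s \<le> c" "Im s = t"
        unfolding closed_segment_horizontal[OF less_imp_le[OF Sc]] by auto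
      have "cmod (tube_kernel G \<kappa> \<epsilon> s) \<le> M / \<bar>t\<bar>\<^sup>2"
      proof (rule M(2)[OF _ s(2) t(1)])
        show "- B \<le> Re s" using B[of t] s(1) by (auto simp: abs_le_iff)
        show "\<bar>t\<bar> \<le> cmod (s - of_nat k)" for k using abs_Im_le_cmod[of "s - of_nat k"] s(3) by simp
      qed
      moreover have "cmod (\<zeta> s) \<le> z0" using bnd[of "Re s" n] s(3) t(2) by (metis complex_surj)
      ultimately show "cmod (?E s) \<le> z0 * (M / \<bar>t\<bar>\<^sup>2)"
        unfolding error_integrand_eq norm_mult using z0 by (intro mult_mono) auto
    qed
    also have "cmod (Complex c t - Complex (S t) t) \<le> c + B"
    proof -
      have "Complex c t - Complex (S t) t = of_real (c - S t)" by (simp add: complex_eq_iff)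
      then have "cmod (Complex c t - Complex (S t) t) = \<bar>c - S t\<bar>" by (simp only: norm_of_real)
      then show ?thesis using B[of t] Sc[of t] by linarith
    qed
    then have "(z0 * (M / \<bar>t\<bar>\<^sup>2)) * cmod (Complex c t - Complex (S t) t)
        \<le> (z0 * (M / \<bar>t\<bar>\<^sup>2)) * (c + B)"
      using z0 M by (intro mult_left_mono) auto
    also have "\<dots> = C / \<bar>t\<bar>\<^sup>2" by (simp add: C_def)
    finally show ?thesis .
  qed
  have "filterlim (\<lambda>n. \<bar>\<tau> n\<bar>\<^sup>2) at_top sequentially"
    by (rule filterlim_pow_at_top[OF _ \<tau>]) simp
  then have lim: "(\<lambda>n. C / \<bar>\<tau> n\<bar>\<^sup>2) \<longlonglongrightarrow> 0"
    by (intro tendsto_divide_0[OF tendsto_const] filterlim_at_top_imp_at_infinity)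
  have ev: "eventually (\<lambda>n. \<bar>\<tau> n\<bar> > 0) sequentially" using \<tau> unfolding filterlim_at_top_dense
    by blast
  show ?thesis
  proof (rule Lim_null_comparison[OF _ lim])
    show "\<forall>\<^sub>F n in sequentially. norm
        (contour_integral (linepath (Complex (S (\<tau> n)) (\<tau> n)) (Complex c (\<tau> n))) ?E) \<le> C / \<bar>\<tau> n\<bar>\<^sup>2"
      using int ev by eventually_elim (rule le[OF _ _ refl])
  qed
qed

lemma error_integrand_screen_integrable:
  fixes G :: "'a::euclidean_space set"
  assumes \<zeta>: "\<zeta> nicely_meromorphic_on UNIV" and scr: "screen \<zeta> D S"
    and S0: "\<And>k. k \<le> DIM('a) \<Longrightarrow> S 0 \<noteq> real k" and \<epsilon>: "\<epsilon> > 0" "inradius G > 0"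
    and b: "bounded (range (\<lambda>t. \<zeta> (Complex (S t) t)))"
  shows "screen_integrable S (error_integrand \<zeta> G \<kappa> \<epsilon>)"
proof -
  obtain L where S: "L-lipschitz_on UNIV S" using scr by (auto simp: screen_def)
  have Sb: "bounded (range S)" and Sp: "\<not> is_pole \<zeta> (Complex (S t) t)" for t
    using scr by (auto simp: screen_def)
  obtain z0 where z0: "\<And>t. cmod (\<zeta> (Complex (S t) t)) \<le> z0" using b unfolding bounded_iff by auto
  obtain C where C: "C \<ge> 0" "\<And>t. cmod (tube_kernel G \<kappa> \<epsilon> (Complex (S t) t)) \<le> C / (1 + t\<^sup>2)"
    by (rule tube_kernel_graph_bound[OF \<epsilon> S Sb S0]) blast+
  show ?thesis
  proof (rule screen_integrable_bound[OF S])
    have an: "error_integrand \<zeta> G \<kappa> \<epsilon> analytic_on {Complex (S t) t}" for t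
    proof -
      have "Complex (S t) t \<notin> of_nat ` {0..DIM('a)}"
      proof
        assume "Complex (S t) t \<in> of_nat ` {0..DIM('a)}"
        then obtain k where k: "k \<le> DIM('a)" "Complex (S t) t = of_nat k" by auto
        have t: "t = 0" using arg_cong[OF k(2), of Im] by simp
        have St: "S t = real k" using arg_cong[OF k(2), of Re] by simp
        show False using St S0[OF k(1)] unfolding t by (rule notE[rotated])
      qed
      then show ?thesis unfolding error_integrand_eq[abs_def]
        by (intro analytic_on_mult nicely_meromorphic_on_imp_analytic_at[OF \<zeta> _ Sp]
          tube_kernel_analytic \<epsilon>) auto
    qed
    then show "continuous_on UNIV (\<lambda>t. error_integrand \<zeta> G \<kappa> \<epsilon> (Complex (S t) t))"
      by (rule continuous_on_graph_analytic[OF S])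
    fix t :: real
    have "0 \<le> z0" using order_trans[OF norm_ge_zero z0] .
    then have "cmod (error_integrand \<zeta> G \<kappa> \<epsilon> (Complex (S t) t)) \<le> z0 * (C / (1 + t\<^sup>2))"
      unfolding error_integrand_eq norm_mult using z0[of t] C(2)[of t] by (intro mult_mono) auto
    then show "cmod (error_integrand \<zeta> G \<kappa> \<epsilon> (Complex (S t) t)) \<le> (z0 * C) / (1 + t\<^sup>2)" by simp
  qed
qed

lemma error_integrand_dims_expansion:
  fixes G :: "'a::euclidean_space set" and \<kappa> :: "nat \<Rightarrow> real \<Rightarrow> real"
  assumes \<zeta>: "\<zeta> nicely_meromorphic_on UNIV" and \<zeta>D: "\<And>s. D < Re s \<Longrightarrow> \<zeta> analytic_on {s}"
    and T: "languid_heights \<zeta> T"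
    and scr: "screen \<zeta> D S" and simple: "simple_visible_poles \<zeta> DIM('a) S"
    and S0: "\<And>k. k \<le> DIM('a) \<Longrightarrow> S 0 \<noteq> real k"
    and c: "D < c" "real DIM('a) - 1 < c" "c < real DIM('a)"
    and \<epsilon>: "\<epsilon> > 0" "inradius G > 0"
    and ci: "screen_integrable (\<lambda>_. c) (error_integrand \<zeta> G \<kappa> \<epsilon>)"
  shows "dims_expansion \<zeta> T S (visible_dims \<zeta> S)
     (\<lambda>\<omega>. dim_coeff \<zeta> G \<kappa> \<omega> * of_real \<epsilon> powr (of_nat DIM('a) - \<omega>))
     (error_integrand \<zeta> G \<kappa> \<epsilon>)
     (1 / (2 * of_real pi * \<i>) * screen_integral (\<lambda>_. c) (error_integrand \<zeta> G \<kappa> \<epsilon>)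
      - (\<Sum>k\<in>visible_integer_dims DIM('a) S - {DIM('a)}. integer_coeff \<zeta> G \<kappa> k
          * of_real \<epsilon> ^ (DIM('a) - k)))"
    (is "dims_expansion \<zeta> T S ?P ?a ?E ?v")
proof -
  obtain z0 where z0: "\<And>n \<alpha>. cmod (\<zeta> (Complex \<alpha> (T n))) \<le> z0" using T
    by (auto simp: languid_heights_def)
  have Tpos: "T (- n) < 0" "0 < T n" if "n \<ge> 1" for n using T that
    by (auto simp: languid_heights_def)
  have Ttop: "filterlim (\<lambda>n. T (int n)) at_top sequentially"
    and Tbot: "filterlim (\<lambda>n. T (- int n)) at_bot sequentially"
    using T by (auto simp: languid_heights_def)
  have Sb: "bounded (range S)" using scr by (simp add: screen_def)
  have Sc: "S t < c" for t using scr c by (auto simp: screen_def intro: le_less_trans)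
  let ?q = "2 * of_real pi * \<i> :: complex"
  let ?K = "\<Sum>k\<in>visible_integer_dims DIM('a) S - {DIM('a)}. integer_coeff \<zeta> G \<kappa> k
      * of_real \<epsilon> ^ (DIM('a) - k)"
  let ?h = "\<lambda>t. contour_integral (linepath (Complex (S t) t) (Complex c t)) ?E"
  have R: "graph_boundary_integrable ?E S c (T (- int n)) (T (int n))"
     "graph_boundary_integral ?E S c (T (- int n)) (T (int n))
         = ?q * (truncated_dims_sum T ?P ?a n + ?K)" if n: "n \<ge> 1" for n
  proof -
    have ab: "T (- int n) < 0" "0 < T (int n)" using Tpos[of "int n"] n by auto
    have b: "cmod (\<zeta> (Complex \<alpha> t)) \<le> z0" if "t = T (- int n) \<or> t = T (int n)" for t \<alpha> using that z0
      by auto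
    show "graph_boundary_integrable ?E S c (T (- int n)) (T (int n))"
      using error_integrand_graph_residues(1)[OF \<zeta> \<zeta>D scr simple S0 c ab b \<epsilon>] by blast
    show "graph_boundary_integral ?E S c (T (- int n)) (T (int n))
        = ?q * (truncated_dims_sum T ?P ?a n + ?K)"
      using error_integrand_graph_residues(2)[OF \<zeta> \<zeta>D scr simple S0 c ab b \<epsilon>]
        unfolding truncated_dims_sum_def by blast
  qed
  have ev1: "eventually (\<lambda>n::nat. n \<ge> 1) sequentially" by (rule eventually_ge_at_top)
  have h1: "(\<lambda>n. ?h (T (int n))) \<longlonglongrightarrow> 0"
  proof (rule horizontal_integral_tendsto_0[OF \<epsilon> Sb Sc])
    show "filterlim (\<lambda>n. \<bar>T (int n)\<bar>) at_top sequentially"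
      by (rule filterlim_at_top_mono[OF Ttop]) (intro always_eventually allI abs_ge_self)
    show "eventually (\<lambda>n. ?E contour_integrable_on linepath (Complex (S (T (int n))) (T (int n)))
        (Complex c (T (int n)))) sequentially"
      using ev1 by eventually_elim (use R(1) in \<open>simp add: graph_boundary_integrable_def\<close>)
  qed (rule z0)
  have h2: "(\<lambda>n. ?h (T (- int n))) \<longlonglongrightarrow> 0"
  proof (rule horizontal_integral_tendsto_0[OF \<epsilon> Sb Sc])
    have "filterlim (\<lambda>n. - T (- int n)) at_top sequentially" using Tbot
      by (simp add: filterlim_uminus_at_bot)
    then show "filterlim (\<lambda>n. \<bar>T (- int n)\<bar>) at_top sequentially"
      by (rule filterlim_at_top_mono) (intro always_eventually allI abs_ge_minus_self)
    show "eventually (\<lambda>n. ?E contour_integrable_on linepath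
        (Complex (S (T (- int n))) (T (- int n))) (Complex c (T (- int n)))) sequentially"
      using ev1 by eventually_elim (use R(1) in \<open>simp add: graph_boundary_integrable_def\<close>)
  qed (rule z0)
  have h3: "(\<lambda>n. truncated_screen_integral (T (- int n)) (T (int n)) (\<lambda>_. c) ?E)
      \<longlonglongrightarrow> screen_integral (\<lambda>_. c) ?E"
    by (rule truncated_screen_integral_LIMSEQ[OF ci Tbot Ttop])
  have lim: "(\<lambda>n. 1 / ?q * (truncated_screen_integral (T (- int n)) (T (int n)) (\<lambda>_. c) ?E
      + ?h (T (- int n)) - ?h (T (int n))) - ?K)
      \<longlonglongrightarrow> 1 / ?q * (screen_integral (\<lambda>_. c) ?E + 0 - 0) - ?K"
    by (intro tendsto_intros h1 h2 h3)
  have eq: "1 / ?q * (truncated_screen_integral (T (- int n)) (T (int n)) (\<lambda>_. c) ?E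
      + ?h (T (- int n)) - ?h (T (int n))) - ?K
     = truncated_dims_sum T ?P ?a n + 1 / ?q
         * truncated_screen_integral (T (- int n)) (T (int n)) S ?E" if n: "n \<ge> 1" for n
  proof -
    have alg: "1 / q * (I + u - w) - k = x + 1 / q * y" if "I - y + u - w = q * (x + k)" "q \<noteq> 0"
      for I y u w q x k :: complex
    proof -
      have "I + u - w = q * (x + k) + y" using that(1) by (simp add: algebra_simps)
      then show ?thesis using that(2) by (simp add: field_simps)
    qed
    show ?thesis by (rule alg[OF R(2)[OF n, unfolded graph_boundary_integral_def]]) simp
  qed
  have main: "(\<lambda>n. truncated_dims_sum T ?P ?a n + 1 / ?q
      * truncated_screen_integral (T (- int n)) (T (int n)) S ?E) \<longlonglongrightarrow> ?v"
  proof (rule Lim_transform_eventually)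
    show "(\<lambda>n. 1 / ?q * (truncated_screen_integral (T (- int n)) (T (int n)) (\<lambda>_. c) ?E
        + ?h (T (- int n)) - ?h (T (int n))) - ?K) \<longlonglongrightarrow> ?v"
      using lim by (simp only: add_0_right diff_0_right)
    show "\<forall>\<^sub>F n in sequentially. 1 / ?q
        * (truncated_screen_integral (T (- int n)) (T (int n)) (\<lambda>_. c) ?E + ?h (T (- int n))
        - ?h (T (int n))) - ?K
     = truncated_dims_sum T ?P ?a n + 1 / ?q
         * truncated_screen_integral (T (- int n)) (T (int n)) S ?E"
      using ev1 by eventually_elim (rule eq)
  qed
  show ?thesis unfolding dims_expansion_def
  proof (intro conjI impI)
    show "screen_integrable S ?E" if "bounded (range (\<lambda>t. \<zeta> (Complex (S t) t)))"
      by (rule error_integrand_screen_integrable[OF \<zeta> scr S0 \<epsilon> that])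
    show "truncated_dims_sum T ?P ?a \<longlonglongrightarrow> ?v - 1 / ?q * screen_integral S ?E"
      if i: "screen_integrable S ?E"
    proof -
      have "(\<lambda>n. (truncated_dims_sum T ?P ?a n + 1 / ?q
          * truncated_screen_integral (T (- int n)) (T (int n)) S ?E)
          - 1 / ?q * truncated_screen_integral (T (- int n)) (T (int n)) S ?E)
              \<longlonglongrightarrow> ?v - 1 / ?q * screen_integral S ?E"
        by (intro tendsto_diff main tendsto_mult tendsto_const
          truncated_screen_integral_LIMSEQ[OF i Tbot Ttop])
      then show ?thesis by (simp only: add_diff_cancel_right')
    qed
    show "(\<lambda>n. truncated_dims_sum T ?P ?a n + 1 / ?q
        * truncated_screen_integral (T (- int n)) (T (int n)) S ?E) \<longlonglongrightarrow> ?v"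
      by (rule main)
  qed
qed

lemma dims_expansion_cong:
  assumes "\<And>t. f (Complex (S t) t) = g (Complex (S t) t)"
  shows "dims_expansion \<zeta> T S P a f v \<longleftrightarrow> dims_expansion \<zeta> T S P a g v"
proof -
  have "screen_integrand S f = screen_integrand S g" using assms
    by (simp add: screen_integrand_def fun_eq_iff)
  then show ?thesis
    by (simp add: dims_expansion_def screen_integrable_def screen_integral_def
      truncated_screen_integral_def)
qed

text \<open>
  With \<open>\<lambda>(G) = \<Sum>\<^sub>k \<kappa>\<^sub>k g\<^sup>d\<^sup>-\<^sup>k\<close>, the identity \<open>1/(s-k) - 1/(s-d) = (d-k) / ((s-k)(d-s))\<close> turns the bracket in
  the tubular zeta function into the sum in the error term; the index \<open>k = d\<close> cancels.
\<close>

lemma steiner_bracket: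
  fixes z :: complex and g :: real and x :: "nat \<Rightarrow> real"
  assumes g: "g > 0" and z: "z \<notin> of_nat ` {0..d}"
  shows "(\<Sum>k=0..d. of_real g powr (z - of_nat k) / (z - of_nat k) * of_real (x k))
      - of_real g powr (z - of_nat d) / (z - of_nat d) * of_real (\<Sum>k=0..d. x k * g ^ (d - k))
     = (\<Sum>k=0..d-1. of_real g powr (z - of_nat k) / (z - of_nat k) * of_nat (d - k) * of_real (x k))
         / (of_nat d - z)"
proof -
  let ?p = "\<lambda>k. complex_of_real g powr (z - of_nat k)" and ?x = "\<lambda>k. complex_of_real (x k)"
  have zk: "z - of_nat k \<noteq> 0" if "k \<le> d" for k using z that by auto
  have pg: "?p d * of_real g ^ (d - k) = ?p k" if "k \<le> d" for k
  proof -
    have e: "z - of_nat k = (z - of_nat d) + of_nat (d - k)" using that by (simp add: of_nat_diff)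
    have "complex_of_real g powr of_nat (d - k) = of_real g ^ (d - k)" using g
      by (simp add: powr_nat')
    then show ?thesis unfolding e powr_add by (simp only:)
  qed
  have step: "?p k / (z - of_nat k) * ?x k - ?p d / (z - of_nat d) * of_real (x k * g ^ (d - k))
      = ?p k / (z - of_nat k) * of_nat (d - k) * ?x k / (of_nat d - z)" if k: "k \<le> d" for k
  proof -
    have alg: "p / u * y - p / w * y = p / u * (u - w) * y / (- w)" if "u \<noteq> 0" "w \<noteq> 0"
      for p y u w :: complex
      using that by (simp add: field_simps)
    have "?p d / (z - of_nat d) * of_real (x k * g ^ (d - k))
        = (?p d * of_real g ^ (d - k)) / (z - of_nat d) * ?x k"
      by simp
    also have "\<dots> = ?p k / (z - of_nat d) * ?x k" unfolding pg[OF k] ..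
    finally have 1: "?p d / (z - of_nat d) * of_real (x k * g ^ (d - k))
        = ?p k / (z - of_nat d) * ?x k" .
    have 2: "complex_of_nat (d - k) = (z - of_nat k) - (z - of_nat d)"
      "of_nat d - z = - (z - of_nat d)"
      using k by (simp_all add: of_nat_diff)
    show ?thesis unfolding 1 2 by (rule alg[OF zk[OF k] zk[OF order_refl]])
  qed
  have "(\<Sum>k=0..d. ?p k / (z - of_nat k) * ?x k) - ?p d / (z - of_nat d)
      * of_real (\<Sum>k=0..d. x k * g ^ (d - k))
      = (\<Sum>k=0..d. ?p k / (z - of_nat k) * ?x k - ?p d / (z - of_nat d)
          * of_real (x k * g ^ (d - k)))"
    unfolding of_real_sum sum_distrib_left sum_subtractf ..
  also have "\<dots> = (\<Sum>k=0..d. ?p k / (z - of_nat k) * of_nat (d - k) * ?x k / (of_nat d - z))"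
    by (intro sum.cong refl step) simp
  also have "\<dots> = (\<Sum>k=0..d-1. ?p k / (z - of_nat k) * of_nat (d - k) * ?x k / (of_nat d - z))"
  proof (rule sum.mono_neutral_right)
    show "\<forall>i\<in>{0..d} - {0..d - 1}. ?p i / (z - of_nat i) * of_nat (d - i) * ?x i / (of_nat d - z)
        = 0"
    proof
      fix i assume "i \<in> {0..d} - {0..d - 1}"
      then have "d - i = 0" by auto
      then show "?p i / (z - of_nat i) * of_nat (d - i) * ?x i / (of_nat d - z) = 0"
        by (simp only: of_nat_0 mult_zero_right mult_zero_left div_0)
    qed
  qed auto
  finally show ?thesis by (simp only: sum_divide_distrib)
qed

lemma tubular_zeta_eq_error_integrand:
  fixes G :: "'a::euclidean_space set"
  assumes N: "2 \<le> N" and r: "\<And>n. n \<in> {1..N} \<Longrightarrow> 0 < r n \<and> r n < 1"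
    and wd: "word_ordering N r wd" and l: "l = (\<lambda>j. word_ratio r (wd j))"
    and G: "open G" "bounded G" "G \<noteq> {}" and mono: "monophase_representation G \<kappa>" and \<epsilon>: "\<epsilon> > 0"
    and s: "\<not> is_pole (string_zeta N r l) s" "s \<notin> of_nat ` {0..DIM('a)}"
  shows "tubular_zeta N r l G \<kappa> \<epsilon> s = error_integrand (string_zeta N r l) G \<kappa> \<epsilon> s"
proof -
  let ?d = "DIM('a)" and ?g = "inradius G" and ?\<zeta> = "string_zeta N r l"
    and ?D = "similarity_dimension N r"
  note Z = string_zeta_properties[OF N r wd l]
  have g: "?g > 0" by (rule inradius_bounded_open(1)[OF G])
  have lpos: "l (Suc j) > 0" for j
  proof -
    have "wd (Suc j) \<in> lists {1..N}" using wd by (auto simp: word_ordering_def bij_betw_def)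
    then show ?thesis unfolding l using word_ratio_pos[of N r] r by blast
  qed
  have coeff: "extended_coeff G \<kappa> k (\<epsilon> / l (Suc j)) = \<kappa> k ?g" if "k \<le> ?d" for k j
  proof -
    have "min (\<epsilon> / l (Suc j)) ?g \<in> {0<..?g}" using g \<epsilon> lpos[of j] by auto
    then show ?thesis using mono that unfolding monophase_representation_def extended_coeff_def
      by blast
  qed
  have vol: "measure lebesgue G = (\<Sum>k=0..?d. \<kappa> k ?g * ?g ^ (?d - k))"
  proof -
    have "\<forall>e\<in>{0<..?g}. inner_volume G e = (\<Sum>k=0..?d. \<kappa> k e * e ^ (?d - k))"
      using mono unfolding monophase_representation_def steiner_representation_def by (elim conjE)
    then have "inner_volume G ?g = (\<Sum>k=0..?d. \<kappa> k ?g * ?g ^ (?d - k))"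
      by (rule bspec) (use g in simp)
    then show ?thesis unfolding inradius_bounded_open(2)[OF G order_refl] .
  qed
  let ?E = "error_integrand ?\<zeta> G \<kappa> \<epsilon>"
  have Em: "?E meromorphic_on UNIV"
    unfolding error_integrand_eq[abs_def] using Z(1)
    by (intro meromorphic_on_mult tube_kernel_meromorphic \<epsilon> g)
      (auto simp: nicely_meromorphic_on_def)
  have Ean: "?E analytic_on {z}" if "\<not> is_pole ?\<zeta> z" "z \<notin> of_nat ` {0..?d}" for z
    unfolding error_integrand_eq[abs_def]
    by (intro analytic_on_mult nicely_meromorphic_on_imp_analytic_at[OF Z(1) _ that(1)]
      tube_kernel_analytic \<epsilon> g that(2)) auto
  have br: "(\<Sum>k=0..?d. of_real ?g powr (z - of_nat k) / (z - of_nat k) * of_real (\<kappa> k ?g))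
      - of_real ?g powr (z - of_nat ?d) / (z - of_nat ?d) * of_real (measure lebesgue G)
     = (\<Sum>k=0..?d-1. of_real ?g powr (z - of_nat k) / (z - of_nat k) * of_nat (?d - k)
         * of_real (\<kappa> k ?g)) / (of_nat ?d - z)"
    if z: "z \<notin> of_nat ` {0..?d}" for z :: complex
    unfolding vol by (rule steiner_bracket[OF g z])
  have "tubular_zeta N r l G \<kappa> \<epsilon> = remove_sings ?E"
    unfolding tubular_zeta_def
  proof (rule meromorphic_extension_eqI)
    show "remove_sings ?E nicely_meromorphic_on UNIV" using Em
      by (rule remove_sings_nicely_meromorphic)
    have "open ({s. ?D < Re s} - of_nat ` {0..?d})"
      by (intro open_Diff open_halfspace_Re_gt finite_imp_closed) auto
    moreover have "complex_of_real (max ?D ?d + 1) \<in> {s. ?D < Re s} - of_nat ` {0..?d}"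
      by (auto simp: complex_eq_iff max_def)
    ultimately show "eventually (\<lambda>s. s \<in> {s. ?D < Re s} - of_nat ` {0..?d})
        (at (of_real (max ?D ?d + 1)))"
      by (rule eventually_at_in_open')
    fix z assume z: "z \<in> {s. ?D < Re s} - of_nat ` {0..?d}"
    have np: "\<not> is_pole ?\<zeta> z" using Z(2)[of z] z analytic_at_imp_no_pole by blast
    have sm: "(\<lambda>j. complex_of_real (l (Suc j)) powr z) sums ?\<zeta> z" using Z(3)[of z] z by simp
    have cs: "(\<Sum>k=0..?d. of_real ?g powr (z - of_nat k) / (z - of_nat k)
        * of_real (extended_coeff G \<kappa> k (\<epsilon> / l (Suc j))))
        = (\<Sum>k=0..?d. of_real ?g powr (z - of_nat k) / (z - of_nat k) * of_real (\<kappa> k ?g))" for j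
      by (intro sum.cong refl) (simp add: coeff)
    have zi: "z \<notin> of_nat ` {0..?d}" using z by blast
    have alg: "p * (q * (x / e)) = p * q / e * x" for p q x e :: complex
      by (simp only: times_divide_eq_left times_divide_eq_right mult.assoc)
    show "remove_sings ?E z = of_real \<epsilon> powr (of_nat ?d - z) *
          (\<Sum>j. of_real (l (Suc j)) powr z
              * ((\<Sum>k=0..?d. of_real ?g powr (z - of_nat k) / (z - of_nat k)
              * of_real (extended_coeff G \<kappa> k (\<epsilon> / l (Suc j))))
          - of_real ?g powr (z - of_nat ?d) / (z - of_nat ?d) * of_real (measure lebesgue G)))"
      unfolding cs br[OF zi] sums_unique[OF sums_mult2[OF sm], symmetric]
        remove_sings_at_analytic[OF Ean[OF np zi]] error_integrand_def alg ..
  qed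
  then show ?thesis using remove_sings_at_analytic[OF Ean[OF s]] by simp
qed

text \<open>
  The last hypothesis lets both parts of the theorem be treated together: if \<open>S 0 < 0\<close>, all integers
  \<open>0, \<dots>, d\<close> are visible, and in the monophase case all fluctuations vanish.
\<close>

lemma tube_formula_screen:
  fixes \<Phi> :: "nat \<Rightarrow> 'a::euclidean_space \<Rightarrow> 'a" and G :: "'a set"
  assumes cs: "contractive_similarities N \<Phi> r" and U: "feasible_open_set N \<Phi> U"
    and gen: "generators N \<Phi> U = {G}" and wd: "word_ordering N r wd"
    and st: "steiner_representation G \<kappa>" and l: "l = (\<lambda>j. word_ratio r (wd j))"
    and T: "languid_heights (string_zeta N r l) T"
    and scr: "screen (string_zeta N r l) (similarity_dimension N r) S"
    and simple: "simple_visible_poles (string_zeta N r l) DIM('a) S"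
    and S0: "\<And>k. k \<le> DIM('a) \<Longrightarrow> S 0 \<noteq> real k" and \<epsilon>: "\<epsilon> > 0"
    and fl: "\<And>k. k \<le> DIM('a) \<Longrightarrow> k \<notin> visible_integer_dims DIM('a) S \<Longrightarrow> fluctuation l G \<kappa> k \<epsilon> = 0"
  shows "dims_expansion (string_zeta N r l) T S (visible_dims (string_zeta N r l) S)
          (\<lambda>\<omega>. dim_coeff (string_zeta N r l) G \<kappa> \<omega> * of_real \<epsilon> powr (of_nat DIM('a) - \<omega>))
          (error_integrand (string_zeta N r l) G \<kappa> \<epsilon>)
          (of_real (inner_volume (\<Union>(tiling N \<Phi> U)) \<epsilon>)
           - (\<Sum>k\<in>visible_integer_dims DIM('a) S.
                (integer_coeff (string_zeta N r l) G \<kappa> k + of_real (fluctuation l G \<kappa> k \<epsilon>))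
                    * of_real \<epsilon> ^ (DIM('a) - k)))"
proof -
  let ?d = "DIM('a)" and ?\<zeta> = "string_zeta N r l" and ?D = "similarity_dimension N r"
  let ?V = "visible_integer_dims ?d S"
  have N: "2 \<le> N" and r: "\<And>n. n \<in> {1..N} \<Longrightarrow> 0 < r n \<and> r n < 1"
    using cs by (auto simp: contractive_similarities_def)
  note G = single_generator_properties[OF cs U gen]
  note Z = string_zeta_properties[OF N r wd l]
  have g: "inradius G > 0" by (rule inradius_bounded_open(1)[OF G(2-4)])
  have Dd: "?D < real ?d"
    using moran_sum_dim_less_1[OF cs U gen] similarity_dimension_properties(2)[where N=N
      and r=r, OF N r] by blast
  \<comment> \<open>Any abscissa strictly between \<open>max D (d-1)\<close> and \<open>d\<close> would do.\<close>
  define c where "c = (max ?D (real ?d - 1) + real ?d) / 2"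
  have c: "?D < c" "real ?d - 1 < c" "c < real ?d" using Dd by (auto simp: c_def max_def)
  note M = tube_formula_vertical_line[OF cs U gen wd st l \<epsilon> c]
  have dV: "?d \<in> ?V" using scr Dd
    by (auto simp: visible_integer_dims_def window_def screen_def intro: order_trans less_imp_le)
  have Vsub: "?V \<subseteq> {0..?d}" by (auto simp: visible_integer_dims_def)
  then have finV: "finite ?V" using finite_subset by blast
  let ?e = "\<lambda>k. complex_of_real \<epsilon> ^ (?d - k)"
  have "(\<Sum>k\<in>?V. (integer_coeff ?\<zeta> G \<kappa> k + of_real (fluctuation l G \<kappa> k \<epsilon>)) * ?e k)
     = (\<Sum>k\<in>?V. integer_coeff ?\<zeta> G \<kappa> k * ?e k) + (\<Sum>k\<in>?V. of_real (fluctuation l G \<kappa> k \<epsilon>) * ?e k)"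
    by (simp add: distrib_right sum.distrib)
  also have "(\<Sum>k\<in>?V. integer_coeff ?\<zeta> G \<kappa> k * ?e k)
      = integer_coeff ?\<zeta> G \<kappa> ?d + (\<Sum>k\<in>?V - {?d}. integer_coeff ?\<zeta> G \<kappa> k * ?e k)"
    using finV dV by (simp add: sum.remove)
  also have "(\<Sum>k\<in>?V. of_real (fluctuation l G \<kappa> k \<epsilon>) * ?e k)
      = (\<Sum>k=0..?d. of_real (fluctuation l G \<kappa> k \<epsilon>) * ?e k)"
    using Vsub fl by (intro sum.mono_neutral_left) auto
  also have "\<dots> = complex_of_real (\<Sum>k=0..?d. fluctuation l G \<kappa> k \<epsilon> * \<epsilon> ^ (?d - k))" by simp
  finally have eq: "of_real (inner_volume (\<Union>(tiling N \<Phi> U)) \<epsilon>)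
      - (\<Sum>k\<in>?V. (integer_coeff ?\<zeta> G \<kappa> k + of_real (fluctuation l G \<kappa> k \<epsilon>)) * ?e k)
     = 1 / (2 * of_real pi * \<i>) * screen_integral (\<lambda>_. c) (error_integrand ?\<zeta> G \<kappa> \<epsilon>)
      - (\<Sum>k\<in>?V - {?d}. integer_coeff ?\<zeta> G \<kappa> k * ?e k)"
    using M(2) unfolding of_real_diff by (simp add: algebra_simps)
  show ?thesis unfolding eq
    by (rule error_integrand_dims_expansion[OF Z(1,2) T scr simple S0 c \<epsilon> g M(1)])
qed

lemma monophase_fluctuation_eq_0:
  fixes G :: "'a::euclidean_space set"
  assumes mono: "monophase_representation G \<kappa>" and g: "inradius G > 0" and k: "k \<le> DIM('a)"
    and \<epsilon>: "\<epsilon> > 0" and l: "\<And>j. 1 \<le> j \<Longrightarrow> l j > 0"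
  shows "fluctuation l G \<kappa> k \<epsilon> = 0"
  unfolding fluctuation_def
proof (rule sum.neutral, rule ballI)
  fix j assume "j \<in> {1..scale_cutoff l G \<epsilon>}"
  then have "min (\<epsilon> / l j) (inradius G) \<in> {0<..inradius G}" using g \<epsilon> l[of j] by auto
  then have "extended_coeff G \<kappa> k (\<epsilon> / l j) = \<kappa> k (inradius G)"
    using mono k unfolding monophase_representation_def extended_coeff_def by blast
  then show "l j ^ k * (extended_coeff G \<kappa> k (\<epsilon> / l j) - \<kappa> k (inradius G)) = 0" by simp
qed

theorem corollary5p13:
  fixes \<Phi> :: "nat \<Rightarrow> 'a::euclidean_space \<Rightarrow> 'a"
    and U G :: "'a set"
    and N d :: nat
    and r l :: "nat \<Rightarrow> real"
    and wd :: "nat \<Rightarrow> nat list"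
    and \<kappa> :: "nat \<Rightarrow> real \<Rightarrow> real"
    and T :: "int \<Rightarrow> real"
    and D :: real
    and \<zeta> :: "complex \<Rightarrow> complex"
  assumes "contractive_similarities N \<Phi> r"
    and "nontriviality_condition N \<Phi>"
    and "feasible_open_set N \<Phi> U"
    and "generators N \<Phi> U = {G}"
    and "word_ordering N r wd"
    and "steiner_representation G \<kappa>"
    and d: "d = DIM('a)"
    and D: "D = similarity_dimension N r"
    and l: "l = (\<lambda>j. word_ratio r (wd j))"
    and \<zeta>: "\<zeta> = string_zeta N r l"
    and "languid_heights \<zeta> T"
  shows
    "(\<forall>S. screen \<zeta> D S \<and> S 0 < 0 \<and> simple_visible_poles \<zeta> d S \<longrightarrow>
       (\<forall>\<epsilon>>0. dims_expansion \<zeta> T S (visible_dims \<zeta> S)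
          (\<lambda>\<omega>. dim_coeff \<zeta> G \<kappa> \<omega> * of_real \<epsilon> powr (of_nat d - \<omega>))
          (error_integrand \<zeta> G \<kappa> \<epsilon>)
          (of_real (inner_volume (\<Union>(tiling N \<Phi> U)) \<epsilon>)
           - (\<Sum>k\<in>visible_integer_dims d S.
                (integer_coeff \<zeta> G \<kappa> k + of_real (fluctuation l G \<kappa> k \<epsilon>)) * of_real \<epsilon> ^ (d - k)))))
     \<and>
     (monophase_representation G \<kappa> \<longrightarrow>
     (\<forall>S. screen \<zeta> D S \<and> (\<forall>k\<in>{0..d}. S 0 \<noteq> real k) \<and> simple_visible_poles \<zeta> d S \<longrightarrow>
       (\<forall>\<epsilon>>0.
          dims_expansion \<zeta> T S (visible_dims \<zeta> S)
          (\<lambda>\<omega>. dim_coeff \<zeta> G \<kappa> \<omega> * of_real \<epsilon> powr (of_nat d - \<omega>))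
          (error_integrand \<zeta> G \<kappa> \<epsilon>)
          (of_real (inner_volume (\<Union>(tiling N \<Phi> U)) \<epsilon>)
           - (\<Sum>k\<in>visible_integer_dims d S.
                (integer_coeff \<zeta> G \<kappa> k + of_real (fluctuation l G \<kappa> k \<epsilon>)) * of_real \<epsilon> ^ (d - k)))
        \<and> dims_expansion \<zeta> T S (visible_dims \<zeta> S)
          (\<lambda>\<omega>. dim_coeff \<zeta> G \<kappa> \<omega> * of_real \<epsilon> powr (of_nat d - \<omega>))
          (tubular_zeta N r l G \<kappa> \<epsilon>)
          (of_real (inner_volume (\<Union>(tiling N \<Phi> U)) \<epsilon>)
           - (\<Sum>k\<in>visible_integer_dims d S. integer_coeff \<zeta> G \<kappa> k * of_real \<epsilon> ^ (d - k))))))"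
proof -
  note cs = assms(1) and U = assms(3) and gen = assms(4) and wd = assms(5) and st = assms(6)
    and T = assms(11)
  note G = single_generator_properties[OF cs U gen]
  have g: "inradius G > 0" by (rule inradius_bounded_open(1)[OF G(2-4)])
  have N: "2 \<le> N" and r: "\<And>n. n \<in> {1..N} \<Longrightarrow> 0 < r n \<and> r n < 1"
    using cs by (auto simp: contractive_similarities_def)
  have lp: "l j > 0" if "1 \<le> j" for j
  proof -
    have "wd j \<in> lists {1..N}" using wd that by (auto simp: word_ordering_def bij_betw_def)
    then show ?thesis unfolding l using word_ratio_pos[of N r] r by blast
  qed
  note expansion = tube_formula_screen[OF cs U gen wd st l T[unfolded \<zeta>], folded \<zeta> D d]
  let ?coeff = "\<lambda>\<epsilon> \<omega>. dim_coeff \<zeta> G \<kappa> \<omega> * of_real \<epsilon> powr (of_nat d - \<omega>)"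
  let ?formula = "\<lambda>S \<epsilon>. dims_expansion \<zeta> T S (visible_dims \<zeta> S) (?coeff \<epsilon>) (error_integrand \<zeta> G \<kappa> \<epsilon>)
      (of_real (inner_volume (\<Union>(tiling N \<Phi> U)) \<epsilon>) - (\<Sum>k\<in>visible_integer_dims d S.
         (integer_coeff \<zeta> G \<kappa> k + of_real (fluctuation l G \<kappa> k \<epsilon>)) * of_real \<epsilon> ^ (d - k)))"
  let ?monophase = "\<lambda>S \<epsilon>. dims_expansion \<zeta> T S (visible_dims \<zeta> S) (?coeff \<epsilon>)
      (tubular_zeta N r l G \<kappa> \<epsilon>)
      (of_real (inner_volume (\<Union>(tiling N \<Phi> U)) \<epsilon>)
       - (\<Sum>k\<in>visible_integer_dims d S. integer_coeff \<zeta> G \<kappa> k * of_real \<epsilon> ^ (d - k)))"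
  have first: "?formula S \<epsilon>"
    if S: "screen \<zeta> D S" "S 0 < 0" "simple_visible_poles \<zeta> d S" and \<epsilon>: "\<epsilon> > 0" for S \<epsilon>
  proof (rule expansion[OF S(1,3) _ \<epsilon>])
    show "S 0 \<noteq> real k" for k using S(2) by auto
    show "fluctuation l G \<kappa> k \<epsilon> = 0" if "k \<le> d" "k \<notin> visible_integer_dims d S" for k
      using that S(2) by (auto simp: visible_integer_dims_def window_def)
  qed
  have second: "?formula S \<epsilon> \<and> ?monophase S \<epsilon>"
    if mono: "monophase_representation G \<kappa>"
      and S: "screen \<zeta> D S" "\<forall>k\<in>{0..d}. S 0 \<noteq> real k" "simple_visible_poles \<zeta> d S"
      and \<epsilon>: "\<epsilon> > 0" for S \<epsilon>
  proof -
    have fl: "fluctuation l G \<kappa> k \<epsilon> = 0" if "k \<le> d" for k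
      using monophase_fluctuation_eq_0[OF mono g _ \<epsilon> lp] that d by simp
    have A: "?formula S \<epsilon>"
      by (rule expansion[OF S(1,3) _ \<epsilon> fl]) (use S(2) in auto)
    have tz: "tubular_zeta N r l G \<kappa> \<epsilon> (Complex (S t) t)
        = error_integrand \<zeta> G \<kappa> \<epsilon> (Complex (S t) t)" for t
      unfolding \<zeta>
    proof (rule tubular_zeta_eq_error_integrand[OF N r wd l G(2-4) mono \<epsilon>])
      show "\<not> is_pole (string_zeta N r l) (Complex (S t) t)" using S(1) by (simp add: screen_def \<zeta>)
      show "Complex (S t) t \<notin> of_nat ` {0..DIM('a)}"
      proof
        assume "Complex (S t) t \<in> of_nat ` {0..DIM('a)}"
        then obtain k where k: "k \<in> {0..d}" "Complex (S t) t = of_nat k" using d by auto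
        have t: "t = 0" using arg_cong[OF k(2), of Im] by simp
        have St: "S t = real k" using arg_cong[OF k(2), of Re] by simp
        show False using St S(2) k(1) unfolding t by blast
      qed
    qed
    have sums_eq: "(\<Sum>k\<in>visible_integer_dims d S.
        (integer_coeff \<zeta> G \<kappa> k + of_real (fluctuation l G \<kappa> k \<epsilon>)) * of_real \<epsilon> ^ (d - k))
        = (\<Sum>k\<in>visible_integer_dims d S. integer_coeff \<zeta> G \<kappa> k * of_real \<epsilon> ^ (d - k))"
      by (intro sum.cong refl) (simp add: fl visible_integer_dims_def)
    show ?thesis using A A[unfolded sums_eq] dims_expansion_cong[where S=S
      and f="tubular_zeta N r l G \<kappa> \<epsilon>" and g="error_integrand \<zeta> G \<kappa> \<epsilon>", OF tz] by blast
  qed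
  show ?thesis using first second by blast
qed

end
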